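(* Let $\mathcal{H}=L^2([0,1])\cong L^2([0,\tfrac12])\oplus L^2([\tfrac12,1])$, writing $\Psi=\Psi^-\oplus\Psi^+$. For $\mu\in\mathbb{R}$ let $H(\mu)$ be the operator acting as $-\frac{d^2}{dx^2}$ on each of $[0,\frac12]$ and $[\frac12,1]$ with domain \[ \mathcal{D}(\mu)=\Bigl\{\Psi\in H^2([0,\tfrac12])\oplus H^2([\tfrac12,1]) : \Psi(0)=\Psi(1)=0,\ \Psi^-(\tfrac12)=\Psi^+(\tfrac12),\ \tfrac{d\Psi^-}{dx}(\tfrac12)-\tfrac{d\Psi^+}{dx}(\tfrac12)=\mu\Psi^-(\tfrac12)\Bigr\}. \] Then for any $\varepsilon>0$, any $\Psi_0,\Psi_1\in\mathcal{H}_{\rm even}$ with $\|\Psi_0\|=\|\Psi_1\|$ and any $r>0$, there exists a piecewise constant function $\mu:[0,T]\to[0,r)$ such that the Schrödinger equation for the time-dependent Hamiltonian $H(\mu(t))$ is well-posed and admits a piecewise weak solution $U_\mu(t,s)$ with \[ \|\Psi_1-U_\mu(T,0)\Psi_0\|<\varepsilon. \]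
   Context: $H^k$ denotes the Sobolev space of order $k$ and $H^1_0([0,1])$ the functions in $H^1([0,1])$ vanishing at $0$ and $1$. $H(\mu)$ is self-adjoint and is the operator associated with the closed form $h_0+\mu h_1$ on the form domain $\mathcal{H}^+=H^1_0([0,1])$, where $h_0(\Phi,\Psi)=\int_0^1\overline{\Phi'(x)}\Psi'(x)\,dx$ and $h_1(\Phi,\Psi)=\overline{\Phi(\tfrac12)}\Psi(\tfrac12)$. $\mathcal{H}_{\rm even}$ is the closed span in $L^2([0,1])$ of the Dirichlet eigenfunctions $\Phi_k(x)=\sqrt2\sin(k\pi x)$ with $k$ odd, i.e. the functions symmetric with respect to $x=\tfrac12$. A piecewise weak solution $U_\mu(t,s)$ is a unitary propagator ($U(t,s)U(s,r')=U(t,r')$, $U(t,t)=\mathbb{I}$, jointly strongly continuous) such that on each of finitely many consecutive subintervals of $[0,T]$, for every $\Psi_0\in H^1_0([0,1])$, $\Psi(t)=U_\mu(t,s)\Psi_0$ satisfies $i\frac{d}{dt}\langle\Phi,\Psi(t)\rangle=h_0(\Phi,\Psi(t))+\mu(t)h_1(\Phi,\Psi(t))$ for all $\Phi\in H^1_0([0,1])$.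
   Formalization: H(μ) is taken as the operator of the form h0+μh1, so the jump condition at 1/2 is dΨ⁺/dx − dΨ⁻/dx = μΨ(1/2), the opposite sign to the printed domain, which belongs to h0−μh1; well-posedness is read as existence of the unitary propagator solving the equation. *)

theory Defs
  imports "HOL-Analysis.Analysis"
begin

text \<open>Wave functions on [0,1] are represented by functions real => complex;
  elements of L2([0,1]) are identified up to a.e. equality via the L2 seminorm.\<close>

definition L2 :: "(real \<Rightarrow> complex) \<Rightarrow> bool" where
  "L2 f \<longleftrightarrow> f \<in> borel_measurable (lebesgue_on {0..1}) \<and>
     integrable (lebesgue_on {0..1}) (\<lambda>x. (cmod (f x))\<^sup>2)"

definition l2norm :: "(real \<Rightarrow> complex) \<Rightarrow> real" where
  "l2norm f = sqrt (integral\<^sup>L (lebesgue_on {0..1}) (\<lambda>x. (cmod (f x))\<^sup>2))"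

definition l2inner :: "(real \<Rightarrow> complex) \<Rightarrow> (real \<Rightarrow> complex) \<Rightarrow> complex" where
  "l2inner f g = integral\<^sup>L (lebesgue_on {0..1}) (\<lambda>x. cnj (f x) * g x)"

text \<open>g is a (square integrable) weak derivative of f on [0,1]; f is then
  the absolutely continuous representative.\<close>
definition deriv_rep :: "(real \<Rightarrow> complex) \<Rightarrow> (real \<Rightarrow> complex) \<Rightarrow> bool" where
  "deriv_rep f g \<longleftrightarrow> L2 g \<and>
     (\<forall>x\<in>{0..1}. f x = f 0 + integral\<^sup>L (lebesgue_on {0..x}) g)"

definition H10 :: "(real \<Rightarrow> complex) \<Rightarrow> bool" where
  "H10 f \<longleftrightarrow> (\<exists>g. deriv_rep f g) \<and> f 0 = 0 \<and> f 1 = 0"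

definition wderiv :: "(real \<Rightarrow> complex) \<Rightarrow> (real \<Rightarrow> complex)" where
  "wderiv f = (SOME g. deriv_rep f g)"

definition h0 :: "(real \<Rightarrow> complex) \<Rightarrow> (real \<Rightarrow> complex) \<Rightarrow> complex" where
  "h0 \<Phi> \<Psi> = l2inner (wderiv \<Phi>) (wderiv \<Psi>)"

definition h1 :: "(real \<Rightarrow> complex) \<Rightarrow> (real \<Rightarrow> complex) \<Rightarrow> complex" where
  "h1 \<Phi> \<Psi> = cnj (\<Phi> (1/2)) * \<Psi> (1/2)"

definition H_even :: "(real \<Rightarrow> complex) \<Rightarrow> bool" where
  "H_even f \<longleftrightarrow> L2 f \<and>
     (\<forall>\<delta>>0. \<exists>(n::nat) (c::nat \<Rightarrow> complex).
        l2norm (\<lambda>x. f x - (\<Sum>j<n. c j * complex_of_real (sqrt 2 * sin (real (2*j+1) * pi * x)))) < \<delta>)"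

definition unitary_propagator ::
  "real \<Rightarrow> (real \<Rightarrow> real \<Rightarrow> (real \<Rightarrow> complex) \<Rightarrow> (real \<Rightarrow> complex)) \<Rightarrow> bool" where
  "unitary_propagator T U \<longleftrightarrow>
     (\<forall>t\<in>{0..T}. \<forall>s\<in>{0..T}. \<forall>f. L2 f \<longrightarrow> L2 (U t s f) \<and> l2norm (U t s f) = l2norm f) \<and>
     (\<forall>t\<in>{0..T}. \<forall>s\<in>{0..T}. \<forall>f g a b. L2 f \<longrightarrow> L2 g \<longrightarrow>
        l2norm (\<lambda>x. U t s (\<lambda>y. a * f y + b * g y) x - (a * U t s f x + b * U t s g x)) = 0) \<and>
     (\<forall>t\<in>{0..T}. \<forall>s\<in>{0..T}. \<forall>r\<in>{0..T}. \<forall>f. L2 f \<longrightarrow>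
        l2norm (\<lambda>x. U t s (U s r f) x - U t r f x) = 0) \<and>
     (\<forall>t\<in>{0..T}. \<forall>f. L2 f \<longrightarrow> l2norm (\<lambda>x. U t t f x - f x) = 0) \<and>
     (\<forall>f. L2 f \<longrightarrow> (\<forall>t0\<in>{0..T}. \<forall>s0\<in>{0..T}. \<forall>e>0. \<exists>d>0. \<forall>t\<in>{0..T}. \<forall>s\<in>{0..T}.
        \<bar>t - t0\<bar> < d \<longrightarrow> \<bar>s - s0\<bar> < d \<longrightarrow> l2norm (\<lambda>x. U t s f x - U t0 s0 f x) < e))"

definition piecewise_weak_solution ::
  "real \<Rightarrow> (real \<Rightarrow> real) \<Rightarrow> nat \<Rightarrow> (nat \<Rightarrow> real)
   \<Rightarrow> (real \<Rightarrow> real \<Rightarrow> (real \<Rightarrow> complex) \<Rightarrow> (real \<Rightarrow> complex)) \<Rightarrow> bool" where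
  "piecewise_weak_solution T \<mu> n ts U \<longleftrightarrow>
     unitary_propagator T U \<and>
     (\<forall>j<n. \<forall>s\<in>{ts j..ts (Suc j)}. \<forall>\<Psi>0. H10 \<Psi>0 \<longrightarrow>
        (\<forall>t\<in>{ts j<..<ts (Suc j)}. H10 (U t s \<Psi>0) \<and>
           (\<forall>\<Phi>. H10 \<Phi> \<longrightarrow> (\<exists>D. ((\<lambda>\<tau>. l2inner \<Phi> (U \<tau> s \<Psi>0)) has_vector_derivative D) (at t) \<and>
               \<i> * D = h0 \<Phi> (U t s \<Psi>0) + complex_of_real (\<mu> t) * h1 \<Phi> (U t s \<Psi>0)))))"

definition piecewise_constant_on :: "real \<Rightarrow> (real \<Rightarrow> real) \<Rightarrow> nat \<Rightarrow> (nat \<Rightarrow> real) \<Rightarrow> bool" where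
  "piecewise_constant_on T \<mu> n ts \<longleftrightarrow> ts 0 = 0 \<and> ts n = T \<and> (\<forall>j<n. ts j < ts (Suc j)) \<and>
     (\<forall>j<n. \<exists>c. \<forall>t\<in>{ts j..<ts (Suc j)}. \<mu> t = c)"

end

theory Submission
  imports Defs "HOL-Complex_Analysis.Complex_Analysis"
begin

text \<open>
  The operator of the form \<open>h0 + \<mu> h1\<close> has eigenvalues \<open>\<kappa>\<^sup>2\<close>. In the odd sector \<open>\<kappa> = k \<pi>\<close> with \<open>k\<close>
  even, independently of \<open>\<mu>\<close>. In the even sector \<open>\<kappa> = k \<pi> + \<delta>\<close> with \<open>k\<close> odd and
  \<open>2 \<kappa> tan (\<delta> / 2) = \<mu>\<close>, with eigenfunction \<open>sin (\<kappa> x)\<close> on \<open>[0,1/2]\<close>, reflected at \<open>1/2\<close>.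
  For small \<open>\<mu>\<close> these eigenfunctions are quadratically close to the Fourier sine basis, hence
  complete.

  The even eigenvalues \<open>\<lambda>\<close> are holomorphic in \<open>\<mu>\<close> near \<open>0\<close> and all satisfy
  \<open>\<lambda>' (4 \<lambda> + 4 \<mu> + \<mu>\<^sup>2) = 8 \<lambda>\<close>, so their \<open>n\<close>-th Taylor coefficient is a polynomial of exact degree
  \<open>n - 1\<close> in \<open>1 / \<lambda>(0)\<close>. A Vandermonde argument shows that they are rationally independent
  for all but countably many \<open>\<mu>\<close>. By Kronecker's theorem the free evolution with such a \<open>\<mu>\<close> then
  approximates, on even states, every unitary that multiplies a single eigenvector by a phase.

  For two generic values of \<open>\<mu>\<close>, an eigenvector \<open>v0\<close> of the second operator is orthogonal to no
  even eigenvector of the first one. Phase rotations about \<open>v0\<close> and about finitely many of these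
  leave a finite dimensional space invariant, and a vector of this space that is not yet parallel
  to \<open>v0\<close> can be rotated so as to increase its \<open>v0\<close>-component. Hence every even state can be
  steered to a multiple of \<open>v0\<close>, and back, since phase rotations are invertible.
\<close>

subsection \<open>The Hilbert space of square integrable functions\<close>

text \<open>At a fixed coupling the evolution preserves the modulus of every eigencoefficient, so at
  least two couplings are needed. Zero cannot be one of them: there the eigenvalues
  \<open>(k pi)^2\<close> are rationally dependent and their phases cannot be set independently. The
  antisymmetric eigenvalues keep these resonant values at every coupling; but the antisymmetric
  eigenfunctions do not change with the coupling either, so the evolution never leaves the symmetric
  sector.

  The branches of the shift must exist on one disc around 0 for all \<open>k\<close> at once,
  because all exceptional couplings are removed from a single interval. Hence the estimates uniform
  in \<open>k\<close>. The differential equation does not mention \<open>k\<close>, which enters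
  only through the initial value; this reduces independence of the eigenvalues to that of point
  evaluations of polynomials.

  Running times are positive, so a piece cannot simply be undone, but the rotation by the opposite
  angle is again a limit of forward evolutions. The steering argument takes a supremum that need not
  be attained, so the gain of a rotation has to be bounded below uniformly.\<close>

abbreviation unitI :: "real measure" where "unitI \<equiv> lebesgue_on {0..1}"

lemma finite_measure_unitI: "finite_measure unitI"
  by (rule finite_measure_lebesgue_on) simp

lemma L2_I:
  assumes "f \<in> borel_measurable unitI" "integrable unitI g" "\<And>x. (cmod (f x))\<^sup>2 \<le> g x"
  shows "L2 f"
  unfolding L2_def
proof (intro conjI Bochner_Integration.integrable_bound[OF assms(2)])
  show "AE x in unitI. norm ((cmod (f x))\<^sup>2) \<le> norm (g x)"
    using assms(3) by (intro AE_I2) (smt (verit) real_norm_def zero_le_power2)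
qed (use assms(1) in auto)

lemma cmod_add_sq_le: "(cmod (a + b))\<^sup>2 \<le> 2 * (cmod a)\<^sup>2 + 2 * (cmod b)\<^sup>2"
proof -
  have "(cmod (a + b))\<^sup>2 \<le> (cmod a + cmod b)\<^sup>2"
    by (intro power_mono norm_triangle_ineq) auto
  also have "\<dots> \<le> 2 * (cmod a)\<^sup>2 + 2 * (cmod b)\<^sup>2"
    using sum_squares_bound[of "cmod a" "cmod b"] by (simp add: power2_sum)
  finally show ?thesis .
qed

lemma L2_add: "L2 f \<Longrightarrow> L2 g \<Longrightarrow> L2 (\<lambda>x. f x + g x)"
  by (rule L2_I[where g="\<lambda>x. 2 * (cmod (f x))\<^sup>2 + 2 * (cmod (g x))\<^sup>2"])
     (auto simp: L2_def intro: cmod_add_sq_le)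

lemma L2_cmult: "L2 f \<Longrightarrow> L2 (\<lambda>x. c * f x)"
  by (auto simp: L2_def norm_mult power_mult_distrib)

lemma L2_uminus: "L2 f \<Longrightarrow> L2 (\<lambda>x. - f x)"
  using L2_cmult[of f "-1"] by simp

lemma L2_diff: "L2 f \<Longrightarrow> L2 g \<Longrightarrow> L2 (\<lambda>x. f x - g x)"
  using L2_add[OF _ L2_uminus] by simp

lemma L2_zero: "L2 (\<lambda>_. 0)"
  by (simp add: L2_def)

lemma L2_cnj_mult_integrable:
  assumes "L2 f" "L2 g"
  shows "integrable unitI (\<lambda>x. cnj (f x) * g x)"
proof (rule Bochner_Integration.integrable_bound[where f="\<lambda>x. (cmod (f x))\<^sup>2 + (cmod (g x))\<^sup>2"])
  show "integrable unitI (\<lambda>x. (cmod (f x))\<^sup>2 + (cmod (g x))\<^sup>2)"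
    using assms by (auto simp: L2_def)
  have [measurable]: "f \<in> borel_measurable unitI" "g \<in> borel_measurable unitI"
    using assms by (auto simp: L2_def)
  have "(\<lambda>x. cnj (f x)) \<in> borel_measurable unitI"
    by (intro borel_measurable_continuous_on[of cnj]) (auto intro!: continuous_intros)
  then show "(\<lambda>x. cnj (f x) * g x) \<in> borel_measurable unitI"
    by measurable
  show "AE x in unitI. norm (cnj (f x) * g x) \<le> norm ((cmod (f x))\<^sup>2 + (cmod (g x))\<^sup>2)"
  proof (rule AE_I2)
    fix x
    have "0 \<le> cmod (f x) * cmod (g x)" by simp
    moreover have "2 * cmod (f x) * cmod (g x) \<le> (cmod (f x))\<^sup>2 + (cmod (g x))\<^sup>2"
      by (rule sum_squares_bound)
    ultimately have "cmod (f x) * cmod (g x) \<le> (cmod (f x))\<^sup>2 + (cmod (g x))\<^sup>2" by linarith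
    then show "norm (cnj (f x) * g x) \<le> norm ((cmod (f x))\<^sup>2 + (cmod (g x))\<^sup>2)"
      by (simp add: norm_mult)
  qed
qed

text \<open>Square integrability is built in, so the relation is only a partial equivalence and
  functions outside L2 drop out of the quotient.\<close>

definition l2eq :: "(real \<Rightarrow> complex) \<Rightarrow> (real \<Rightarrow> complex) \<Rightarrow> bool" where
  "l2eq f g \<longleftrightarrow> L2 f \<and> L2 g \<and> (AE x in unitI. f x = g x)"

lemma l2eq_refl [simp]: "l2eq f f \<longleftrightarrow> L2 f"
  by (simp add: l2eq_def)

lemma part_equivp_l2eq: "part_equivp l2eq"
proof (rule part_equivpI)
  show "\<exists>x. l2eq x x" by (auto intro: L2_zero)
  show "symp l2eq" by (auto simp: symp_def l2eq_def)
  show "transp l2eq"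
  proof (rule transpI)
    fix f g h assume "l2eq f g" "l2eq g h"
    then have "L2 f" "L2 h" and 1: "AE x in unitI. f x = g x" and 2: "AE x in unitI. g x = h x"
      by (auto simp: l2eq_def)
    moreover have "AE x in unitI. f x = h x" using 1 2 by eventually_elim auto
    ultimately show "l2eq f h" by (auto simp: l2eq_def)
  qed
qed

quotient_type ltwo = "real \<Rightarrow> complex" / partial: l2eq
  by (rule part_equivp_l2eq)

lemma l2eq_inner_cong:
  assumes "l2eq f f'" "l2eq g g'"
  shows "l2inner f g = l2inner f' g'"
  unfolding l2inner_def
proof (rule integral_cong_AE)
  have "L2 f" "L2 f'" "L2 g" "L2 g'" using assms by (auto simp: l2eq_def)
  then show "(\<lambda>x. cnj (f x) * g x) \<in> borel_measurable unitI" "(\<lambda>x. cnj (f' x) * g' x) \<in> borel_measurable unitI"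
    by (auto intro: borel_measurable_integrable L2_cnj_mult_integrable)
  have "AE x in unitI. f x = f' x" "AE x in unitI. g x = g' x" using assms by (auto simp: l2eq_def)
  then show "AE x in unitI. cnj (f x) * g x = cnj (f' x) * g' x"
    by eventually_elim auto
qed

lift_definition cinn :: "ltwo \<Rightarrow> ltwo \<Rightarrow> complex" is l2inner
  by (rule l2eq_inner_cong)

lift_definition csc :: "complex \<Rightarrow> ltwo \<Rightarrow> ltwo" is "\<lambda>c f x. c * f x"
  by (auto simp: l2eq_def intro: L2_cmult)

lemma l2inner_add_right:
  "L2 f \<Longrightarrow> L2 g \<Longrightarrow> L2 h \<Longrightarrow> l2inner f (\<lambda>x. g x + h x) = l2inner f g + l2inner f h"
  by (simp add: l2inner_def distrib_left L2_cnj_mult_integrable)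

lemma l2inner_mult_right: "l2inner f (\<lambda>x. c * g x) = c * l2inner f g"
  by (simp add: l2inner_def algebra_simps flip: integral_mult_right_zero)

lemma l2inner_cnj: "cnj (l2inner f g) = l2inner g f"
  unfolding l2inner_def by (subst Bochner_Integration.integral_cnj[symmetric]) (simp add: mult.commute)

lemma l2inner_self: "l2inner f f = of_real ((l2norm f)\<^sup>2)"
proof -
  have "l2inner f f = integral\<^sup>L unitI (\<lambda>x. complex_of_real ((cmod (f x))\<^sup>2))"
    unfolding l2inner_def by (intro Bochner_Integration.integral_cong) (auto simp: complex_norm_square mult.commute simp del: of_real_power)
  also have "\<dots> = of_real (integral\<^sup>L unitI (\<lambda>x. (cmod (f x))\<^sup>2))"
    by (rule integral_complex_of_real)
  also have "\<dots> = of_real ((l2norm f)\<^sup>2)"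
    by (simp add: l2norm_def)
  finally show ?thesis .
qed

lemma l2norm_eq_0_iff:
  assumes "L2 f" shows "l2norm f = 0 \<longleftrightarrow> (AE x in unitI. f x = 0)"
  using assms unfolding l2norm_def L2_def by (simp add: integral_nonneg_eq_0_iff_AE)

text \<open>The real structure carries only the real part of \<open>cinn\<close>. It gives access to
  norms, limits and series of real inner product spaces, while complex scalars act through
  \<open>csc\<close>.\<close>

instantiation ltwo :: real_inner
begin

lift_definition zero_ltwo :: ltwo is "\<lambda>_. 0" by (simp add: L2_zero)

lift_definition plus_ltwo :: "ltwo \<Rightarrow> ltwo \<Rightarrow> ltwo" is "\<lambda>f g x. f x + g x"
proof -
  fix f f' g g' assume *: "l2eq f f'" "l2eq g g'"
  then have "AE x in unitI. f x = f' x" "AE x in unitI. g x = g' x" by (auto simp: l2eq_def)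
  then have "AE x in unitI. f x + g x = f' x + g' x" by eventually_elim auto
  with * show "l2eq (\<lambda>x. f x + g x) (\<lambda>x. f' x + g' x)" by (auto simp: l2eq_def intro: L2_add)
qed

lift_definition minus_ltwo :: "ltwo \<Rightarrow> ltwo \<Rightarrow> ltwo" is "\<lambda>f g x. f x - g x"
proof -
  fix f f' g g' assume *: "l2eq f f'" "l2eq g g'"
  then have "AE x in unitI. f x = f' x" "AE x in unitI. g x = g' x" by (auto simp: l2eq_def)
  then have "AE x in unitI. f x - g x = f' x - g' x" by eventually_elim auto
  with * show "l2eq (\<lambda>x. f x - g x) (\<lambda>x. f' x - g' x)" by (auto simp: l2eq_def intro: L2_diff)
qed

lift_definition uminus_ltwo :: "ltwo \<Rightarrow> ltwo" is "\<lambda>f x. - f x"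
  by (auto simp: l2eq_def intro: L2_uminus)

definition "scaleR_ltwo (r::real) (u::ltwo) = csc (complex_of_real r) u"
definition "inner_ltwo (u::ltwo) (v::ltwo) = Re (cinn u v)"
definition "norm_ltwo (u::ltwo) = sqrt (inner u u)"
definition "sgn_ltwo (u::ltwo) = inverse (norm u) *\<^sub>R u"
definition "dist_ltwo (u::ltwo) (v::ltwo) = norm (u - v)"
definition [code del]: "(uniformity :: (ltwo \<times> ltwo) filter) = (INF e\<in>{0 <..}. principal {(x, y). dist x y < e})"
definition [code del]: "open_ltwo (U :: ltwo set) \<longleftrightarrow> (\<forall>x\<in>U. eventually (\<lambda>(x', y). x' = x \<longrightarrow> y \<in> U) uniformity)"

instance
proof
  fix u v w :: ltwo and a b r :: real
  show "u + v + w = u + (v + w)" by transfer (auto simp: add.assoc intro!: L2_add)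
  show "u + v = v + u" by transfer (auto simp: add.commute intro!: L2_add)
  show "0 + u = u" by transfer auto
  show "- u + u = 0" by transfer (auto simp: L2_zero)
  show "u - v = u + - v" by transfer (auto intro!: L2_diff)
  show "a *\<^sub>R (u + v) = a *\<^sub>R u + a *\<^sub>R v" unfolding scaleR_ltwo_def
    by transfer (auto simp: distrib_left intro!: L2_add L2_cmult)
  show "(a + b) *\<^sub>R u = a *\<^sub>R u + b *\<^sub>R u" unfolding scaleR_ltwo_def
    by transfer (auto simp: distrib_right intro!: L2_add L2_cmult)
  show "a *\<^sub>R b *\<^sub>R u = (a * b) *\<^sub>R u" unfolding scaleR_ltwo_def
    by transfer (auto simp: mult.assoc intro!: L2_cmult)
  show "1 *\<^sub>R u = u" unfolding scaleR_ltwo_def by transfer auto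
  show "dist u v = norm (u - v)" by (simp add: dist_ltwo_def)
  show "sgn u = inverse (norm u) *\<^sub>R u" by (simp add: sgn_ltwo_def)
  show "inner u v = inner v u" unfolding inner_ltwo_def
    by transfer (metis cnj.simps(1) l2inner_cnj)
  show "inner (u + v) w = inner u w + inner v w" unfolding inner_ltwo_def
  proof transfer
    fix f g h assume *: "l2eq f f" "l2eq g g" "l2eq h h"
    have "Re (l2inner (\<lambda>x. f x + g x) h) = Re (l2inner h (\<lambda>x. f x + g x))"
      by (metis cnj.simps(1) l2inner_cnj)
    also have "\<dots> = Re (l2inner h f) + Re (l2inner h g)"
      using * by (simp add: l2inner_add_right)
    also have "\<dots> = Re (l2inner f h) + Re (l2inner g h)"
      by (metis cnj.simps(1) l2inner_cnj)
    finally show "Re (l2inner (\<lambda>x. f x + g x) h) = Re (l2inner f h) + Re (l2inner g h)" .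
  qed
  show "inner (r *\<^sub>R u) v = r * inner u v" unfolding inner_ltwo_def scaleR_ltwo_def
  proof transfer
    fix c f g
    have "Re (l2inner (\<lambda>x. complex_of_real c * f x) g) = Re (l2inner g (\<lambda>x. complex_of_real c * f x))"
      by (metis cnj.simps(1) l2inner_cnj)
    also have "\<dots> = c * Re (l2inner g f)" by (simp add: l2inner_mult_right)
    also have "\<dots> = c * Re (l2inner f g)" by (metis cnj.simps(1) l2inner_cnj)
    finally show "Re (l2inner (\<lambda>x. complex_of_real c * f x) g) = c * Re (l2inner f g)" .
  qed
  show "0 \<le> inner u u" unfolding inner_ltwo_def
    by transfer (simp add: l2inner_self)
  show "inner u u = 0 \<longleftrightarrow> u = 0" unfolding inner_ltwo_def
    by transfer (auto simp: l2inner_self l2norm_eq_0_iff l2eq_def L2_zero)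
  show "norm u = sqrt (inner u u)" by (simp add: norm_ltwo_def)
  show "(uniformity :: (ltwo \<times> ltwo) filter) = (INF e\<in>{0 <..}. principal {(x, y). dist x y < e})"
    by (simp add: uniformity_ltwo_def)
  show "open U \<longleftrightarrow> (\<forall>x\<in>U. eventually (\<lambda>(x', y). x' = x \<longrightarrow> y \<in> U) uniformity)" for U :: "ltwo set"
    by (simp add: open_ltwo_def)
qed

end

abbreviation cls :: "(real \<Rightarrow> complex) \<Rightarrow> ltwo" where "cls \<equiv> abs_ltwo"

lemma L2_rep [simp]: "L2 (rep_ltwo u)"
  using Quotient3_rep_reflp[OF Quotient3_ltwo, of u] by simp

lemma cls_rep [simp]: "cls (rep_ltwo u) = u"
  by (rule Quotient3_abs_rep[OF Quotient3_ltwo])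

lemma cls_eq_iff: "L2 f \<Longrightarrow> L2 g \<Longrightarrow> cls f = cls g \<longleftrightarrow> (AE x in unitI. f x = g x)"
  using Quotient3_rel[OF Quotient3_ltwo, of f g] by (simp add: l2eq_def)

lemma cls_zero: "0 = cls (\<lambda>_. 0)"
  by (simp add: zero_ltwo_def)

lemma cls_add: "L2 f \<Longrightarrow> L2 g \<Longrightarrow> cls (\<lambda>x. f x + g x) = cls f + cls g"
  by (simp add: plus_ltwo.abs_eq)

lemma cls_diff: "L2 f \<Longrightarrow> L2 g \<Longrightarrow> cls (\<lambda>x. f x - g x) = cls f - cls g"
  by (simp add: minus_ltwo.abs_eq)

lemma cls_csc: "L2 f \<Longrightarrow> cls (\<lambda>x. c * f x) = csc c (cls f)"
  by (simp add: csc.abs_eq)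

lemma cinn_cls: "L2 f \<Longrightarrow> L2 g \<Longrightarrow> cinn (cls f) (cls g) = l2inner f g"
  by (simp add: cinn.abs_eq)

lemma norm_cls: "L2 f \<Longrightarrow> norm (cls f) = l2norm f"
  by (simp add: norm_ltwo_def inner_ltwo_def cinn_cls l2inner_self) (simp add: l2norm_def)

lemma cinn_commute: "cnj (cinn u v) = cinn v u"
  by transfer (simp add: l2inner_cnj)

lemma cinn_add_right: "cinn u (v + w) = cinn u v + cinn u w"
  by transfer (simp add: l2inner_add_right)

lemma cinn_csc_right: "cinn u (csc c v) = c * cinn u v"
  by transfer (simp add: l2inner_mult_right)

lemma cinn_csc_left: "cinn (csc c u) v = cnj c * cinn u v"
  by (metis cinn_commute cinn_csc_right complex_cnj_mult)

lemma csc_add_right: "csc c (u + v) = csc c u + csc c v"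
  by transfer (auto simp: distrib_left intro!: L2_add L2_cmult)

lemma csc_add_left: "csc (c + d) u = csc c u + csc d u"
  by transfer (auto simp: distrib_right intro!: L2_add L2_cmult)

lemma csc_csc: "csc c (csc d u) = csc (c * d) u"
  by transfer (auto simp: mult.assoc intro!: L2_cmult)

lemma csc_one [simp]: "csc 1 u = u"
  by transfer auto

lemma csc_of_real: "csc (of_real r) u = r *\<^sub>R u"
  by (simp add: scaleR_ltwo_def)

lemma csc_zero_left [simp]: "csc 0 u = 0"
  using csc_of_real[of 0 u] by simp

lemma csc_minus_left: "csc (- c) u = - csc c u"
  using csc_add_left[of "-c" c u] by (simp add: eq_neg_iff_add_eq_0)

lemma csc_diff_left: "csc (c - d) u = csc c u - csc d u"
  using csc_add_left[of c "-d" u] by (simp add: csc_minus_left)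

lemma cinn_self: "cinn u u = of_real ((norm u)\<^sup>2)"
  unfolding norm_ltwo_def inner_ltwo_def
  by transfer (simp add: l2inner_self)

lemma norm_csc: "norm (csc c u) = cmod c * norm u"
proof -
  have "complex_of_real ((norm (csc c u))\<^sup>2) = of_real ((cmod c * norm u)\<^sup>2)"
    unfolding cinn_self[symmetric] cinn_csc_left cinn_csc_right
    by (simp add: cinn_self power_mult_distrib complex_norm_square[symmetric] mult.assoc[symmetric] mult.commute[of "cnj c"] del: of_real_power)
  then have "(norm (csc c u))\<^sup>2 = (cmod c * norm u)\<^sup>2"
    using of_real_eq_iff by blast
  then show ?thesis by (simp add: power2_eq_iff_nonneg)
qed

lemma bounded_linear_csc: "bounded_linear (csc c)"
proof (rule bounded_linear_intro[where K="cmod c"])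
  fix r u show "csc c (r *\<^sub>R u) = r *\<^sub>R csc c u"
    by (simp add: csc_csc mult.commute flip: csc_of_real)
qed (auto simp: csc_add_right norm_csc mult.commute)

text \<open>The real inequality suffices: multiplying \<open>v\<close> by a unit scalar makes
  \<open>cinn u v\<close> real and nonnegative.\<close>

lemma cinn_Cauchy_Schwarz: "cmod (cinn u v) \<le> norm u * norm v"
proof (cases "cinn u v = 0")
  case False
  define c where "c = cnj (sgn (cinn u v))"
  have c: "cmod c = 1" using False by (simp add: c_def norm_sgn)
  have "cinn u (csc c v) = of_real (cmod (cinn u v))"
  proof -
    have "cinn u v * cnj (cinn u v) = of_real (cmod (cinn u v)) * of_real (cmod (cinn u v))"
      using complex_norm_square[of "cinn u v"] by (simp add: power2_eq_square)
    then show ?thesis using False by (simp add: cinn_csc_right c_def sgn_eq field_simps)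
  qed
  then have "cmod (cinn u v) = inner u (csc c v)" by (simp add: inner_ltwo_def)
  also have "\<dots> \<le> norm u * norm (csc c v)" by (rule norm_cauchy_schwarz)
  finally show ?thesis by (simp add: norm_csc c)
qed simp

lemma bounded_linear_cinn: "bounded_linear (cinn u)"
proof (rule bounded_linear_intro[where K="norm u"])
  fix r v show "cinn u (r *\<^sub>R v) = r *\<^sub>R cinn u v"
    by (simp add: cinn_csc_right scaleR_conv_of_real flip: csc_of_real)
next
  fix v show "norm (cinn u v) \<le> norm v * norm u" using cinn_Cauchy_Schwarz[of u v] by (simp add: mult.commute)
qed (rule cinn_add_right)

lemmas cinn_zero_right [simp] = linear_0[OF bounded_linear.linear[OF bounded_linear_cinn]]
lemmas cinn_diff_right = linear_diff[OF bounded_linear.linear[OF bounded_linear_cinn]]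
lemmas cinn_sum_right = linear_sum[OF bounded_linear.linear[OF bounded_linear_cinn]]
lemmas csc_zero_right [simp] = linear_0[OF bounded_linear.linear[OF bounded_linear_csc]]
lemmas csc_diff_right = linear_diff[OF bounded_linear.linear[OF bounded_linear_csc]]
lemmas csc_sum_right = linear_sum[OF bounded_linear.linear[OF bounded_linear_csc]]

lemma cinn_zero_left [simp]: "cinn 0 u = 0"
  by (metis cinn_commute cinn_zero_right complex_cnj_zero)

lemma cinn_diff_left: "cinn (u - v) w = cinn u w - cinn v w"
  by (metis cinn_commute cinn_diff_right complex_cnj_diff)

lemma cinn_sum_left: "cinn (sum f A) w = (\<Sum>i\<in>A. cinn (f i) w)"
  by (subst (1 2) cinn_commute[symmetric]) (simp add: cinn_sum_right)

lemma norm_add_sq: "(norm (u + v))\<^sup>2 = (norm u)\<^sup>2 + (norm v)\<^sup>2 + 2 * Re (cinn u v)" for u v :: ltwo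
  by (simp add: power2_norm_eq_inner inner_add_left inner_add_right inner_commute[of v u]) (simp add: inner_ltwo_def)

lemma norm_diff_sq: "(norm (u - v))\<^sup>2 = (norm u)\<^sup>2 + (norm v)\<^sup>2 - 2 * Re (cinn u v)" for u v :: ltwo
  by (simp add: power2_norm_eq_inner inner_diff_left inner_diff_right inner_commute[of v u]) (simp add: inner_ltwo_def)

section \<open>Norm bounds on the unit interval and completeness\<close>

lemma L2_bounded:
  assumes "f \<in> borel_measurable unitI" "\<And>x. x \<in> {0..1} \<Longrightarrow> cmod (f x) \<le> B"
  shows "L2 f" and "l2norm f \<le> B"
proof -
  interpret finite_measure unitI by (rule finite_measure_unitI)
  have B: "(cmod (f x))\<^sup>2 \<le> B\<^sup>2" if "x \<in> {0..1}" for x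
    using assms(2)[OF that] by (intro power_mono) auto
  have int: "integrable unitI (\<lambda>x. (cmod (f x))\<^sup>2)"
    using assms(1) B by (intro integrable_const_bound[where B="B\<^sup>2"] AE_I2) auto
  then show "L2 f" using assms by (simp add: L2_def)
  have "B \<ge> 0" using order_trans[OF norm_ge_zero assms(2)[of 0]] by simp
  have "integral\<^sup>L unitI (\<lambda>x. (cmod (f x))\<^sup>2) \<le> integral\<^sup>L unitI (\<lambda>x. B\<^sup>2)"
    using int B by (intro integral_mono) auto
  also have "\<dots> = B\<^sup>2" by (simp add: measure_restrict_space)
  finally show "l2norm f \<le> B" using \<open>B \<ge> 0\<close> by (simp add: l2norm_def real_le_lsqrt)
qed

lemma L2_integrable:
  assumes "L2 f"
  shows "integrable unitI f" and "integral\<^sup>L unitI (\<lambda>x. cmod (f x)) \<le> l2norm f"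
proof -
  let ?o = "\<lambda>x::real. 1::complex" and ?a = "\<lambda>x. complex_of_real (cmod (f x))"
  have o: "L2 ?o" and o': "l2norm ?o \<le> 1" by (auto intro: L2_bounded)
  have a: "L2 ?a" using assms by (auto simp: L2_def)
  have a': "l2norm ?a = l2norm f" by (simp add: l2norm_def)
  show "integrable unitI f" using L2_cnj_mult_integrable[OF o assms] by simp
  have "integral\<^sup>L unitI (\<lambda>x. cmod (f x)) = cmod (l2inner ?o ?a)"
    by (simp add: l2inner_def)
  also have "\<dots> \<le> l2norm ?o * l2norm ?a"
    using cinn_Cauchy_Schwarz[of "cls ?o" "cls ?a"] by (simp add: cinn_cls norm_cls o a)
  also have "\<dots> \<le> 1 * l2norm f"
    unfolding a' using o' by (intro mult_right_mono) (auto simp: l2norm_def)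
  finally show "integral\<^sup>L unitI (\<lambda>x. cmod (f x)) \<le> l2norm f" by simp
qed

text \<open>On a probability space the L1 norm is at most the L2 norm, so the sum of the moduli has
  finite integral. This yields pointwise limits of rapidly converging sequences.\<close>

lemma AE_summable_of_geometric:
  fixes D :: "nat \<Rightarrow> real \<Rightarrow> complex"
  assumes D: "\<And>k. L2 (D k)" and b: "\<And>k. l2norm (D k) \<le> (1/2)^k"
  shows "AE x in unitI. summable (\<lambda>k. cmod (D k x))"
proof -
  have [measurable]: "D k \<in> borel_measurable unitI" for k using D by (simp add: L2_def)
  have "(\<integral>\<^sup>+x. (\<Sum>k. ennreal (cmod (D k x))) \<partial>unitI) = (\<Sum>k. \<integral>\<^sup>+x. ennreal (cmod (D k x)) \<partial>unitI)"
    by (intro nn_integral_suminf) auto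
  also have "\<dots> \<le> (\<Sum>k. ennreal ((1/2)^k))"
  proof (intro suminf_le)
    fix k
    have "(\<integral>\<^sup>+x. ennreal (cmod (D k x)) \<partial>unitI) = ennreal (integral\<^sup>L unitI (\<lambda>x. cmod (D k x)))"
      using L2_integrable(1)[OF D] by (intro nn_integral_eq_integral) auto
    also have "\<dots> \<le> ennreal ((1/2)^k)"
      using L2_integrable(2)[OF D[of k]] b[of k] by (intro ennreal_leI) linarith
    finally show "(\<integral>\<^sup>+x. ennreal (cmod (D k x)) \<partial>unitI) \<le> ennreal ((1/2)^k)" .
  qed auto
  also have "\<dots> < \<infinity>"
    by (subst suminf_ennreal_eq[OF _ geometric_sums]) auto
  finally have "AE x in unitI. (\<Sum>k. ennreal (cmod (D k x))) \<noteq> \<infinity>"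
    by (intro nn_integral_noteq_infinite) auto
  then show ?thesis
  proof eventually_elim
    case (elim x)
    then show ?case by (intro summable_suminf_not_top) auto
  qed
qed

text \<open>Fatou's lemma carries the bound on \<open>F k - F m\<close> over to the pointwise
  limit.\<close>

lemma L2_limit:
  fixes F :: "nat \<Rightarrow> real \<Rightarrow> complex"
  assumes F: "\<And>k. L2 (F k)" and f: "f \<in> borel_measurable unitI"
    and lim: "AE x in unitI. (\<lambda>k. F k x) \<longlonglongrightarrow> f x"
    and b: "\<And>k. k \<ge> m \<Longrightarrow> l2norm (\<lambda>x. F k x - F m x) \<le> B"
  shows "L2 f" "l2norm (\<lambda>x. f x - F m x) \<le> B"
proof -
  have [measurable]: "F k \<in> borel_measurable unitI" for k using F by (simp add: L2_def)
  note f[measurable]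
  have B: "B \<ge> 0" using b[of m] by (simp add: l2norm_def)
  have "(\<integral>\<^sup>+x. ennreal ((cmod (f x - F m x))\<^sup>2) \<partial>unitI)
      \<le> (\<integral>\<^sup>+x. liminf (\<lambda>k. ennreal ((cmod (F k x - F m x))\<^sup>2)) \<partial>unitI)"
  proof (rule nn_integral_mono_AE)
    show "AE x in unitI. ennreal ((cmod (f x - F m x))\<^sup>2) \<le> liminf (\<lambda>k. ennreal ((cmod (F k x - F m x))\<^sup>2))"
      using lim
    proof eventually_elim
      case (elim x)
      then have "(\<lambda>k. ennreal ((cmod (F k x - F m x))\<^sup>2)) \<longlonglongrightarrow> ennreal ((cmod (f x - F m x))\<^sup>2)"
        by (intro tendsto_ennrealI tendsto_intros)
      from lim_imp_Liminf[OF _ this] show ?case by simp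
    qed
  qed
  also have "\<dots> \<le> liminf (\<lambda>k. \<integral>\<^sup>+x. ennreal ((cmod (F k x - F m x))\<^sup>2) \<partial>unitI)"
    by (rule nn_integral_liminf) auto
  also have "\<dots> \<le> liminf (\<lambda>k. ennreal (B\<^sup>2))"
  proof (rule Liminf_mono)
    show "\<forall>\<^sub>F k in sequentially. (\<integral>\<^sup>+x. ennreal ((cmod (F k x - F m x))\<^sup>2) \<partial>unitI) \<le> ennreal (B\<^sup>2)"
      using eventually_ge_at_top[of m]
    proof eventually_elim
      case (elim k)
      have "(\<integral>\<^sup>+x. ennreal ((cmod (F k x - F m x))\<^sup>2) \<partial>unitI) = ennreal (integral\<^sup>L unitI (\<lambda>x. (cmod (F k x - F m x))\<^sup>2))"
        using L2_diff[OF F F, of k m] by (intro nn_integral_eq_integral) (auto simp: L2_def)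
      also have "\<dots> \<le> ennreal (B\<^sup>2)"
      proof (rule ennreal_leI)
        have "sqrt (integral\<^sup>L unitI (\<lambda>x. (cmod (F k x - F m x))\<^sup>2)) \<le> B"
          using b[OF elim] by (simp add: l2norm_def)
        then show "integral\<^sup>L unitI (\<lambda>x. (cmod (F k x - F m x))\<^sup>2) \<le> B\<^sup>2"
          by (rule sqrt_le_D)
      qed
      finally show ?case .
    qed
  qed
  also have "\<dots> = ennreal (B\<^sup>2)" by (rule Liminf_const) simp
  finally have le: "(\<integral>\<^sup>+x. ennreal ((cmod (f x - F m x))\<^sup>2) \<partial>unitI) \<le> ennreal (B\<^sup>2)" .
  have int: "integrable unitI (\<lambda>x. (cmod (f x - F m x))\<^sup>2)"
  proof (rule integrableI_bounded)
    show "(\<integral>\<^sup>+x. ennreal (norm ((cmod (f x - F m x))\<^sup>2)) \<partial>unitI) < \<infinity>"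
      using le by (simp add: le_less_trans)
  qed auto
  have 1: "L2 (\<lambda>x. f x - F m x)" using int by (simp add: L2_def)
  then show "L2 f" using L2_add[OF 1 F[of m]] by simp
  have "ennreal (integral\<^sup>L unitI (\<lambda>x. (cmod (f x - F m x))\<^sup>2)) \<le> ennreal (B\<^sup>2)"
    using le by (subst (asm) nn_integral_eq_integral[OF int]) auto
  then have "integral\<^sup>L unitI (\<lambda>x. (cmod (f x - F m x))\<^sup>2) \<le> B\<^sup>2"
    by (simp add: ennreal_le_iff)
  then show "l2norm (\<lambda>x. f x - F m x) \<le> B" using B by (simp add: l2norm_def real_le_lsqrt)
qed

instance ltwo :: banach
proof
  fix X :: "nat \<Rightarrow> ltwo" assume "Cauchy X"
  then have "\<exists>N. \<forall>m\<ge>N. \<forall>n\<ge>N. norm (X m - X n) < (1/2)^k" for k :: nat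
    unfolding Cauchy_iff by simp
  then obtain N where N: "\<And>k m n. m \<ge> N k \<Longrightarrow> n \<ge> N k \<Longrightarrow> norm (X m - X n) < (1/2)^k" by metis
  \<comment> \<open>The partial sums dominate every earlier \<open>N\<close>, so consecutive terms
    of \<open>X (r k)\<close> are geometrically close.\<close>
  define r where "r k = (\<Sum>i\<le>k. N i)" for k :: nat
  have rN: "r k \<ge> N m" if "m \<le> k" for k m
    unfolding r_def using that by (intro member_le_sum) auto
  define F where "F k = rep_ltwo (X (r k))" for k
  have F: "L2 (F k)" and clsF: "cls (F k) = X (r k)" for k by (auto simp: F_def)
  have FF: "l2norm (\<lambda>x. F k x - F m x) \<le> (1/2)^m" if "m \<le> k" for k m
    using N[OF rN[OF that] rN[OF order_refl]] by (simp add: norm_cls[symmetric] cls_diff L2_diff F clsF less_imp_le)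
  \<comment> \<open>\<open>lim\<close> is measurable whether or not the sequence converges at
    \<open>x\<close>.\<close>
  define f where "f x = lim (\<lambda>k. F k x)" for x
  have [measurable]: "F k \<in> borel_measurable unitI" for k using F by (simp add: L2_def)
  have f: "f \<in> borel_measurable unitI" unfolding f_def by measurable
  have "AE x in unitI. summable (\<lambda>k. cmod (F (Suc k) x - F k x))"
    using FF by (intro AE_summable_of_geometric L2_diff F) auto
  then have lim: "AE x in unitI. (\<lambda>k. F k x) \<longlonglongrightarrow> f x"
  proof eventually_elim
    case (elim x)
    then have "summable (\<lambda>k. F (Suc k) x - F k x)" by (rule summable_norm_cancel)
    then have "(\<lambda>n. \<Sum>k<n. F (Suc k) x - F k x) \<longlonglongrightarrow> (\<Sum>k. F (Suc k) x - F k x)" by (rule summable_LIMSEQ)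
    then have "(\<lambda>n. F n x - F 0 x) \<longlonglongrightarrow> (\<Sum>k. F (Suc k) x - F k x)" by (simp only: sum_lessThan_telescope[of "\<lambda>k. F k x"])
    from tendsto_add[OF this tendsto_const[of "F 0 x"]]
    have "convergent (\<lambda>n. F n x)" by (auto simp: convergent_def)
    then show ?case by (simp add: f_def convergent_LIMSEQ_iff)
  qed
  note lims = L2_limit[OF F f lim FF]
  have L: "L2 f" by (rule lims(1))
  have b: "norm (cls f - X (r m)) \<le> (1/2)^m" for m
    using lims(2)[of m] by (simp add: norm_cls[symmetric] cls_diff L2_diff F clsF L)
  have "X \<longlonglongrightarrow> cls f"
  proof (rule LIMSEQ_I)
    fix e :: real assume "e > 0"
    then obtain k where k: "(1/2)^k < e / 2" using real_arch_pow_inv[of "e/2" "1/2"] by auto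
    have "norm (X n - cls f) < e" if "n \<ge> N k" for n
      using N[OF that rN[OF order_refl]] b[of k] k norm_triangle_ineq[of "X n - X (r k)" "X (r k) - cls f"]
      by (simp add: norm_minus_commute)
    then show "\<exists>no. \<forall>n\<ge>no. norm (X n - cls f) < e" by blast
  qed
  then show "convergent X" by (auto simp: convergent_def)
qed

subsection \<open>Orthonormal bases and unitary groups\<close>

definition orthonormal :: "(nat \<Rightarrow> ltwo) \<Rightarrow> bool" where
  "orthonormal e \<longleftrightarrow> (\<forall>i j. cinn (e i) (e j) = (if i = j then 1 else 0))"

text \<open>Totality is stated in the form in which completeness of eigenfunctions gets proved;
  completeness of the space turns it into the expansion \<open>onb_expansion\<close>.\<close>

definition onb :: "(nat \<Rightarrow> ltwo) \<Rightarrow> bool" where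
  "onb e \<longleftrightarrow> orthonormal e \<and> (\<forall>u. (\<forall>i. cinn (e i) u = 0) \<longrightarrow> u = 0)"

lemma orthonormal_cinn: "orthonormal e \<Longrightarrow> cinn (e i) (e j) = (if i = j then 1 else 0)"
  by (simp add: orthonormal_def)

lemma orthonormal_norm: "orthonormal e \<Longrightarrow> norm (e i) = 1"
  using cinn_self[of "e i"] norm_ge_zero[of "e i"]
  by (simp add: orthonormal_cinn) (metis of_real_eq_1_iff of_real_power power2_eq_1_iff norm_ge_zero not_one_le_zero neg_0_le_iff_le)

lemma cinn_sum_orthonormal:
  assumes "orthonormal e" "finite A"
  shows "cinn (e j) (\<Sum>i\<in>A. csc (c i) (e i)) = (if j \<in> A then c j else 0)"
  using assms by (simp add: cinn_sum_right cinn_csc_right orthonormal_cinn if_distrib cong: if_cong)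

lemma norm_sum_orthonormal:
  assumes "orthonormal e" "finite A"
  shows "(norm (\<Sum>i\<in>A. csc (c i) (e i)))\<^sup>2 = (\<Sum>i\<in>A. (cmod (c i))\<^sup>2)"
proof -
  have "complex_of_real ((norm (\<Sum>i\<in>A. csc (c i) (e i)))\<^sup>2) = (\<Sum>i\<in>A. cnj (c i) * c i)"
    unfolding cinn_self[symmetric]
    by (subst cinn_sum_left) (simp add: cinn_csc_left cinn_sum_orthonormal[OF assms])
  also have "\<dots> = of_real (\<Sum>i\<in>A. (cmod (c i))\<^sup>2)"
    by (simp add: complex_norm_square mult.commute del: of_real_power)
  finally show ?thesis by (simp only: of_real_eq_iff)
qed

lemma cinn_partial_sum:
  "cinn u (\<Sum>i\<in>A. csc (cinn (e i) u) (e i)) = of_real (\<Sum>i\<in>A. (cmod (cinn (e i) u))\<^sup>2)"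
  by (simp add: cinn_sum_right cinn_csc_right complex_norm_square cinn_commute del: of_real_power)

lemma bessel:
  assumes "orthonormal e" "finite A"
  shows "(\<Sum>i\<in>A. (cmod (cinn (e i) u))\<^sup>2) \<le> (norm u)\<^sup>2"
proof -
  have "0 \<le> (norm (u - (\<Sum>i\<in>A. csc (cinn (e i) u) (e i))))\<^sup>2" by simp
  then show ?thesis
    unfolding norm_diff_sq norm_sum_orthonormal[OF assms] cinn_partial_sum by simp
qed

lemma summable_coeffs:
  assumes "orthonormal e" shows "summable (\<lambda>i. (cmod (cinn (e i) u))\<^sup>2)"
  by (rule summableI_nonneg_bounded[where x="(norm u)\<^sup>2"]) (auto intro: bessel[OF assms])

lemma summable_csc:
  assumes "orthonormal e" "summable (\<lambda>i. (cmod (c i))\<^sup>2)"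
  shows "summable (\<lambda>i. csc (c i) (e i))"
  unfolding summable_Cauchy
proof (intro allI impI)
  fix \<epsilon> :: real assume "\<epsilon> > 0"
  then have "\<epsilon>\<^sup>2 > 0" by simp
  then obtain N where N: "\<And>m n. m \<ge> N \<Longrightarrow> norm (\<Sum>i\<in>{m..<n}. (cmod (c i))\<^sup>2) < \<epsilon>\<^sup>2"
    using assms(2) unfolding summable_Cauchy by blast
  have "norm (\<Sum>i\<in>{m..<n}. csc (c i) (e i)) < \<epsilon>" if "m \<ge> N" for m n
  proof (rule power2_less_imp_less)
    show "(norm (\<Sum>i\<in>{m..<n}. csc (c i) (e i)))\<^sup>2 < \<epsilon>\<^sup>2"
      using N[OF that, of n] by (simp add: norm_sum_orthonormal[OF assms(1)])
  qed (use \<open>\<epsilon> > 0\<close> in simp)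
  then show "\<exists>N. \<forall>m\<ge>N. \<forall>n. norm (\<Sum>i\<in>{m..<n}. csc (c i) (e i)) < \<epsilon>" by blast
qed

lemma coeff_suminf:
  assumes "orthonormal e" "summable (\<lambda>i. (cmod (c i))\<^sup>2)"
  shows "cinn (e j) (\<Sum>i. csc (c i) (e i)) = c j"
proof -
  have "cinn (e j) (\<Sum>i. csc (c i) (e i)) = (\<Sum>i. cinn (e j) (csc (c i) (e i)))"
    by (rule bounded_linear.suminf[OF bounded_linear_cinn summable_csc[OF assms]])
  also have "\<dots> = (\<Sum>i. if i = j then c i else 0)"
    using assms(1) by (auto simp: cinn_csc_right orthonormal_cinn if_distrib intro!: suminf_cong)
  also have "\<dots> = c j" using sums_unique[OF sums_single[of j c]] by simp
  finally show ?thesis .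
qed

lemma onb_orthonormal: "onb e \<Longrightarrow> orthonormal e"
  by (simp add: onb_def)

lemma onb_eqI:
  assumes "onb e" "\<And>i. cinn (e i) u = cinn (e i) v" shows "u = v"
proof -
  have "\<forall>i. cinn (e i) (u - v) = 0" by (simp add: cinn_diff_right assms(2))
  then have "u - v = 0" using assms(1) unfolding onb_def by blast
  then show ?thesis by simp
qed

text \<open>Bessel's inequality makes the series converge, and its sum has the same coefficients as
  \<open>u\<close>.\<close>

lemma onb_expansion:
  assumes "onb e" shows "(\<lambda>i. csc (cinn (e i) u) (e i)) sums u"
proof -
  note o = onb_orthonormal[OF assms]
  have "(\<Sum>i. csc (cinn (e i) u) (e i)) = u"
    by (rule onb_eqI[OF assms]) (rule coeff_suminf[OF o summable_coeffs[OF o]])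
  then show ?thesis using summable_csc[OF o summable_coeffs[OF o]] by (metis summable_sums)
qed

lemma onb_cinn_sums:
  assumes "onb e" shows "(\<lambda>i. cnj (cinn (e i) u) * cinn (e i) v) sums cinn u v"
  using bounded_linear.sums[OF bounded_linear_cinn onb_expansion[OF assms, of v], of u]
  by (simp add: cinn_csc_right cinn_commute mult.commute)

lemma onb_parseval:
  assumes "onb e" shows "(\<lambda>i. (cmod (cinn (e i) u))\<^sup>2) sums (norm u)\<^sup>2"
proof -
  have "(\<lambda>i. complex_of_real ((cmod (cinn (e i) u))\<^sup>2)) sums complex_of_real ((norm u)\<^sup>2)"
    using onb_cinn_sums[OF assms, of u u] by (simp add: cinn_self complex_norm_square mult.commute del: of_real_power)
  then show ?thesis by (simp only: sums_of_real_iff)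
qed

lemma onb_norm_le:
  assumes "onb e" "\<And>i. cmod (cinn (e i) u) \<le> cmod (cinn (e i) v)" shows "norm u \<le> norm v"
proof (rule power2_le_imp_le)
  show "(norm u)\<^sup>2 \<le> (norm v)\<^sup>2"
    by (rule sums_le[OF _ onb_parseval[OF assms(1)] onb_parseval[OF assms(1)]]) (auto intro!: power_mono assms(2))
qed simp

section \<open>Diagonal unitaries and the free evolution\<close>

definition diag :: "(nat \<Rightarrow> ltwo) \<Rightarrow> (nat \<Rightarrow> complex) \<Rightarrow> ltwo \<Rightarrow> ltwo" where
  "diag e m u = (\<Sum>i. csc (m i * cinn (e i) u) (e i))"

lemma coeff_diag:
  assumes "onb e" "\<And>i. cmod (m i) = 1"
  shows "cinn (e i) (diag e m u) = m i * cinn (e i) u"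
  unfolding diag_def
  by (rule coeff_suminf[OF onb_orthonormal[OF assms(1)]])
     (simp add: norm_mult assms(2) summable_coeffs[OF onb_orthonormal[OF assms(1)]])

lemma norm_diag:
  assumes "onb e" "\<And>i. cmod (m i) = 1" shows "norm (diag e m u) = norm u"
  by (intro antisym onb_norm_le[OF assms(1)]) (simp_all add: coeff_diag[OF assms] norm_mult assms(2))

lemma diag_linear:
  assumes "onb e" "\<And>i. cmod (m i) = 1"
  shows "diag e m (csc a u + csc b v) = csc a (diag e m u) + csc b (diag e m v)"
  by (rule onb_eqI[OF assms(1)]) (simp add: coeff_diag[OF assms] cinn_add_right cinn_csc_right algebra_simps)

lemma diag_diff:
  assumes "onb e" "\<And>i. cmod (m i) = 1"
  shows "diag e m (u - v) = diag e m u - diag e m v"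
  by (rule onb_eqI[OF assms(1)]) (simp add: coeff_diag[OF assms] cinn_diff_right algebra_simps)

text \<open>Outside finitely many basis vectors \<open>u\<close> has small norm, and unimodular
  multipliers cannot enlarge that tail. Indices at which \<open>u\<close> has no component are
  exempt, so a symmetric state imposes no condition on the antisymmetric phases.\<close>

lemma diag_approx:
  assumes e: "onb e" and "\<epsilon> > 0"
  shows "\<exists>N \<delta>. \<delta> > 0 \<and> (\<forall>m m'. (\<forall>i. cmod (m i) = 1) \<longrightarrow> (\<forall>i. cmod (m' i) = 1) \<longrightarrow>
     (\<forall>i<N. cinn (e i) u \<noteq> 0 \<longrightarrow> cmod (m i - m' i) < \<delta>) \<longrightarrow> norm (diag e m u - diag e m' u) < \<epsilon>)"
proof -
  note o = onb_orthonormal[OF e]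
  define S where "S n = (\<Sum>i<n. csc (cinn (e i) u) (e i))" for n
  have "S \<longlonglongrightarrow> u" using onb_expansion[OF e, of u] unfolding sums_def S_def .
  then have "\<forall>\<^sub>F n in sequentially. dist (S n) u < \<epsilon> / 4" using \<open>\<epsilon> > 0\<close> by (intro tendstoD) auto
  then obtain N where N: "norm (S N - u) < \<epsilon> / 4" by (auto simp: eventually_sequentially dist_norm)
  \<comment> \<open>The head may cost \<open>\<epsilon> / 2\<close>, because the tail enters twice
    with less than \<open>\<epsilon> / 4\<close> each; the added 1 covers
    \<open>u = 0\<close>.\<close>
  define \<delta> where "\<delta> = \<epsilon> / (2 * (norm u + 1))"
  have nu: "norm u + 1 > 0" by (simp add: add_nonneg_pos)
  have \<delta>: "\<delta> > 0" using \<open>\<epsilon> > 0\<close> nu by (simp add: \<delta>_def)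
  have "norm (diag e m u - diag e m' u) < \<epsilon>"
    if m: "\<And>i. cmod (m i) = 1" "\<And>i. cmod (m' i) = 1" and close: "\<forall>i<N. cinn (e i) u \<noteq> 0 \<longrightarrow> cmod (m i - m' i) < \<delta>" for m m'
  proof -
    have 1: "norm (diag e m (S N) - diag e m' (S N)) \<le> norm (csc (of_real \<delta>) (S N))"
    proof (rule onb_norm_le[OF e])
      fix i
      have *: "cinn (e i) (S N) = (if i < N then cinn (e i) u else 0)"
        unfolding S_def by (simp add: cinn_sum_orthonormal[OF o])
      have "cmod (m i - m' i) * cmod (cinn (e i) (S N)) \<le> \<delta> * cmod (cinn (e i) (S N))"
        using close * by (cases "i < N \<and> cinn (e i) u \<noteq> 0") (auto intro!: mult_right_mono less_imp_le)
      then show "cmod (cinn (e i) (diag e m (S N) - diag e m' (S N))) \<le> cmod (cinn (e i) (csc (of_real \<delta>) (S N)))"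
        using \<delta> by (simp add: cinn_diff_right coeff_diag[OF e] m cinn_csc_right norm_mult flip: left_diff_distrib)
    qed
    have "norm (S N) \<le> norm u"
      by (rule onb_norm_le[OF e]) (simp add: S_def cinn_sum_orthonormal[OF o])
    then have "norm (csc (of_real \<delta>) (S N)) \<le> \<delta> * (norm u + 1)"
      using \<delta> by (auto simp: norm_csc intro!: mult_left_mono)
    also have "\<dots> = \<epsilon> / 2" using nu by (simp add: \<delta>_def divide_simps)
    finally have 2: "norm (diag e m (S N) - diag e m' (S N)) \<le> \<epsilon> / 2" using 1 by simp
    have "diag e m u - diag e m' u = (diag e m (S N) - diag e m' (S N)) - diag e m (S N - u) + diag e m' (S N - u)"
      using m by (simp add: diag_diff[OF e])
    also have "norm \<dots> \<le> norm (diag e m (S N) - diag e m' (S N)) + norm (diag e m (S N - u)) + norm (diag e m' (S N - u))"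
      by (rule order_trans[OF norm_triangle_ineq add_right_mono[OF norm_triangle_ineq4]])
    also have "\<dots> < \<epsilon>" using 2 N m by (simp add: norm_diag[OF e])
    finally show ?thesis .
  qed
  then show ?thesis using \<delta> by blast
qed

text \<open>The group \<open>exp (- i t H)\<close> of the operator with eigenvectors
  \<open>e\<close> and eigenvalues \<open>l\<close>.\<close>

definition grp :: "(nat \<Rightarrow> ltwo) \<Rightarrow> (nat \<Rightarrow> real) \<Rightarrow> real \<Rightarrow> ltwo \<Rightarrow> ltwo" where
  "grp e l t = diag e (\<lambda>i. cis (- (t * l i)))"

context
  fixes e :: "nat \<Rightarrow> ltwo" assumes e: "onb e"
begin

lemma coeff_grp: "cinn (e i) (grp e l t u) = cis (- (t * l i)) * cinn (e i) u"
  unfolding grp_def by (rule coeff_diag[OF e]) simp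

lemma norm_grp: "norm (grp e l t u) = norm u"
  unfolding grp_def by (rule norm_diag[OF e]) simp

lemma grp_linear: "grp e l t (csc a u + csc b v) = csc a (grp e l t u) + csc b (grp e l t v)"
  unfolding grp_def by (rule diag_linear[OF e]) simp

lemma grp_grp: "grp e l t (grp e l s u) = grp e l (t + s) u"
  by (rule onb_eqI[OF e]) (simp add: coeff_grp cis_mult algebra_simps flip: mult.assoc)

lemma grp_0: "grp e l 0 u = u"
  by (rule onb_eqI[OF e]) (simp add: coeff_grp)

text \<open>\<open>diag_approx\<close> reduces strong continuity to finitely many phases, however
  fast the eigenvalues grow.\<close>

lemma continuous_grp: "continuous_on UNIV (\<lambda>t. grp e l t u)"
  unfolding continuous_on_iff
proof (intro ballI allI impI)
  fix t0 \<epsilon> :: real assume "\<epsilon> > 0"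
  obtain N \<delta> where "\<delta> > 0" and N: "\<And>m m'. \<lbrakk>\<forall>i. cmod (m i) = 1; \<forall>i. cmod (m' i) = 1;
     \<forall>i<N. cinn (e i) u \<noteq> 0 \<longrightarrow> cmod (m i - m' i) < \<delta>\<rbrakk> \<Longrightarrow> norm (diag e m u - diag e m' u) < \<epsilon>"
    using diag_approx[OF e \<open>\<epsilon> > 0\<close>, of u] by blast
  have "\<forall>\<^sub>F t in at t0. \<forall>i\<in>{..<N}. dist (cis (- (t * l i))) (cis (- (t0 * l i))) < \<delta>"
  proof (rule eventually_ball_finite[OF finite_lessThan], rule ballI)
    fix i
    have "((\<lambda>t. cis (- (t * l i))) \<longlongrightarrow> cis (- (t0 * l i))) (at t0)"
      unfolding cis_conv_exp by (intro isContD continuous_intros)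
    then show "\<forall>\<^sub>F t in at t0. dist (cis (- (t * l i))) (cis (- (t0 * l i))) < \<delta>"
      using \<open>\<delta> > 0\<close> by (rule tendstoD)
  qed
  then obtain d where "d > 0" and d: "\<And>t. t \<noteq> t0 \<Longrightarrow> dist t t0 < d \<Longrightarrow> \<forall>i<N. dist (cis (- (t * l i))) (cis (- (t0 * l i))) < \<delta>"
    unfolding eventually_at by (auto simp: Ball_def)
  have "dist (grp e l t u) (grp e l t0 u) < \<epsilon>" if "dist t t0 < d" for t
  proof (cases "t = t0")
    case False
    show ?thesis unfolding grp_def dist_norm
      using d[OF False that] by (intro N) (auto simp: dist_norm)
  qed (use \<open>\<epsilon> > 0\<close> in simp)
  then show "\<exists>d>0. \<forall>t\<in>UNIV. dist t t0 < d \<longrightarrow> dist (grp e l t u) (grp e l t0 u) < \<epsilon>"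
    using \<open>d > 0\<close> by blast
qed

end

subsection \<open>Weak derivatives and the Fourier sine basis\<close>

definition prim :: "(real \<Rightarrow> complex) \<Rightarrow> real \<Rightarrow> complex" where
  "prim g x = integral\<^sup>L (lebesgue_on {0..x}) g"

lemma unitI_indicator_integral:
  fixes g :: "real \<Rightarrow> 'a::{banach, second_countable_topology}"
  assumes "{a..b} \<subseteq> {0..1}"
  shows "integral\<^sup>L unitI (\<lambda>y. indicator {a..b} y *\<^sub>R g y) = integral\<^sup>L (lebesgue_on {a..b}) g"
  using assms by (auto simp: integral_restrict_space indicator_def intro!: Bochner_Integration.integral_cong)

lemma integrable_subinterval_lebesgue:
  fixes g :: "real \<Rightarrow> 'a::{banach, second_countable_topology}"
  assumes "integrable unitI g" "{a..b} \<subseteq> {0..1}"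
  shows "integrable (lebesgue_on {a..b}) g"
proof -
  have "integrable unitI (\<lambda>y. indicator {a..b} y *\<^sub>R g y)"
    by (rule integrable_mult_indicator[OF _ assms(1)]) (use assms(2) in \<open>simp add: sets_restrict_space_iff\<close>)
  then have *: "integrable lebesgue (\<lambda>y. indicator {0..1::real} y *\<^sub>R (indicator {a..b} y *\<^sub>R g y))"
    by (simp add: integrable_restrict_space)
  have "(\<lambda>y. indicator {0..1::real} y *\<^sub>R (indicator {a..b} y *\<^sub>R g y)) = (\<lambda>y. indicator {a..b} y *\<^sub>R g y)"
    using assms(2) by (force simp: indicator_def)
  with * show ?thesis by (simp add: integrable_restrict_space)
qed

lemma prim_eq: "x \<in> {0..1} \<Longrightarrow> prim g x = integral\<^sup>L unitI (\<lambda>y. indicator {0..x} y *\<^sub>R g y)"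
  unfolding prim_def by (subst unitI_indicator_integral) auto

lemma prim_HK: "integrable unitI g \<Longrightarrow> x \<in> {0..1} \<Longrightarrow> prim g x = integral {0..x} g"
  unfolding prim_def
  by (rule lebesgue_integral_eq_integral) (auto intro: integrable_subinterval_lebesgue)

lemma prim_0 [simp]: "prim g 0 = 0"
proof -
  have "prim g 0 = integral\<^sup>L lebesgue (\<lambda>y. indicator {0::real} y *\<^sub>R g y)"
    by (simp add: prim_def integral_restrict_space)
  also have "\<dots> = 0"
  proof (rule integral_eq_zero_AE)
    have "AE y in lebesgue. y \<noteq> (0::real)" by (intro AE_completion AE_lborel_singleton)
    then show "AE y in lebesgue. indicator {0::real} y *\<^sub>R g y = 0" by eventually_elim auto
  qed
  finally show ?thesis .
qed

lemma continuous_prim: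
  assumes "integrable unitI g" shows "continuous_on {0..1} (prim g)"
proof -
  have "g integrable_on {0..1}"
    using has_integral_integral_lebesgue_on[OF assms] by (auto simp: integrable_on_def)
  from indefinite_integral_continuous_1[OF this] show ?thesis
    by (rule continuous_on_eq) (simp add: prim_HK[OF assms])
qed

lemma prim_bound:
  assumes "L2 g" "x \<in> {0..1}" shows "cmod (prim g x) \<le> l2norm g"
proof -
  have i: "integrable unitI g" by (rule L2_integrable[OF assms(1)])
  have "{0..x} \<inter> space unitI \<in> sets unitI" using assms(2) by (auto simp: sets_restrict_space_iff)
  then have i2: "integrable unitI (\<lambda>y. indicator {0..x} y *\<^sub>R g y)"
    using assms(2) by (intro integrable_mult_indicator i) (auto simp: sets_restrict_space_iff)
  have "cmod (prim g x) \<le> integral\<^sup>L unitI (\<lambda>y. cmod (indicator {0..x} y *\<^sub>R g y))"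
    unfolding prim_eq[OF assms(2)] by (rule integral_norm_bound)
  also have "\<dots> \<le> integral\<^sup>L unitI (\<lambda>y. cmod (g y))"
    by (rule integral_mono[OF integrable_norm[OF i2] integrable_norm[OF i]]) (auto simp: indicator_def)
  also have "\<dots> \<le> l2norm g" by (rule L2_integrable[OF assms(1)])
  finally show ?thesis .
qed

lemma prim_lin:
  assumes "integrable unitI f" "integrable unitI g" "x \<in> {0..1}"
  shows "prim (\<lambda>y. a * f y + b * g y) x = a * prim f x + b * prim g x"
  unfolding prim_def using assms
  by (simp add: integrable_subinterval_lebesgue)

lemma borel_measurable_id_unitI [measurable]: "(\<lambda>x. x) \<in> borel_measurable unitI"
  by (simp add: measurable_restrict_space1 measurable_completion)

text \<open>Fubini on the triangle \<open>x \<le> y\<close>. It takes the place of integration by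
  parts for primitives that are differentiable only almost everywhere.\<close>

lemma integral_prim_mult:
  fixes g q :: "real \<Rightarrow> complex"
  assumes g: "integrable unitI g" and q: "integrable unitI q"
  shows "integral\<^sup>L unitI (\<lambda>y. prim g y * q y) = integral\<^sup>L unitI (\<lambda>x. g x * integral\<^sup>L (lebesgue_on {x..1}) q)"
proof -
  interpret U: finite_measure unitI by (rule finite_measure_unitI)
  interpret P: pair_sigma_finite unitI unitI by standard
  have [measurable]: "g \<in> borel_measurable unitI" "q \<in> borel_measurable unitI" using g q by auto
  define f where "f x y = g x * (if x \<le> y then q y else 0)" for x y
  have m1[measurable]: "fst \<in> borel_measurable (unitI \<Otimes>\<^sub>M unitI)"
    using measurable_compose[OF measurable_fst borel_measurable_id_unitI] by simp
  have m2[measurable]: "snd \<in> borel_measurable (unitI \<Otimes>\<^sub>M unitI)"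
    using measurable_compose[OF measurable_snd borel_measurable_id_unitI] by simp
  have meas[measurable]: "(\<lambda>z. f (fst z) (snd z)) \<in> borel_measurable (unitI \<Otimes>\<^sub>M unitI)"
    unfolding f_def by measurable
  have iq: "integrable unitI (\<lambda>y. if x \<le> y then q y else 0)" for x
    by (rule Bochner_Integration.integrable_bound[OF q]) auto
  have int: "integrable (unitI \<Otimes>\<^sub>M unitI) (\<lambda>z. f (fst z) (snd z))"
  proof (rule P.Fubini_integrable[OF meas])
    have "(\<lambda>x. integral\<^sup>L unitI (\<lambda>y. norm (f x y))) = (\<lambda>x. cmod (g x) * integral\<^sup>L unitI (\<lambda>y. cmod (if x \<le> y then q y else 0)))"
      by (simp add: f_def norm_mult)
    moreover have "integrable unitI \<dots>"
    proof (rule Bochner_Integration.integrable_bound[where f="\<lambda>x. cmod (g x) * integral\<^sup>L unitI (\<lambda>y. cmod (q y))"])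
      show "integrable unitI (\<lambda>x. cmod (g x) * integral\<^sup>L unitI (\<lambda>y. cmod (q y)))" using g by simp
      have "(\<lambda>x. integral\<^sup>L unitI (\<lambda>y. norm (f x y))) \<in> borel_measurable unitI"
        by (rule U.borel_measurable_lebesgue_integral) (simp add: split_beta)
      then show "(\<lambda>x. cmod (g x) * integral\<^sup>L unitI (\<lambda>y. cmod (if x \<le> y then q y else 0))) \<in> borel_measurable unitI"
        by (simp add: f_def norm_mult)
      have "integral\<^sup>L unitI (\<lambda>y. cmod (if x \<le> y then q y else 0)) \<le> integral\<^sup>L unitI (\<lambda>y. cmod (q y))" for x
        by (rule integral_mono) (use iq q in auto)
      moreover have "0 \<le> integral\<^sup>L unitI (\<lambda>y. cmod (if x \<le> y then q y else 0))" for x by simp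
      ultimately show "AE x in unitI. norm (cmod (g x) * integral\<^sup>L unitI (\<lambda>y. cmod (if x \<le> y then q y else 0)))
          \<le> norm (cmod (g x) * integral\<^sup>L unitI (\<lambda>y. cmod (q y)))"
        by (intro AE_I2) (auto simp: abs_mult intro!: mult_left_mono)
    qed
    ultimately show "integrable unitI (\<lambda>x. integral\<^sup>L unitI (\<lambda>y. norm (f (fst (x, y)) (snd (x, y)))))" by simp
    show "AE x in unitI. integrable unitI (\<lambda>y. f (fst (x, y)) (snd (x, y)))"
      using iq by (simp add: f_def)
  qed
  have fub: "integral\<^sup>L unitI (\<lambda>y. integral\<^sup>L unitI (\<lambda>x. f x y)) = integral\<^sup>L unitI (\<lambda>x. integral\<^sup>L unitI (\<lambda>y. f x y))"
    by (rule P.Fubini_integral) (use int in \<open>simp add: case_prod_unfold\<close>)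
  have B: "integral\<^sup>L unitI (\<lambda>x. f x y) = prim g y * q y" if "y \<in> {0..1}" for y
  proof -
    have "integral\<^sup>L unitI (\<lambda>x. f x y) = integral\<^sup>L unitI (\<lambda>x. (indicator {0..y} x *\<^sub>R g x) * q y)"
      unfolding f_def by (intro Bochner_Integration.integral_cong) (auto simp: indicator_def)
    also have "\<dots> = prim g y * q y" by (subst integral_mult_left_zero) (simp add: prim_eq[OF that])
    finally show ?thesis .
  qed
  have C: "integral\<^sup>L unitI (\<lambda>y. f x y) = g x * integral\<^sup>L (lebesgue_on {x..1}) q" if "x \<in> {0..1}" for x
  proof -
    have "integral\<^sup>L unitI (\<lambda>y. f x y) = integral\<^sup>L unitI (\<lambda>y. g x * (indicator {x..1} y *\<^sub>R q y))"
      unfolding f_def by (intro Bochner_Integration.integral_cong) (auto simp: indicator_def)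
    also have "\<dots> = g x * integral\<^sup>L (lebesgue_on {x..1}) q"
      using that by (simp add: unitI_indicator_integral)
    finally show ?thesis .
  qed
  have "integral\<^sup>L unitI (\<lambda>y. prim g y * q y) = integral\<^sup>L unitI (\<lambda>y. integral\<^sup>L unitI (\<lambda>x. f x y))"
    by (intro Bochner_Integration.integral_cong refl B[symmetric]) simp
  also have "\<dots> = integral\<^sup>L unitI (\<lambda>x. g x * integral\<^sup>L (lebesgue_on {x..1}) q)"
    unfolding fub by (intro Bochner_Integration.integral_cong refl C) simp
  finally show ?thesis .
qed

text \<open>The integral of \<open>g\<close> vanishes over all half-lines, an intersection-stable
  generator of the Borel sets. A Dynkin argument extends this to Borel sets, and discarding null
  sets extends it to Lebesgue sets.\<close>

lemma prim_zero_imp_AE_zero: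
  assumes g: "integrable unitI g" and zero: "\<And>x. x \<in> {0..1} \<Longrightarrow> prim g x = 0"
  shows "AE x in unitI. g x = 0"
proof -
  interpret U: finite_measure unitI by (rule finite_measure_unitI)
  show ?thesis
  proof (rule U.density_zero[OF g])
    have borel: "integral\<^sup>L unitI (\<lambda>x. indicator B x *\<^sub>R g x) = 0" if "B \<in> sets borel" for B :: "real set"
    proof -
      have G: "Int_stable (range atMost :: real set set)"
        by (auto simp: Int_stable_def)
      have ints: "integrable unitI (\<lambda>x. indicator B x *\<^sub>R g x)" if "B \<in> sets borel" for B
      proof -
        have "integrable unitI (\<lambda>x. indicator (B \<inter> {0..1}) x *\<^sub>R g x)"
          using that by (intro integrable_mult_indicator[OF _ g]) (simp add: sets_restrict_space_iff)
        then show ?thesis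
          by (rule iffD1[OF Bochner_Integration.integrable_cong[OF refl], rotated]) (simp add: indicator_def)
      qed
      have sb: "sigma_sets UNIV (range atMost) = sets (borel :: real measure)"
        by (simp add: borel_eq_atMost)
      have cl: "range atMost \<subseteq> Pow (UNIV :: real set)" by simp
      have "B \<in> sigma_sets UNIV (range atMost)" using that sb by simp
      from G cl this show ?thesis
      proof (induction rule: sigma_sets_induct_disjoint)
        case (basic A)
        then obtain a where A: "A = {..a}" by auto
        consider "a < 0" | "a \<in> {0..1}" | "a > 1" by fastforce
        then show ?case
        proof cases
          case 1
          then have "integral\<^sup>L unitI (\<lambda>x. indicator A x *\<^sub>R g x) = integral\<^sup>L unitI (\<lambda>x. 0)"
            by (intro Bochner_Integration.integral_cong) (auto simp: A)
          then show ?thesis by simp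
        next
          case 2
          then have "integral\<^sup>L unitI (\<lambda>x. indicator A x *\<^sub>R g x) = integral\<^sup>L unitI (\<lambda>x. indicator {0..a} x *\<^sub>R g x)"
            by (intro Bochner_Integration.integral_cong) (auto simp: A indicator_def)
          then show ?thesis using zero[OF 2] by (simp add: prim_eq[OF 2])
        next
          case 3
          then have "integral\<^sup>L unitI (\<lambda>x. indicator A x *\<^sub>R g x) = integral\<^sup>L unitI (\<lambda>x. indicator {0..1} x *\<^sub>R g x)"
            by (intro Bochner_Integration.integral_cong) (auto simp: A indicator_def)
          then show ?thesis using zero[of 1] by (simp add: prim_eq)
        qed
      next
        case (compl A)
        then have A: "A \<in> sets borel" by (simp add: sb)
        have "integral\<^sup>L unitI g = integral\<^sup>L unitI (\<lambda>x. indicator {0..1} x *\<^sub>R g x)"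
          by (intro Bochner_Integration.integral_cong) auto
        also have "\<dots> = 0" using zero[of 1] by (simp add: prim_eq)
        finally have 0: "integral\<^sup>L unitI g = 0" .
        have "integral\<^sup>L unitI (\<lambda>x. indicator (UNIV - A) x *\<^sub>R g x) = integral\<^sup>L unitI (\<lambda>x. g x - indicator A x *\<^sub>R g x)"
          by (intro Bochner_Integration.integral_cong) (auto simp: indicator_def)
        also have "\<dots> = 0" using 0 compl ints[OF A] g by simp
        finally show ?case .
      next
        case (union A)
        then have A: "A i \<in> sets borel" for i using sb by blast
        have "(\<lambda>n. integral\<^sup>L unitI (\<lambda>x. indicator (\<Union>i<n. A i) x *\<^sub>R g x)) \<longlonglongrightarrow> integral\<^sup>L unitI (\<lambda>x. indicator (\<Union>i. A i) x *\<^sub>R g x)"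
        proof (rule integral_dominated_convergence[where w="\<lambda>x. cmod (g x)"])
          show "AE x in unitI. (\<lambda>n. indicator (\<Union>i<n. A i) x *\<^sub>R g x) \<longlonglongrightarrow> indicator (\<Union>i. A i) x *\<^sub>R g x"
          proof (rule AE_I2)
            fix x
            have "(\<lambda>n. indicator (\<Union>i<n. A i) x :: real) \<longlonglongrightarrow> indicator (\<Union>i. A i) x"
              by (rule LIMSEQ_indicator_UN)
            then show "(\<lambda>n. indicator (\<Union>i<n. A i) x *\<^sub>R g x) \<longlonglongrightarrow> indicator (\<Union>i. A i) x *\<^sub>R g x"
              by (intro tendsto_intros)
          qed
        qed (use g A ints in \<open>auto simp: indicator_def intro!: borel_measurable_integrable sets.finite_UN\<close>)
        moreover have "integral\<^sup>L unitI (\<lambda>x. indicator (\<Union>i<n. A i) x *\<^sub>R g x) = 0" for n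
        proof (induction n)
          case (Suc n)
          have "indicator (\<Union>i<Suc n. A i) x *\<^sub>R g x = indicator (\<Union>i<n. A i) x *\<^sub>R g x + indicator (A n) x *\<^sub>R g x" for x
          proof -
            have "x \<notin> A i" if "x \<in> A n" "i < n" for i
              using disjoint_family_onD[OF union(1), of i n] that by auto
            then show ?thesis by (auto simp: indicator_def lessThan_Suc)
          qed
          then have "integral\<^sup>L unitI (\<lambda>x. indicator (\<Union>i<Suc n. A i) x *\<^sub>R g x)
              = integral\<^sup>L unitI (\<lambda>x. indicator (\<Union>i<n. A i) x *\<^sub>R g x + indicator (A n) x *\<^sub>R g x)" by presburger
          also have "\<dots> = 0" using Suc union by (subst Bochner_Integration.integral_add) (auto intro!: ints A sets.finite_UN)
          finally show ?case .
        qed simp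
        ultimately show ?case by (simp add: LIMSEQ_const_iff)
      qed simp_all
    qed
    fix A assume "A \<in> sets unitI"
    then have "A \<in> sets lebesgue" by (auto simp: sets_restrict_space_iff)
    then obtain S N N' where *: "A = S \<union> N'" "N' \<subseteq> N" "N \<in> null_sets lborel" "S \<in> sets lborel"
      by (rule sets_completionE)
    have "AE x in lebesgue. x \<notin> N" using *(3) by (intro AE_completion AE_not_in)
    then have "AE x in unitI. x \<notin> N" by (simp add: AE_restrict_space_iff) (auto elim: eventually_mono)
    then have ae: "AE x in unitI. indicator A x *\<^sub>R g x = indicator S x *\<^sub>R g x"
      by eventually_elim (use * in \<open>auto simp: indicator_def\<close>)
    have [measurable]: "g \<in> borel_measurable unitI" using g by simp
    have [measurable]: "A \<in> sets unitI" by fact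
    have m2: "(\<lambda>x. indicator S x *\<^sub>R g x) \<in> borel_measurable unitI"
    proof -
      have "S \<inter> {0..1} \<in> sets unitI" using *(4) by (simp add: sets_restrict_space_iff)
      then have "(\<lambda>x. indicator (S \<inter> {0..1}) x *\<^sub>R g x) \<in> borel_measurable unitI" by simp
      then show ?thesis by (rule measurable_cong[THEN iffD1, rotated]) (auto simp: indicator_def)
    qed
    have "integral\<^sup>L unitI (\<lambda>x. indicator A x *\<^sub>R g x) = integral\<^sup>L unitI (\<lambda>x. indicator S x *\<^sub>R g x)"
      by (rule integral_cong_AE[OF _ m2 ae]) simp
    then show "set_lebesgue_integral unitI A g = 0"
      using borel[of S] *(4) by (simp add: set_lebesgue_integral_def)
  qed
qed

section \<open>Completeness of the sine system\<close>

lemma L2_continuous: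
  assumes "continuous_on {0..1} f" shows "L2 f"
proof -
  have "compact (f ` {0..1})" by (rule compact_continuous_image[OF assms]) simp
  then obtain B where "\<And>x. x \<in> {0..1} \<Longrightarrow> cmod (f x) \<le> B"
    using compact_imp_bounded bounded_iff by (metis imageI)
  moreover have "f \<in> borel_measurable unitI"
    by (rule continuous_imp_measurable_on_sets_lebesgue[OF assms]) simp
  ultimately show ?thesis by (intro L2_bounded(1))
qed

text \<open>Powers of \<open>cos (pi * x)\<close> are combinations of the
  \<open>cos (k * pi * x)\<close>, and in the variable \<open>s = cos (pi * x)\<close> polynomials
  are uniformly dense by Weierstrass. So \<open>R\<close> is orthogonal to approximations of
  itself.\<close>

lemma cos_orthogonal_imp_zero:
  fixes R :: "real \<Rightarrow> real"
  assumes cont: "continuous_on {0..1} R"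
    and orth: "\<And>k::nat. integral {0..1} (\<lambda>x. R x * cos (real k * pi * x)) = 0"
    and x: "x \<in> {0..1}"
  shows "R x = 0"
proof -
  note ci = integrable_continuous_real
  \<comment> \<open>The frequency \<open>k\<close> is kept general so that the product-to-sum
    formula can trade one power of \<open>cos (pi * x)\<close> for the neighbouring frequencies
    \<open>k - 1\<close> and \<open>k + 1\<close>.\<close>
  have pw: "integral {0..1} (\<lambda>x. R x * cos (real k * pi * x) * cos (pi * x) ^ m) = 0" for k m
  proof (induction m arbitrary: k)
    case 0
    then show ?case using orth by simp
  next
    case (Suc m)
    show ?case
    proof (cases k)
      case 0
      then show ?thesis using Suc[of 1] by (simp add: mult.assoc)
    next
      case (Suc j)
      have eq: "R x * cos (real k * pi * x) * cos (pi * x) ^ Suc m =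
         (1/2) * (R x * cos (real (Suc k) * pi * x) * cos (pi * x) ^ m) + (1/2) * (R x * cos (real j * pi * x) * cos (pi * x) ^ m)" for x
      proof -
        have "cos (real k * pi * x) * cos (pi * x) = (cos (real j * pi * x) + cos (real (Suc k) * pi * x)) / 2"
          unfolding cos_times_cos by (simp add: Suc algebra_simps)
        then have "R x * (cos (real k * pi * x) * cos (pi * x)) * cos (pi * x) ^ m
          = R x * ((cos (real j * pi * x) + cos (real (Suc k) * pi * x)) / 2) * cos (pi * x) ^ m" by simp
        then show ?thesis by (simp add: field_simps del: of_nat_Suc)
      qed
      have "integral {0..1} (\<lambda>x. R x * cos (real k * pi * x) * cos (pi * x) ^ Suc m) =
         (1/2) * integral {0..1} (\<lambda>x. R x * cos (real (Suc k) * pi * x) * cos (pi * x) ^ m)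
          + (1/2) * integral {0..1} (\<lambda>x. R x * cos (real j * pi * x) * cos (pi * x) ^ m)"
        unfolding eq
        by (subst integral_add) (auto intro!: ci continuous_intros cont)
      then show ?thesis using \<open>\<And>k. integral {0..1} (\<lambda>x. R x * cos (real k * pi * x) * cos (pi * x) ^ m) = 0\<close> by (simp del: of_nat_Suc)
    qed
  qed
  define J where "J = integral {0..1} (\<lambda>x. \<bar>R x\<bar>)"
  have J0: "J \<ge> 0" unfolding J_def by (rule integral_nonneg) (auto intro!: ci continuous_intros cont)
  \<comment> \<open>\<open>R x * R x\<close> differs from \<open>R x * g (cos (pi * x))\<close>,
    whose integral is zero, by at most \<open>\<epsilon> * \<bar>R x\<bar>\<close>.\<close>
  have le: "integral {0..1} (\<lambda>x. R x * R x) \<le> \<epsilon> * J" if "\<epsilon> > 0" for \<epsilon>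
  proof -
    define G where "G s = R (arccos s / pi)" for s
    have "continuous_on {-1..1} G"
      unfolding G_def
    proof (rule continuous_on_compose2[OF cont])
      show "continuous_on {-1..1} (\<lambda>s. arccos s / pi)" by (intro continuous_intros) auto
      show "(\<lambda>s. arccos s / pi) ` {-1..1} \<subseteq> {0..1}" using arccos_lbound arccos_ubound by (force simp: field_simps)
    qed
    then obtain g where g: "real_polynomial_function g" and gb: "\<And>s. s \<in> {-1..1} \<Longrightarrow> \<bar>G s - g s\<bar> < \<epsilon>"
      using Stone_Weierstrass_real_polynomial_function[of "{-1..1::real}" G \<epsilon>] \<open>\<epsilon> > 0\<close> by auto
    obtain a n where ga: "g = (\<lambda>x. \<Sum>i\<le>n. a i * x ^ i)"
      using g real_polynomial_function_iff_sum by auto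
    have close: "\<bar>R x - g (cos (pi * x))\<bar> < \<epsilon>" if "x \<in> {0..1}" for x
    proof -
      have "arccos (cos (pi * x)) = pi * x" using that by (intro arccos_cos) auto
      then show ?thesis using gb[of "cos (pi * x)"] by (simp add: G_def)
    qed
    have gc: "continuous_on {0..1} (\<lambda>x. g (cos (pi * x)))"
      unfolding ga by (intro continuous_intros)
    have "integral {0..1} (\<lambda>x. R x * g (cos (pi * x))) = integral {0..1} (\<lambda>x. \<Sum>i\<le>n. a i * (R x * cos (real 0 * pi * x) * cos (pi * x) ^ i))"
      by (simp add: ga sum_distrib_left algebra_simps)
    also have "\<dots> = (\<Sum>i\<le>n. integral {0..1} (\<lambda>x. a i * (R x * cos (real 0 * pi * x) * cos (pi * x) ^ i)))"
      by (rule integral_sum) (auto intro!: ci continuous_intros cont)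
    also have "\<dots> = 0" using pw[of 0] by simp
    finally have z: "integral {0..1} (\<lambda>x. R x * g (cos (pi * x))) = 0" .
    have "integral {0..1} (\<lambda>x. R x * R x) = integral {0..1} (\<lambda>x. R x * R x) - integral {0..1} (\<lambda>x. R x * g (cos (pi * x)))"
      by (simp add: z)
    also have "\<dots> = integral {0..1} (\<lambda>x. R x * R x - R x * g (cos (pi * x)))"
      by (rule integral_diff[symmetric]) (auto intro!: ci continuous_intros cont gc)
    also have "\<dots> \<le> integral {0..1} (\<lambda>x. \<epsilon> * \<bar>R x\<bar>)"
    proof (rule integral_le)
      fix x assume "x \<in> {0..1::real}"
      have "R x * R x - R x * g (cos (pi * x)) \<le> \<bar>R x\<bar> * \<bar>R x - g (cos (pi * x))\<bar>"
        by (metis abs_ge_self abs_mult right_diff_distrib)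
      also have "\<dots> \<le> \<bar>R x\<bar> * \<epsilon>" using close[OF \<open>x \<in> {0..1}\<close>] by (intro mult_left_mono) auto
      finally show "R x * R x - R x * g (cos (pi * x)) \<le> \<epsilon> * \<bar>R x\<bar>" by (simp add: mult.commute)
    qed (auto intro!: ci continuous_intros cont gc)
    also have "\<dots> = \<epsilon> * J" by (simp add: J_def)
    finally show ?thesis .
  qed
  have "integral {0..1} (\<lambda>x. R x * R x) \<le> 0"
  proof (rule field_le_epsilon)
    fix e :: real assume "e > 0"
    then have "e / (J + 1) > 0" using J0 by simp
    from le[OF this] have "integral {0..1} (\<lambda>x. R x * R x) \<le> e * (J / (J + 1))" by simp
    also have "\<dots> \<le> e * 1" using \<open>e > 0\<close> J0 by (intro mult_left_mono) auto
    finally show "integral {0..1} (\<lambda>x. R x * R x) \<le> 0 + e" by simp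
  qed
  moreover have "integral {0..1} (\<lambda>x. R x * R x) \<ge> 0"
    by (rule integral_nonneg) (auto intro!: ci continuous_intros cont)
  ultimately have "integral {0..1} (\<lambda>x. R x * R x) = 0" by simp
  then have "\<forall>x\<in>{0..1}. R x * R x = 0"
    by (subst (asm) integral_eq_0_iff) (auto intro!: continuous_intros cont)
  then show ?thesis using x by auto
qed

lemma integrable_unitI_continuous: "continuous_on {0..1} f \<Longrightarrow> integrable unitI f" for f :: "real \<Rightarrow> complex"
  by (rule continuous_imp_integrable_real)

lemma integral_cos_tail:
  assumes "k > 0" "x \<in> {0..1}"
  shows "integral\<^sup>L (lebesgue_on {x..1}) (\<lambda>y. complex_of_real (cos (real k * pi * y))) = - of_real (sin (real k * pi * x) / (real k * pi))"
proof -
  have "((\<lambda>y. cos (real k * pi * y)) has_integral sin (real k * pi * 1) / (real k * pi) - sin (real k * pi * x) / (real k * pi)) {x..1}"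
    using assms
    by (intro fundamental_theorem_of_calculus) (auto intro!: derivative_eq_intros simp: has_real_derivative_iff_has_vector_derivative[symmetric])
  then have "integral {x..1} (\<lambda>y. cos (real k * pi * y)) = - (sin (real k * pi * x) / (real k * pi))"
    by (simp add: integral_unique)
  moreover have "integral\<^sup>L (lebesgue_on {x..1}) (\<lambda>y. complex_of_real (cos (real k * pi * y)))
     = of_real (integral\<^sup>L (lebesgue_on {x..1}) (\<lambda>y. cos (real k * pi * y)))"
    by (rule integral_complex_of_real)
  moreover have "integral\<^sup>L (lebesgue_on {x..1}) (\<lambda>y. cos (real k * pi * y)) = integral {x..1} (\<lambda>y. cos (real k * pi * y))"
    by (intro lebesgue_integral_eq_integral continuous_imp_integrable_real continuous_intros) auto
  ultimately show ?thesis by simp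
qed

text \<open>Integration by parts turns orthogonality of \<open>f\<close> to the sines into
  orthogonality of its primitive to the nonconstant cosines. The primitive is then constant, and it
  vanishes at 0.\<close>

lemma sin_orthogonal_imp_AE_zero:
  assumes f: "L2 f" and orth: "\<And>k::nat. k > 0 \<Longrightarrow> integral\<^sup>L unitI (\<lambda>x. f x * complex_of_real (sin (real k * pi * x))) = 0"
  shows "AE x in unitI. f x = 0"
proof -
  have fi: "integrable unitI f" by (rule L2_integrable[OF f])
  define F where "F = prim f"
  have Fc: "continuous_on {0..1} F" unfolding F_def by (rule continuous_prim[OF fi])
  have cosc: "continuous_on S (\<lambda>y. complex_of_real (cos (real k * pi * y)))" for k S by (intro continuous_intros)
  have Fcos: "integral\<^sup>L unitI (\<lambda>y. F y * complex_of_real (cos (real k * pi * y))) = 0" if k: "k > 0" for k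
  proof -
    have "integral\<^sup>L unitI (\<lambda>y. F y * complex_of_real (cos (real k * pi * y)))
      = integral\<^sup>L unitI (\<lambda>x. f x * integral\<^sup>L (lebesgue_on {x..1}) (\<lambda>y. complex_of_real (cos (real k * pi * y))))"
      unfolding F_def by (rule integral_prim_mult[OF fi integrable_unitI_continuous[OF cosc]])
    also have "\<dots> = integral\<^sup>L unitI (\<lambda>x. f x * complex_of_real (sin (real k * pi * x)) * (- 1 / of_real (real k * pi)))"
      using k by (intro Bochner_Integration.integral_cong refl) (subst integral_cos_tail, auto)
    also have "\<dots> = 0" using orth[OF k] by (subst integral_mult_left_zero) simp
    finally show ?thesis .
  qed
  \<comment> \<open>Subtracting the mean adds orthogonality to the constant function, the case
    \<open>k = 0\<close>.\<close>
  define c where "c = integral\<^sup>L unitI F"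
  have Gcos: "integral\<^sup>L unitI (\<lambda>y. (F y - c) * complex_of_real (cos (real k * pi * y))) = 0" for k :: nat
  proof (cases "k = 0")
    case True
    have "integral\<^sup>L unitI (\<lambda>y. F y - c) = 0"
      by (subst Bochner_Integration.integral_diff) (auto intro!: integrable_unitI_continuous Fc continuous_intros simp: c_def measure_restrict_space)
    then show ?thesis using True by simp
  next
    case False
    have "integral\<^sup>L unitI (\<lambda>y. complex_of_real (cos (real k * pi * y))) = 0"
      using integral_cos_tail[of k 0] False by simp
    then have c0: "integral\<^sup>L unitI (\<lambda>y. c * complex_of_real (cos (real k * pi * y))) = 0"
      by (subst integral_mult_right_zero) simp
    have "integral\<^sup>L unitI (\<lambda>y. (F y - c) * complex_of_real (cos (real k * pi * y)))
       = integral\<^sup>L unitI (\<lambda>y. F y * complex_of_real (cos (real k * pi * y))) - integral\<^sup>L unitI (\<lambda>y. c * complex_of_real (cos (real k * pi * y)))"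
      unfolding left_diff_distrib
      by (rule Bochner_Integration.integral_diff) (auto intro!: integrable_unitI_continuous Fc continuous_intros)
    then show ?thesis using Fcos[of k] False c0 by simp
  qed
  have Gc: "continuous_on {0..1} (\<lambda>y. F y - c)" by (intro continuous_intros Fc)
  have HK: "integral {0..1} (\<lambda>y. (F y - c) * complex_of_real (cos (real k * pi * y))) = 0" for k :: nat
    using Gcos[of k]
    by (subst lebesgue_integral_eq_integral[symmetric]) (auto intro!: integrable_unitI_continuous continuous_intros Fc)
  have hki: "(\<lambda>y. (F y - c) * complex_of_real (cos (real k * pi * y))) integrable_on {0..1}" for k :: nat
    by (intro integrable_continuous_real continuous_intros Fc)
  have "Re (F x - c) = 0 \<and> Im (F x - c) = 0" if x: "x \<in> {0..1}" for x
  proof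
    show "Re (F x - c) = 0"
    proof (rule cos_orthogonal_imp_zero[where R="\<lambda>x. Re (F x - c)", OF _ _ x])
      show "continuous_on {0..1} (\<lambda>x. Re (F x - c))" by (intro continuous_intros Fc)
      fix k :: nat
      have "integral {0..1} (\<lambda>y. Re ((F y - c) * complex_of_real (cos (real k * pi * y)))) = 0"
        using integral_linear[OF hki[of k] bounded_linear_Re] HK[of k] by (simp add: o_def)
      then show "integral {0..1} (\<lambda>x. Re (F x - c) * cos (real k * pi * x)) = 0" by simp
    qed
    show "Im (F x - c) = 0"
    proof (rule cos_orthogonal_imp_zero[where R="\<lambda>x. Im (F x - c)", OF _ _ x])
      show "continuous_on {0..1} (\<lambda>x. Im (F x - c))" by (intro continuous_intros Fc)
      fix k :: nat
      have "integral {0..1} (\<lambda>y. Im ((F y - c) * complex_of_real (cos (real k * pi * y)))) = 0"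
        using integral_linear[OF hki[of k] bounded_linear_Im] HK[of k] by (simp add: o_def)
      then show "integral {0..1} (\<lambda>x. Im (F x - c) * cos (real k * pi * x)) = 0" by simp
    qed
  qed
  then have Fcst: "F x = c" if "x \<in> {0..1}" for x using that by (auto simp: complex_eq_iff)
  moreover have "F 0 = 0" by (simp add: F_def)
  ultimately have "F x = 0" if "x \<in> {0..1}" for x using that Fcst[of 0] by simp
  then show ?thesis by (intro prim_zero_imp_AE_zero[OF fi]) (simp add: F_def)
qed

section \<open>Weak derivatives and the form domain \<open>H10\<close>\<close>

lemma deriv_rep_prim: "deriv_rep f g \<longleftrightarrow> L2 g \<and> (\<forall>x\<in>{0..1}. f x = f 0 + prim g x)"
  by (simp add: deriv_rep_def prim_def)

lemma deriv_rep_L2: "deriv_rep f g \<Longrightarrow> L2 g"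
  unfolding deriv_rep_def by blast

lemma deriv_rep_eq: "deriv_rep f g \<Longrightarrow> x \<in> {0..1} \<Longrightarrow> f x = f 0 + prim g x"
  unfolding deriv_rep_prim by blast

lemma deriv_rep_cont: assumes "deriv_rep f g" shows "continuous_on {0..1} f"
proof -
  have "continuous_on {0..1} (\<lambda>x. f 0 + prim g x)"
    using assms by (intro continuous_intros continuous_prim L2_integrable deriv_rep_L2)
  then show ?thesis by (rule continuous_on_eq) (rule deriv_rep_eq[OF assms, symmetric])
qed

lemma deriv_rep_unique:
  assumes "deriv_rep f g" "deriv_rep f g'" shows "cls g = cls g'"
proof -
  have L: "L2 g" "L2 g'" using assms by (auto intro: deriv_rep_L2)
  have "AE x in unitI. (\<lambda>x. 1 * g x + (-1) * g' x) x = 0"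
  proof (rule prim_zero_imp_AE_zero)
    fix x :: real assume x: "x \<in> {0..1}"
    then have "f 0 + prim g x = f 0 + prim g' x" using deriv_rep_eq[OF assms(1)] deriv_rep_eq[OF assms(2)] by metis
    then show "prim (\<lambda>x. 1 * g x + (-1) * g' x) x = 0"
      using x by (subst prim_lin) (auto intro: L2_integrable L)
  qed (use L in \<open>auto intro: L2_integrable\<close>)
  then have "AE x in unitI. g x = g' x" by simp
  then show ?thesis by (simp add: cls_eq_iff L)
qed

lemma deriv_rep_wderiv: "deriv_rep f g \<Longrightarrow> deriv_rep f (wderiv f)"
  unfolding wderiv_def by (rule someI[where P="deriv_rep f"])

lemma deriv_rep_lin:
  assumes "deriv_rep f g" "deriv_rep f' g'"
  shows "deriv_rep (\<lambda>x. a * f x + b * f' x) (\<lambda>x. a * g x + b * g' x)"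
  unfolding deriv_rep_prim
proof (intro conjI ballI)
  show "L2 (\<lambda>x. a * g x + b * g' x)" using assms by (intro L2_add L2_cmult deriv_rep_L2)
  fix x :: real assume x: "x \<in> {0..1}"
  have L: "L2 g" "L2 g'" using assms by (auto intro: deriv_rep_L2)
  have "f x = f 0 + prim g x" "f' x = f' 0 + prim g' x" using assms x by (auto intro: deriv_rep_eq)
  then show "a * f x + b * f' x = a * f 0 + b * f' 0 + prim (\<lambda>x. a * g x + b * g' x) x"
    using x by (simp add: prim_lin L2_integrable L algebra_simps)
qed

text \<open>\<open>wderiv\<close> picks one of many almost everywhere equal derivatives; only its
  class is determined, and only the class enters the form.\<close>

definition dcl :: "(real \<Rightarrow> complex) \<Rightarrow> ltwo" where "dcl f = cls (wderiv f)"

lemma dcl_eq: "deriv_rep f g \<Longrightarrow> dcl f = cls g"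
  unfolding dcl_def by (rule deriv_rep_unique[OF deriv_rep_wderiv])

lemma H10_E: assumes "H10 f" obtains g where "deriv_rep f g" "L2 g" "dcl f = cls g"
  using assms dcl_eq deriv_rep_L2 unfolding H10_def by blast

lemma H10_cont: "H10 f \<Longrightarrow> continuous_on {0..1} f"
  by (auto simp: H10_def intro: deriv_rep_cont)

lemma H10_L2: "H10 f \<Longrightarrow> L2 f"
  by (rule L2_continuous[OF H10_cont])

lemma h0_cinn: assumes "H10 \<Phi>" "H10 \<Psi>" shows "h0 \<Phi> \<Psi> = cinn (dcl \<Phi>) (dcl \<Psi>)"
proof -
  have "L2 (wderiv \<Phi>)" "L2 (wderiv \<Psi>)" using assms deriv_rep_wderiv deriv_rep_L2 unfolding H10_def by blast+
  then show ?thesis by (simp add: h0_def dcl_def cinn_cls)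
qed

lemma H10_lin:
  assumes "H10 f" "H10 g"
  shows "H10 (\<lambda>x. a * f x + b * g x)" "dcl (\<lambda>x. a * f x + b * g x) = csc a (dcl f) + csc b (dcl g)"
    "cls (\<lambda>x. a * f x + b * g x) = csc a (cls f) + csc b (cls g)"
proof -
  obtain f' where f': "deriv_rep f f'" "L2 f'" "dcl f = cls f'" using assms(1) by (rule H10_E)
  obtain g' where g': "deriv_rep g g'" "L2 g'" "dcl g = cls g'" using assms(2) by (rule H10_E)
  note d = deriv_rep_lin[OF f'(1) g'(1), of a b]
  show "H10 (\<lambda>x. a * f x + b * g x)" using d assms by (auto simp: H10_def)
  show "dcl (\<lambda>x. a * f x + b * g x) = csc a (dcl f) + csc b (dcl g)"
    unfolding dcl_eq[OF d] f'(3) g'(3) using f'(2) g'(2) by (simp add: cls_add L2_cmult cls_csc)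
  show "cls (\<lambda>x. a * f x + b * g x) = csc a (cls f) + csc b (cls g)"
    using assms by (simp add: cls_add L2_cmult cls_csc H10_L2)
qed

lemma H10_cmult:
  assumes "H10 f"
  shows "H10 (\<lambda>x. a * f x)" "dcl (\<lambda>x. a * f x) = csc a (dcl f)" "cls (\<lambda>x. a * f x) = csc a (cls f)"
  using H10_lin[OF assms assms, of a 0] by simp_all

lemma H10_zero: "H10 (\<lambda>_. 0)" "dcl (\<lambda>_. 0) = 0"
proof -
  have d: "deriv_rep (\<lambda>_. 0) (\<lambda>_. 0)" by (simp add: deriv_rep_def L2_zero)
  show "H10 (\<lambda>_. 0)" using d by (auto simp: H10_def)
  show "dcl (\<lambda>_. 0) = 0" using dcl_eq[OF d] by (simp add: cls_zero)
qed

lemma H10_sum: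
  assumes "\<And>i. H10 (f i)" "finite A"
  shows "H10 (\<lambda>x. \<Sum>i\<in>A. c i * f i x) \<and> dcl (\<lambda>x. \<Sum>i\<in>A. c i * f i x) = (\<Sum>i\<in>A. csc (c i) (dcl (f i)))
     \<and> cls (\<lambda>x. \<Sum>i\<in>A. c i * f i x) = (\<Sum>i\<in>A. csc (c i) (cls (f i)))"
  using assms(2)
proof (induction A rule: finite_induct)
  case empty
  then show ?case by (simp add: H10_zero flip: cls_zero)
next
  case (insert n A)
  then show ?case using H10_lin[of "f n" "\<lambda>x. \<Sum>i\<in>A. c i * f i x" "c n" 1] assms(1) by simp
qed

text \<open>Sobolev embedding on an interval: the derivative controls the supremum, so limits in
  energy are uniform limits.\<close>

lemma deriv_rep_sup_bound:
  assumes "deriv_rep f g" "f 0 = 0" "x \<in> {0..1}" shows "cmod (f x) \<le> norm (cls g)"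
  using deriv_rep_eq[OF assms(1,3)] prim_bound[OF deriv_rep_L2[OF assms(1)] assms(3)] assms(2)
  by (simp add: norm_cls deriv_rep_L2[OF assms(1)])
text \<open>Continuity makes every point value, in particular the one at \<open>1/2\<close>, a
  function of the class.\<close>

lemma H10_cls_eq_imp:
  assumes "H10 f" "H10 g" "cls f = cls g" "x \<in> {0..1}" shows "f x = g x"
proof -
  note c = H10_cont[OF assms(1)] H10_cont[OF assms(2)]
  have cont: "continuous_on {0..1} (\<lambda>x. (cmod (f x - g x))\<^sup>2)" by (intro continuous_intros c)
  have "l2norm (\<lambda>x. f x - g x) = 0"
    using assms(3) H10_L2[OF assms(1)] H10_L2[OF assms(2)] by (simp add: norm_cls[symmetric] L2_diff cls_diff)
  then have "integral\<^sup>L unitI (\<lambda>x. (cmod (f x - g x))\<^sup>2) = 0" by (simp add: l2norm_def)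
  then have "integral {0..1} (\<lambda>x. (cmod (f x - g x))\<^sup>2) = 0"
    by (subst lebesgue_integral_eq_integral[symmetric]) (auto intro!: continuous_imp_integrable_real cont)
  then have "\<forall>x\<in>{0..1}. (cmod (f x - g x))\<^sup>2 = 0"
    by (subst (asm) integral_eq_0_iff[OF cont]) auto
  then show ?thesis using assms(4) by auto
qed

lemma H10_cls_eq_dcl:
  assumes "H10 f" "H10 g" "cls f = cls g" shows "dcl f = dcl g"
proof -
  obtain g' where g': "deriv_rep g g'" "L2 g'" "dcl g = cls g'" using assms(2) by (rule H10_E)
  have eq: "f x = g x" if "x \<in> {0..1}" for x using H10_cls_eq_imp[OF assms that] .
  then have "f x = f 0 + prim g' x" if "x \<in> {0..1}" for x
    using deriv_rep_eq[OF g'(1) that] that by (metis atLeastAtMost_iff order_refl zero_le_one)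
  then have "deriv_rep f g'" using g'(2) unfolding deriv_rep_prim by blast
  then show ?thesis using dcl_eq g'(3) by simp
qed

subsection \<open>Eigenfunction expansions and weak solutions\<close>

text \<open>Differentiation term by term: the derivatives are bounded, uniformly in
  \<open>t\<close>, by the terms of \<open>s1\<close>.\<close>

lemma cis_series_has_vector_derivative:
  fixes b :: "nat \<Rightarrow> complex" and l :: "nat \<Rightarrow> real"
  assumes s1: "summable (\<lambda>i. \<bar>l i\<bar> * cmod (b i))" and s0: "summable b"
  shows "((\<lambda>t. \<Sum>i. cis (- (t * l i)) * b i) has_vector_derivative (\<Sum>i. - \<i> * of_real (l i) * (cis (- (t * l i)) * b i))) (at t)"
proof -
  define f where "f i t = cis (- (t * l i)) * b i" for i t
  define a where "a i t = - \<i> * of_real (l i) * (cis (- (t * l i)) * b i)" for i t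
  have der: "(f i has_derivative (\<lambda>h. h *\<^sub>R a i t)) (at t within UNIV)" for i t
  proof -
    have "((\<lambda>t. exp (\<i> * of_real (- (t * l i))) * b i) has_vector_derivative a i t) (at t)"
      unfolding a_def cis_conv_exp
      by (rule derivative_eq_intros has_vector_derivative_real_field refl | simp)+
    then show ?thesis unfolding f_def cis_conv_exp has_vector_derivative_def by simp
  qed
  have ub: "uniform_limit UNIV (\<lambda>n t. \<Sum>i<n. a i t) (\<lambda>t. \<Sum>i. a i t) sequentially"
    by (rule Weierstrass_m_test[OF _ s1]) (simp add: a_def norm_mult)
  have "\<exists>g. \<forall>t\<in>UNIV. (\<lambda>n. f n t) sums g t \<and> (g has_derivative (\<lambda>h. h *\<^sub>R (\<Sum>i. a i t))) (at t within UNIV)"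
  proof (rule has_derivative_series[where f'="\<lambda>i t h. h *\<^sub>R a i t", OF convex_UNIV der])
    fix e :: real assume "e > 0"
    from uniform_limitD[OF ub this]
    show "\<forall>\<^sub>F n in sequentially. \<forall>t\<in>UNIV. \<forall>h. norm ((\<Sum>i<n. h *\<^sub>R a i t) - h *\<^sub>R (\<Sum>i. a i t)) \<le> e * norm h"
    proof eventually_elim
      case (elim n)
      show ?case
      proof (intro ballI allI)
        fix t h :: real
        have "norm ((\<Sum>i<n. h *\<^sub>R a i t) - h *\<^sub>R (\<Sum>i. a i t)) = \<bar>h\<bar> * dist (\<Sum>i<n. a i t) (\<Sum>i. a i t)"
          by (simp add: dist_norm scaleR_sum_right[symmetric] flip: scaleR_diff_right)
        also have "\<dots> \<le> \<bar>h\<bar> * e" using elim by (intro mult_left_mono) (auto intro: less_imp_le)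
        finally show "norm ((\<Sum>i<n. h *\<^sub>R a i t) - h *\<^sub>R (\<Sum>i. a i t)) \<le> e * norm h" by (simp add: mult.commute)
      qed
    qed
  next
    show "(\<lambda>n. f n 0) sums (\<Sum>i. b i)" using s0 by (simp add: f_def summable_sums)
  qed auto
  then obtain g where g: "\<And>t. (\<lambda>n. f n t) sums g t" "\<And>t. (g has_derivative (\<lambda>h. h *\<^sub>R (\<Sum>i. a i t))) (at t)" by auto
  have "g = (\<lambda>t. \<Sum>i. f i t)" using g(1) by (auto simp: sums_iff)
  then show ?thesis using g(2) by (simp add: has_vector_derivative_def f_def a_def)
qed

section \<open>The quadratic form and its eigensystems\<close>

definition aform :: "real \<Rightarrow> (real \<Rightarrow> complex) \<Rightarrow> (real \<Rightarrow> complex) \<Rightarrow> complex" where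
  "aform \<mu> \<Phi> \<Psi> = cinn (dcl \<Phi>) (dcl \<Psi>) + of_real \<mu> * (cnj (\<Phi> (1/2)) * \<Psi> (1/2))"

lemma aform_eq: "H10 \<Phi> \<Longrightarrow> H10 \<Psi> \<Longrightarrow> aform \<mu> \<Phi> \<Psi> = h0 \<Phi> \<Psi> + of_real \<mu> * h1 \<Phi> \<Psi>"
  by (simp add: aform_def h0_cinn h1_def)

lemma aform_cnj: "cnj (aform \<mu> \<Phi> \<Psi>) = aform \<mu> \<Psi> \<Phi>"
  by (simp add: aform_def cinn_commute)

lemma aform_self: "aform \<mu> \<Phi> \<Phi> = of_real ((norm (dcl \<Phi>))\<^sup>2 + \<mu> * (cmod (\<Phi> (1/2)))\<^sup>2)"
  by (simp add: aform_def cinn_self complex_norm_square mult.commute del: of_real_power)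

lemma aform_sum_right:
  assumes "\<And>i. H10 (f i)" "finite A"
  shows "aform \<mu> \<Phi> (\<lambda>x. \<Sum>i\<in>A. c i * f i x) = (\<Sum>i\<in>A. c i * aform \<mu> \<Phi> (f i))"
  using H10_sum[OF assms, of c]
  by (simp add: aform_def cinn_sum_right cinn_csc_right distrib_left sum.distrib sum_distrib_left algebra_simps)

text \<open>All that the dynamics requires of the Hamiltonian. The eigenvalue equation is tested
  against elements of the form domain, so operator domains do not enter; simplicity of the spectrum
  makes orthogonality automatic.\<close>

locale eigensys =
  fixes \<mu> :: real and \<phi> :: "nat \<Rightarrow> real \<Rightarrow> complex" and l :: "nat \<Rightarrow> real"
  assumes mu: "0 \<le> \<mu>"
    and H10_phi: "H10 (\<phi> n)"
    and l_pos: "l n > 0"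
    and l_inj: "l i = l j \<Longrightarrow> i = j"
    and eig: "H10 \<Phi> \<Longrightarrow> aform \<mu> \<Phi> (\<phi> n) = of_real (l n) * cinn (cls \<Phi>) (cls (\<phi> n))"
    and norm_phi: "norm (cls (\<phi> n)) = 1"
    and complete: "(\<And>n. cinn (cls (\<phi> n)) u = 0) \<Longrightarrow> u = 0"
begin

definition e :: "nat \<Rightarrow> ltwo" where "e n = cls (\<phi> n)"

text \<open>Evaluating the Hermitian form on a pair from both sides gives two different eigenvalues
  times the same inner product.\<close>

lemma onb_e: "onb e"
proof -
  have "cinn (e i) (e j) = 0" if "i \<noteq> j" for i j
  proof -
    have "of_real (l j) * cinn (e i) (e j) = aform \<mu> (\<phi> i) (\<phi> j)" by (simp add: e_def eig H10_phi)
    also have "\<dots> = cnj (aform \<mu> (\<phi> j) (\<phi> i))" by (simp add: aform_cnj)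
    also have "\<dots> = of_real (l i) * cinn (e i) (e j)" by (simp add: e_def eig H10_phi cinn_commute)
    finally have "of_real (l j - l i) * cinn (e i) (e j) = 0" by (simp add: algebra_simps)
    then show ?thesis using l_inj[of j i] that by auto
  qed
  moreover have "cinn (e i) (e i) = 1" for i by (simp add: cinn_self e_def norm_phi)
  ultimately show ?thesis using complete by (simp add: onb_def orthonormal_def e_def)
qed

lemmas orth = onb_orthonormal[OF onb_e]

lemma aform_partial_sum:
  assumes "finite A"
  shows "aform \<mu> (\<lambda>x. \<Sum>i\<in>A. c i * \<phi> i x) (\<lambda>x. \<Sum>i\<in>A. c i * \<phi> i x) = of_real (\<Sum>i\<in>A. l i * (cmod (c i))\<^sup>2)"
proof -
  note S = H10_sum[OF H10_phi assms, of c]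
  have "cinn (cls (\<lambda>x. \<Sum>i\<in>A. c i * \<phi> i x)) (cls (\<phi> j)) = cnj (c j)" if "j \<in> A" for j
  proof -
    have "cinn (cls (\<phi> j)) (cls (\<lambda>x. \<Sum>i\<in>A. c i * \<phi> i x)) = c j"
      using cinn_sum_orthonormal[OF orth assms, of j c] S that by (simp add: e_def)
    then show ?thesis by (metis cinn_commute)
  qed
  then show ?thesis using S
    by (simp add: aform_sum_right[OF H10_phi assms] eig complex_norm_square mult_ac del: of_real_power)
qed

text \<open>Bessel's inequality in energy: the form is nonnegative on the remainder \<open>R\<close>
  of a partial expansion, because \<open>0 \<le> \<mu>\<close>.\<close>

lemma form_bessel:
  assumes "H10 \<Phi>"
  shows "(\<Sum>i<n. l i * (cmod (cinn (e i) (cls \<Phi>)))\<^sup>2) \<le> (norm (dcl \<Phi>))\<^sup>2 + \<mu> * (cmod (\<Phi> (1/2)))\<^sup>2"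
proof -
  define d where "d i = cinn (e i) (cls \<Phi>)" for i
  define S where "S = (\<lambda>x. \<Sum>i<n. d i * \<phi> i x)"
  define B where "B = (\<Sum>i<n. l i * (cmod (d i))\<^sup>2)"
  have S: "H10 S" unfolding S_def using H10_sum[OF H10_phi, of "{..<n}" d] by simp
  define R where "R x = 1 * \<Phi> x + (-1) * S x" for x
  have R: "H10 R" "dcl R = dcl \<Phi> - dcl S" unfolding R_def using H10_lin[OF assms S, of 1 "-1"]
    by (simp_all add: csc_minus_left)
  have PS: "aform \<mu> \<Phi> S = of_real B"
    unfolding S_def B_def
    by (subst aform_sum_right[OF H10_phi]) (simp_all add: eig assms d_def e_def complex_norm_square cinn_commute mult_ac del: of_real_power)
  have SP: "aform \<mu> S \<Phi> = of_real B" using PS aform_cnj[of \<mu> \<Phi> S] by simp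
  have SS: "aform \<mu> S S = of_real B" unfolding S_def B_def by (rule aform_partial_sum) simp
  have "aform \<mu> R R = aform \<mu> \<Phi> \<Phi> - aform \<mu> \<Phi> S - aform \<mu> S \<Phi> + aform \<mu> S S"
    unfolding aform_def R(2) by (simp add: R_def cinn_diff_left cinn_diff_right algebra_simps)
  then have "complex_of_real ((norm (dcl R))\<^sup>2 + \<mu> * (cmod (R (1/2)))\<^sup>2)
    = of_real ((norm (dcl \<Phi>))\<^sup>2 + \<mu> * (cmod (\<Phi> (1/2)))\<^sup>2 - B)"
    using PS SP SS by (simp add: aform_self)
  then have "(norm (dcl R))\<^sup>2 + \<mu> * (cmod (R (1/2)))\<^sup>2 = (norm (dcl \<Phi>))\<^sup>2 + \<mu> * (cmod (\<Phi> (1/2)))\<^sup>2 - B"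
    by (simp only: of_real_eq_iff)
  moreover have "0 \<le> (norm (dcl R))\<^sup>2 + \<mu> * (cmod (R (1/2)))\<^sup>2" using mu by simp
  ultimately show ?thesis by (simp add: B_def d_def)
qed

lemma form_summable:
  assumes "H10 \<Phi>" shows "summable (\<lambda>i. l i * (cmod (cinn (e i) (cls \<Phi>)))\<^sup>2)"
  by (rule summableI_nonneg_bounded[OF _ form_bessel[OF assms]]) (simp add: l_pos less_imp_le)

text \<open>Finite energy forces convergence in the form domain. Since \<open>0 \<le> \<mu>\<close>,
  the form bounds the norm of the derivative, which bounds the supremum, so the boundary values and
  the value at \<open>1/2\<close> survive the limit.\<close>

lemma form_convergent:
  assumes s: "summable (\<lambda>i. l i * (cmod (c i))\<^sup>2)"
  obtains f where "H10 f" "(\<lambda>i. csc (c i) (e i)) sums cls f"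
    "(\<lambda>i. csc (c i) (dcl (\<phi> i))) sums dcl f" "(\<lambda>i. c i * \<phi> i (1/2)) sums f (1/2)"
proof -
  have sd: "summable (\<lambda>i. csc (c i) (dcl (\<phi> i)))"
    unfolding summable_Cauchy
  proof (intro allI impI)
    fix \<epsilon> :: real assume "\<epsilon> > 0"
    then have "\<epsilon>\<^sup>2 > 0" by simp
    then obtain N where N: "\<And>m n. m \<ge> N \<Longrightarrow> norm (\<Sum>i\<in>{m..<n}. l i * (cmod (c i))\<^sup>2) < \<epsilon>\<^sup>2"
      using s unfolding summable_Cauchy by blast
    have "norm (\<Sum>i\<in>{m..<n}. csc (c i) (dcl (\<phi> i))) < \<epsilon>" if "m \<ge> N" for m n
    proof (rule power2_less_imp_less)
      let ?S = "\<lambda>x. \<Sum>i\<in>{m..<n}. c i * \<phi> i x"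
      have "dcl ?S = (\<Sum>i\<in>{m..<n}. csc (c i) (dcl (\<phi> i)))" using H10_sum[OF H10_phi, of "{m..<n}" c] by simp
      moreover have "aform \<mu> ?S ?S = of_real (\<Sum>i\<in>{m..<n}. l i * (cmod (c i))\<^sup>2)"
        by (rule aform_partial_sum) simp
      then have "(norm (dcl ?S))\<^sup>2 + \<mu> * (cmod (?S (1/2)))\<^sup>2 = (\<Sum>i\<in>{m..<n}. l i * (cmod (c i))\<^sup>2)"
        by (simp only: aform_self of_real_eq_iff)
      moreover have "0 \<le> \<mu> * (cmod (?S (1/2)))\<^sup>2" using mu by simp
      ultimately show "(norm (\<Sum>i\<in>{m..<n}. csc (c i) (dcl (\<phi> i))))\<^sup>2 < \<epsilon>\<^sup>2"
        using N[OF that, of n] by (simp add: abs_less_iff)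
    qed (use \<open>\<epsilon> > 0\<close> in simp)
    then show "\<exists>N. \<forall>m\<ge>N. \<forall>n. norm (\<Sum>i\<in>{m..<n}. csc (c i) (dcl (\<phi> i))) < \<epsilon>" by blast
  qed
  define g where "g = rep_ltwo (\<Sum>i. csc (c i) (dcl (\<phi> i)))"
  have gL: "L2 g" and gc: "(\<lambda>i. csc (c i) (dcl (\<phi> i))) sums cls g"
    using sd by (simp_all add: g_def summable_sums)
  \<comment> \<open>The limit is built from its derivative, which makes it weakly differentiable by
    construction.\<close>
  define f where "f = prim g"
  have fg: "deriv_rep f g" unfolding deriv_rep_prim f_def using gL by simp
  define S where "S n = (\<lambda>x. \<Sum>i<n. c i * \<phi> i x)" for n
  define \<eta> where "\<eta> n = norm ((\<Sum>i<n. csc (c i) (dcl (\<phi> i))) - cls g)" for n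
  have \<eta>0: "\<eta> \<longlonglongrightarrow> 0" using gc unfolding sums_def \<eta>_def by (simp add: tendsto_norm_zero LIM_zero)
  have bound: "cmod (S n x - f x) \<le> \<eta> n" if x: "x \<in> {0..1}" for n x
  proof -
    have H: "H10 (S n)" and ds: "dcl (S n) = (\<Sum>i<n. csc (c i) (dcl (\<phi> i)))"
      unfolding S_def using H10_sum[OF H10_phi, of "{..<n}" c] by simp_all
    obtain g' where g': "deriv_rep (S n) g'" "L2 g'" "dcl (S n) = cls g'" using H by (rule H10_E)
    have "deriv_rep (\<lambda>x. 1 * S n x + (-1) * f x) (\<lambda>x. 1 * g' x + (-1) * g x)"
      by (rule deriv_rep_lin[OF g'(1) fg])
    then have "cmod (1 * S n x + (-1) * f x) \<le> norm (cls (\<lambda>x. 1 * g' x + (-1) * g x))"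
      by (rule deriv_rep_sup_bound) (use x H in \<open>auto simp: f_def H10_def\<close>)
    also have "cls (\<lambda>x. 1 * g' x + (-1) * g x) = dcl (S n) - cls g"
      using g' gL by (simp add: cls_diff)
    finally show ?thesis by (simp add: \<eta>_def ds)
  qed
  have lim: "(\<lambda>n. S n x) \<longlonglongrightarrow> f x" if "x \<in> {0..1}" for x
    by (rule Lim_transform[OF tendsto_const[of "f x"]], rule Lim_null_comparison[OF _ \<eta>0])
       (use bound[OF that] in simp)
  have "(\<lambda>n. S n 1) \<longlonglongrightarrow> f 1" by (rule lim) simp
  moreover have "S n 1 = 0" for n using H10_sum[OF H10_phi, of "{..<n}" c] by (simp add: S_def H10_def)
  ultimately have "f 1 = 0" by (simp add: LIMSEQ_const_iff)
  then have Hf: "H10 f" using fg by (auto simp: H10_def f_def)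
  have "(\<lambda>n. cls (S n)) \<longlonglongrightarrow> cls f"
  proof (rule Lim_transform[OF tendsto_const[of "cls f"]], rule Lim_null_comparison[OF _ \<eta>0])
    have "norm (cls (S n) - cls f) \<le> \<eta> n" for n
    proof -
      have H: "H10 (S n)" unfolding S_def using H10_sum[OF H10_phi, of "{..<n}" c] by simp
      have "norm (cls (S n) - cls f) = l2norm (\<lambda>x. S n x - f x)"
        using H10_L2[OF H] H10_L2[OF Hf] by (simp add: norm_cls[symmetric] cls_diff L2_diff)
      also have "\<dots> \<le> \<eta> n"
        using H10_L2[OF H] H10_L2[OF Hf] by (intro L2_bounded(2)[OF _ bound]) (auto simp: L2_def)
      finally show ?thesis .
    qed
    then show "\<forall>\<^sub>F n in sequentially. norm (cls (S n) - cls f) \<le> \<eta> n" by simp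
  qed
  moreover have "cls (S n) = (\<Sum>i<n. csc (c i) (e i))" for n
    using H10_sum[OF H10_phi, of "{..<n}" c] by (simp add: S_def e_def)
  ultimately have 2: "(\<lambda>i. csc (c i) (e i)) sums cls f" by (simp add: sums_def)
  have 3: "(\<lambda>i. c i * \<phi> i (1/2)) sums f (1/2)" using lim[of "1/2"] by (simp add: sums_def S_def)
  show ?thesis using that[OF Hf 2 _ 3] gc dcl_eq[OF fg] by simp
qed

text \<open>Parseval for the form. The expansion of \<open>f\<close> converges in the form domain to
  some \<open>f'\<close> of the same class, hence with the same derivative class and the same value
  at \<open>1/2\<close>.\<close>

lemma aform_sums:
  assumes "H10 \<Phi>" "H10 f"
  shows "(\<lambda>i. of_real (l i) * (cnj (cinn (e i) (cls \<Phi>)) * cinn (e i) (cls f))) sums aform \<mu> \<Phi> f"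
proof -
  define c where "c i = cinn (e i) (cls f)" for i
  obtain f' where f': "H10 f'" "(\<lambda>i. csc (c i) (e i)) sums cls f'"
    "(\<lambda>i. csc (c i) (dcl (\<phi> i))) sums dcl f'" "(\<lambda>i. c i * \<phi> i (1/2)) sums f' (1/2)"
    using form_convergent[of c] form_summable[OF assms(2)] unfolding c_def by blast
  have "cls f' = cls f" using sums_unique2[OF f'(2)] onb_expansion[OF onb_e, of "cls f"] by (simp add: c_def)
  then have eq: "dcl f' = dcl f" "f' (1/2) = f (1/2)"
    using H10_cls_eq_dcl[OF f'(1) assms(2)] H10_cls_eq_imp[OF f'(1) assms(2), of "1/2"] by auto
  have "(\<lambda>i. c i * cinn (dcl \<Phi>) (dcl (\<phi> i))) sums cinn (dcl \<Phi>) (dcl f)"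
    using bounded_linear.sums[OF bounded_linear_cinn f'(3)] by (simp add: cinn_csc_right eq)
  moreover have "(\<lambda>i. of_real \<mu> * cnj (\<Phi> (1/2)) * (c i * \<phi> i (1/2))) sums (of_real \<mu> * cnj (\<Phi> (1/2)) * f (1/2))"
    using sums_mult[OF f'(4)] by (simp add: eq)
  ultimately have "(\<lambda>i. c i * cinn (dcl \<Phi>) (dcl (\<phi> i)) + of_real \<mu> * cnj (\<Phi> (1/2)) * (c i * \<phi> i (1/2))) sums aform \<mu> \<Phi> f"
    unfolding aform_def using sums_add by (fastforce simp: mult.assoc)
  moreover have "c i * cinn (dcl \<Phi>) (dcl (\<phi> i)) + of_real \<mu> * cnj (\<Phi> (1/2)) * (c i * \<phi> i (1/2))
     = of_real (l i) * (cnj (cinn (e i) (cls \<Phi>)) * c i)" for i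
  proof -
    have "c i * cinn (dcl \<Phi>) (dcl (\<phi> i)) + of_real \<mu> * cnj (\<Phi> (1/2)) * (c i * \<phi> i (1/2)) = c i * aform \<mu> \<Phi> (\<phi> i)"
      by (simp add: aform_def algebra_simps)
    also have "\<dots> = of_real (l i) * (cnj (cinn (e i) (cls \<Phi>)) * c i)"
      using assms(1) by (simp add: eig e_def cinn_commute)
    finally show ?thesis .
  qed
  ultimately show ?thesis by (simp add: c_def)
qed

text \<open>Phases leave the energy sum unchanged, so \<open>form_convergent\<close> applies to the
  evolved coefficients.\<close>

lemma grp_H10:
  assumes "H10 f" obtains f' where "H10 f'" "cls f' = grp e l t (cls f)"
proof -
  define c where "c i = cinn (e i) (grp e l t (cls f))" for i
  have "summable (\<lambda>i. l i * (cmod (c i))\<^sup>2)"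
    using form_summable[OF assms] by (simp add: c_def coeff_grp[OF onb_e] norm_mult)
  then obtain f' where "H10 f'" "(\<lambda>i. csc (c i) (e i)) sums cls f'" by (rule form_convergent)
  then show ?thesis using that sums_unique2[OF onb_expansion[OF onb_e, of "grp e l t (cls f)"]]
    unfolding c_def by metis
qed

text \<open>Pairing with \<open>\<Phi>\<close> gives a series of exponentials. Both functions have
  finite energy, so the bound \<open>x * y \<le> x^2 + y^2\<close> on products of coefficients makes
  even the differentiated series converge absolutely.\<close>

lemma grp_weak_solution:
  assumes \<Phi>: "H10 \<Phi>" and f: "H10 f" and f': "H10 f'" "cls f' = grp e l t (cls f)"
  shows "\<exists>D. ((\<lambda>t. cinn (cls \<Phi>) (grp e l t (cls f))) has_vector_derivative D) (at t) \<and> \<i> * D = aform \<mu> \<Phi> f'"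
proof -
  define b where "b i = cnj (cinn (e i) (cls \<Phi>)) * cinn (e i) (cls f)" for i
  have s1: "summable (\<lambda>i. \<bar>l i\<bar> * cmod (b i))"
  proof (rule summable_comparison_test)
    show "summable (\<lambda>i. l i * (cmod (cinn (e i) (cls \<Phi>)))\<^sup>2 + l i * (cmod (cinn (e i) (cls f)))\<^sup>2)"
      by (intro summable_add form_summable \<Phi> f)
    have "norm (\<bar>l i\<bar> * cmod (b i)) \<le> l i * (cmod (cinn (e i) (cls \<Phi>)))\<^sup>2 + l i * (cmod (cinn (e i) (cls f)))\<^sup>2" for i
    proof -
      let ?x = "cmod (cinn (e i) (cls \<Phi>))" and ?y = "cmod (cinn (e i) (cls f))"
      have "0 \<le> ?x * ?y" by simp
      then have "?x * ?y \<le> ?x\<^sup>2 + ?y\<^sup>2" using sum_squares_bound[of ?x ?y] by linarith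
      then have "l i * (?x * ?y) \<le> l i * (?x\<^sup>2 + ?y\<^sup>2)" using l_pos[of i] by (intro mult_left_mono) auto
      then show ?thesis using l_pos[of i] by (simp add: b_def norm_mult distrib_left)
    qed
    then show "\<exists>N. \<forall>i\<ge>N. norm (\<bar>l i\<bar> * cmod (b i)) \<le> l i * (cmod (cinn (e i) (cls \<Phi>)))\<^sup>2 + l i * (cmod (cinn (e i) (cls f)))\<^sup>2"
      by blast
  qed
  have s0: "summable b" unfolding b_def using onb_cinn_sums[OF onb_e] by (rule sums_summable)
  have "(\<lambda>t. \<Sum>i. cis (- (t * l i)) * b i) = (\<lambda>t. cinn (cls \<Phi>) (grp e l t (cls f)))"
  proof
    fix t
    have "(\<lambda>i. cis (- (t * l i)) * b i) sums cinn (cls \<Phi>) (grp e l t (cls f))"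
      using onb_cinn_sums[OF onb_e, of "cls \<Phi>" "grp e l t (cls f)"]
      by (simp add: coeff_grp[OF onb_e] b_def mult_ac)
    then show "(\<Sum>i. cis (- (t * l i)) * b i) = cinn (cls \<Phi>) (grp e l t (cls f))" by (simp add: sums_iff)
  qed
  with cis_series_has_vector_derivative[OF s1 s0, of t]
  have D: "((\<lambda>t. cinn (cls \<Phi>) (grp e l t (cls f))) has_vector_derivative (\<Sum>i. - \<i> * of_real (l i) * (cis (- (t * l i)) * b i))) (at t)"
    by simp
  have "(\<lambda>i. of_real (l i) * (cis (- (t * l i)) * b i)) sums aform \<mu> \<Phi> f'"
    using aform_sums[OF \<Phi> f'(1)] by (simp add: f'(2) coeff_grp[OF onb_e] b_def mult_ac)
  then have "(\<lambda>i. - \<i> * (of_real (l i) * (cis (- (t * l i)) * b i))) sums (- \<i> * aform \<mu> \<Phi> f')"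
    by (rule sums_mult)
  then have "(\<Sum>i. - \<i> * of_real (l i) * (cis (- (t * l i)) * b i)) = - \<i> * aform \<mu> \<Phi> f'"
    by (simp add: sums_iff mult.assoc)
  with D show ?thesis by (intro exI[of _ "- \<i> * aform \<mu> \<Phi> f'"]) (simp flip: mult.assoc)
qed

end

subsection \<open>Eigenfunctions of the delta potential\<close>

text \<open>A sine on the left half, continued by \<open>\<sigma>\<close> times its mirror image:
  \<open>\<sigma> = 1\<close> gives the symmetric and \<open>\<sigma> = -1\<close> the antisymmetric
  candidate for an eigenfunction with eigenvalue \<open>\<kappa>^2\<close>.\<close>

definition psi :: "real \<Rightarrow> real \<Rightarrow> real \<Rightarrow> complex" where
  "psi \<kappa> \<sigma> x = complex_of_real (if x \<le> 1/2 then sin (\<kappa> * x) else \<sigma> * sin (\<kappa> * (1 - x)))"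

definition dpsi :: "real \<Rightarrow> real \<Rightarrow> real \<Rightarrow> complex" where
  "dpsi \<kappa> \<sigma> x = complex_of_real (if x \<le> 1/2 then \<kappa> * cos (\<kappa> * x) else - \<sigma> * \<kappa> * cos (\<kappa> * (1 - x)))"

lemma FTC_piecewise:
  fixes f g f' g' :: "real \<Rightarrow> real"
  assumes f: "\<And>x. (f has_real_derivative f' x) (at x)" and g: "\<And>x. (g has_real_derivative g' x) (at x)"
    and eq: "f (1/2) = g (1/2)" and "a \<le> b"
  shows "((\<lambda>x. complex_of_real (if x \<le> 1/2 then f' x else g' x)) has_integral
     complex_of_real (if b \<le> 1/2 then f b else g b) - complex_of_real (if a \<le> 1/2 then f a else g a)) {a..b}"
proof (rule fundamental_theorem_of_calculus_interior_strong[where S="{1/2}"])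
  fix x assume x: "x \<in> {a<..<b} - {1/2}"
  have "((\<lambda>x. if x \<le> 1/2 then f x else g x) has_real_derivative (if x \<le> 1/2 then f' x else g' x)) (at x)"
  proof (cases "x < 1/2")
    case True
    have "((\<lambda>x. if x \<le> 1/2 then f x else g x) has_real_derivative f' x) (at x)"
      by (rule has_field_derivative_transform_within_open[OF f open_lessThan[of "1/2"]]) (use True in auto)
    then show ?thesis using True by simp
  next
    case False
    then have F: "x > 1/2" using x by auto
    have "((\<lambda>x. if x \<le> 1/2 then f x else g x) has_real_derivative g' x) (at x)"
      by (rule has_field_derivative_transform_within_open[OF g open_greaterThan[of "1/2"]]) (use F in auto)
    then show ?thesis using F by simp
  qed
  then show "((\<lambda>x. complex_of_real (if x \<le> 1/2 then f x else g x)) has_vector_derivative complex_of_real (if x \<le> 1/2 then f' x else g' x)) (at x)"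
    by (rule has_vector_derivative_of_real)
next
  have cf: "continuous_on S f" "continuous_on S g" for S
    by (meson f g DERIV_isCont continuous_at_imp_continuous_on)+
  have "continuous_on {a..b} (\<lambda>x. if x \<le> 1/2 then f x else g x)"
  proof (rule continuous_on_cases_le)
    show "f x = g x" if "x \<in> {a..b}" "x = 1/2" for x using eq unfolding that(2) .
  qed (auto intro!: continuous_intros cf)
  then show "continuous_on {a..b} (\<lambda>x. complex_of_real (if x \<le> 1/2 then f x else g x))"
    by (intro continuous_intros)
qed (use \<open>a \<le> b\<close> in auto)

lemma dpsi_measurable: "dpsi \<kappa> \<sigma> \<in> borel_measurable unitI"
  unfolding dpsi_def[abs_def] by measurable

text \<open>Hypothesis \<open>c\<close> is continuity at \<open>1/2\<close>; for
  \<open>\<sigma> = -1\<close> it forces the sine to vanish there.\<close>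

lemma psi_deriv_rep:
  assumes s: "\<bar>\<sigma>\<bar> = 1" and c: "sin (\<kappa> / 2) = \<sigma> * sin (\<kappa> / 2)"
  shows "deriv_rep (psi \<kappa> \<sigma>) (dpsi \<kappa> \<sigma>)"
  unfolding deriv_rep_prim
proof (intro conjI ballI)
  have "cmod (dpsi \<kappa> \<sigma> x) \<le> \<bar>\<kappa>\<bar>" for x
    using s mult_left_mono[OF abs_cos_le_one abs_ge_zero, of \<kappa>] by (auto simp: dpsi_def abs_mult simp del: of_real_mult)
  then show L: "L2 (dpsi \<kappa> \<sigma>)" by (intro L2_bounded(1) dpsi_measurable)
  fix x :: real assume x: "x \<in> {0..1}"
  have "(dpsi \<kappa> \<sigma> has_integral psi \<kappa> \<sigma> x - psi \<kappa> \<sigma> 0) {0..x}"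
    unfolding psi_def[abs_def] dpsi_def[abs_def]
    by (rule FTC_piecewise) (use x c in \<open>auto intro!: derivative_eq_intros simp: field_simps\<close>)
  then show "psi \<kappa> \<sigma> x = psi \<kappa> \<sigma> 0 + prim (dpsi \<kappa> \<sigma>) x"
    using prim_HK[OF L2_integrable(1)[OF L] x] by (simp add: integral_unique)
qed

lemma psi_H10:
  assumes s: "\<bar>\<sigma>\<bar> = 1" and c: "sin (\<kappa> / 2) = \<sigma> * sin (\<kappa> / 2)"
  shows "H10 (psi \<kappa> \<sigma>)"
  using psi_deriv_rep[OF assms] by (auto simp: H10_def psi_def)

lemma prim_cnj: "prim (\<lambda>x. cnj (g x)) x = cnj (prim g x)"
  unfolding prim_def by (rule Bochner_Integration.integral_cnj)

text \<open>Hypothesis \<open>jump\<close> is the delta condition at \<open>1/2\<close>. Integrating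
  the equation from \<open>x\<close> to 1 writes \<open>dpsi\<close> as a constant, a step at
  \<open>1/2\<close> and \<open>\<kappa>^2\<close> times the tail integral of \<open>psi\<close>.
  Paired with the derivative of \<open>\<Phi>\<close>, the constant meets
  \<open>\<Phi> 1 = 0\<close>, the step gives the point interaction and the tail integral, by
  Fubini, the inner product with \<open>\<Phi>\<close>.\<close>

lemma psi_eig:
  assumes s: "\<bar>\<sigma>\<bar> = 1" and c: "sin (\<kappa> / 2) = \<sigma> * sin (\<kappa> / 2)"
    and jump: "- (1 + \<sigma>) * \<kappa> * cos (\<kappa> / 2) = \<mu> * sin (\<kappa> / 2)"
    and \<Phi>: "H10 \<Phi>"
  shows "aform \<mu> \<Phi> (psi \<kappa> \<sigma>) = of_real (\<kappa>\<^sup>2) * cinn (cls \<Phi>) (cls (psi \<kappa> \<sigma>))"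
proof -
  note H = psi_H10[OF s c]
  obtain g where g: "deriv_rep \<Phi> g" "L2 g" "dcl \<Phi> = cls g" using \<Phi> by (rule H10_E)
  have \<Phi>eq: "\<Phi> x = prim g x" if "x \<in> {0..1}" for x
    using deriv_rep_eq[OF g(1) that] \<Phi> by (simp add: H10_def)
  have dL: "L2 (dpsi \<kappa> \<sigma>)" by (rule deriv_rep_L2[OF psi_deriv_rep[OF s c]])
  have gi: "integrable unitI (\<lambda>x. cnj (g x))" using L2_integrable(1)[OF g(2)] by simp
  have pL: "L2 (psi \<kappa> \<sigma>)" by (rule H10_L2[OF H])
  have pi: "integrable unitI (psi \<kappa> \<sigma>)" by (rule L2_integrable[OF pL])
  define Q where "Q x = integral\<^sup>L (lebesgue_on {x..1}) (psi \<kappa> \<sigma>)" for x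
  define C where "C = complex_of_real (- \<sigma> * \<kappa>)"
  define J where "J = complex_of_real (\<mu> * sin (\<kappa> / 2))"
  \<comment> \<open>Raising the left branch of the derivative by \<open>J\<close> makes it
    continuous at \<open>1/2\<close>, by \<open>jump\<close>, so that \<open>FTC_piecewise\<close>
    applies.\<close>
  have d: "dpsi \<kappa> \<sigma> x = C - indicator {0..1/2} x *\<^sub>R J + of_real (\<kappa>\<^sup>2) * Q x" if x: "x \<in> {0..1}" for x
  proof -
    have "((\<lambda>y. complex_of_real (if y \<le> 1/2 then - \<kappa>\<^sup>2 * sin (\<kappa> * y) else - \<kappa>\<^sup>2 * (\<sigma> * sin (\<kappa> * (1 - y))))) has_integral
      complex_of_real (if 1 \<le> (1/2::real) then \<kappa> * cos (\<kappa> * 1) + \<mu> * sin (\<kappa> / 2) else - \<sigma> * \<kappa> * cos (\<kappa> * (1 - 1)))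
       - complex_of_real (if x \<le> 1/2 then \<kappa> * cos (\<kappa> * x) + \<mu> * sin (\<kappa> / 2) else - \<sigma> * \<kappa> * cos (\<kappa> * (1 - x)))) {x..1}"
      by (rule FTC_piecewise) (use x jump in \<open>auto intro!: derivative_eq_intros simp: field_simps power2_eq_square\<close>)
    moreover have "(\<lambda>y. complex_of_real (if y \<le> 1/2 then - \<kappa>\<^sup>2 * sin (\<kappa> * y) else - \<kappa>\<^sup>2 * (\<sigma> * sin (\<kappa> * (1 - y)))))
       = (\<lambda>y. - of_real (\<kappa>\<^sup>2) * psi \<kappa> \<sigma> y)" by (auto simp: psi_def)
    ultimately have 1: "((\<lambda>y. - of_real (\<kappa>\<^sup>2) * psi \<kappa> \<sigma> y) has_integral C - (dpsi \<kappa> \<sigma> x + indicator {0..1/2} x *\<^sub>R J)) {x..1}"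
      using x by (auto simp: C_def dpsi_def J_def indicator_def)
    have "(psi \<kappa> \<sigma> has_integral Q x) {x..1}"
      unfolding Q_def using x by (intro has_integral_integral_lebesgue_on integrable_subinterval_lebesgue[OF pi]) auto
    then have "((\<lambda>y. - of_real (\<kappa>\<^sup>2) * psi \<kappa> \<sigma> y) has_integral - of_real (\<kappa>\<^sup>2) * Q x) {x..1}"
      by (rule has_integral_mult_right)
    from has_integral_unique[OF this 1] show ?thesis by (simp add: algebra_simps)
  qed
  have Qm: "integrable unitI (\<lambda>x. cnj (g x) * (of_real (\<kappa>\<^sup>2) * Q x))"
  proof -
    have i1: "integrable unitI (\<lambda>x. cnj (g x) * dpsi \<kappa> \<sigma> x)" by (rule L2_cnj_mult_integrable[OF g(2) dL])
    have i2: "integrable unitI (\<lambda>x. cnj (g x) * C)" using gi by simp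
    have i3: "integrable unitI (\<lambda>x. (indicator {0..1/2} x *\<^sub>R cnj (g x)) * J)"
      by (intro integrable_mult_left integrable_mult_indicator gi) (simp add: sets_restrict_space_iff)
    have "integrable unitI (\<lambda>x. cnj (g x) * dpsi \<kappa> \<sigma> x - cnj (g x) * C + (indicator {0..1/2} x *\<^sub>R cnj (g x)) * J)"
      by (intro Bochner_Integration.integrable_add Bochner_Integration.integrable_diff i1 i2 i3)
    then show ?thesis
      by (rule iffD1[OF Bochner_Integration.integrable_cong[OF refl], rotated]) (simp add: d algebra_simps)
  qed
  have z: "integral\<^sup>L unitI (\<lambda>x. cnj (g x)) = 0"
  proof -
    have "integral\<^sup>L unitI (\<lambda>x. cnj (g x)) = prim (\<lambda>x. cnj (g x)) 1" by (simp add: prim_def)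
    also have "\<dots> = cnj (\<Phi> 1)" by (simp add: prim_cnj \<Phi>eq)
    finally show ?thesis using \<Phi> by (simp add: H10_def)
  qed
  have h: "integral\<^sup>L unitI (\<lambda>x. indicator {0..1/2} x *\<^sub>R cnj (g x)) = cnj (\<Phi> (1/2))"
    using prim_eq[of "1/2" "\<lambda>x. cnj (g x)"] by (simp add: prim_cnj \<Phi>eq)
  have q: "integral\<^sup>L unitI (\<lambda>x. cnj (g x) * Q x) = l2inner \<Phi> (psi \<kappa> \<sigma>)"
  proof -
    have "integral\<^sup>L unitI (\<lambda>x. cnj (g x) * Q x) = integral\<^sup>L unitI (\<lambda>y. prim (\<lambda>x. cnj (g x)) y * psi \<kappa> \<sigma> y)"
      unfolding Q_def by (rule integral_prim_mult[OF gi pi, symmetric])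
    also have "\<dots> = l2inner \<Phi> (psi \<kappa> \<sigma>)"
      unfolding l2inner_def by (intro Bochner_Integration.integral_cong) (auto simp: prim_cnj \<Phi>eq)
    finally show ?thesis .
  qed
  have "l2inner g (dpsi \<kappa> \<sigma>) = integral\<^sup>L unitI (\<lambda>x. (cnj (g x) * C - (indicator {0..1/2} x *\<^sub>R cnj (g x)) * J) + cnj (g x) * (of_real (\<kappa>\<^sup>2) * Q x))"
    unfolding l2inner_def by (intro Bochner_Integration.integral_cong) (auto simp: d algebra_simps)
  also have "\<dots> = integral\<^sup>L unitI (\<lambda>x. cnj (g x) * C) - integral\<^sup>L unitI (\<lambda>x. (indicator {0..1/2} x *\<^sub>R cnj (g x)) * J)
     + integral\<^sup>L unitI (\<lambda>x. cnj (g x) * (of_real (\<kappa>\<^sup>2) * Q x))"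
  proof -
    have i2: "integrable unitI (\<lambda>x. cnj (g x) * C)" using gi by simp
    have i3: "integrable unitI (\<lambda>x. (indicator {0..1/2} x *\<^sub>R cnj (g x)) * J)"
      by (intro integrable_mult_left integrable_mult_indicator gi) (simp add: sets_restrict_space_iff)
    show ?thesis
      by (subst Bochner_Integration.integral_add[OF Bochner_Integration.integrable_diff[OF i2 i3] Qm],
          subst Bochner_Integration.integral_diff[OF i2 i3]) (rule refl)
  qed
  also have "integral\<^sup>L unitI (\<lambda>x. cnj (g x) * C) = 0"
    by (subst integral_mult_left_zero) (simp only: z mult_zero_left)
  also have "integral\<^sup>L unitI (\<lambda>x. (indicator {0..1/2} x *\<^sub>R cnj (g x)) * J) = cnj (\<Phi> (1/2)) * J"
    by (subst integral_mult_left_zero) (simp only: h)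
  also have "integral\<^sup>L unitI (\<lambda>x. cnj (g x) * (of_real (\<kappa>\<^sup>2) * Q x)) = of_real (\<kappa>\<^sup>2) * l2inner \<Phi> (psi \<kappa> \<sigma>)"
    unfolding q[symmetric] by (subst integral_mult_right_zero[symmetric]) (simp add: mult_ac)
  finally have "l2inner g (dpsi \<kappa> \<sigma>) + cnj (\<Phi> (1/2)) * J = of_real (\<kappa>\<^sup>2) * l2inner \<Phi> (psi \<kappa> \<sigma>)" by simp
  moreover have "aform \<mu> \<Phi> (psi \<kappa> \<sigma>) = l2inner g (dpsi \<kappa> \<sigma>) + cnj (\<Phi> (1/2)) * J"
    unfolding aform_def g(3) dcl_eq[OF psi_deriv_rep[OF s c]] using g(2) dL
    by (simp add: cinn_cls J_def psi_def)
  ultimately show ?thesis using H10_L2[OF \<Phi>] pL by (simp add: cinn_cls)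
qed

text \<open>Index \<open>n\<close> stands for \<open>k = n + 1\<close>, so the functions symmetric about \<open>1/2\<close> carry the even
  indices. The last clause of \<open>quantized\<close> is the jump \<open>\<psi>'(1/2+) - \<psi>'(1/2-) = \<mu> \<psi>(1/2)\<close> that the form
  imposes on its eigenfunctions.\<close>

definition kap :: "(nat \<Rightarrow> real) \<Rightarrow> nat \<Rightarrow> real" where "kap \<delta> n = real (n + 1) * pi + \<delta> n"

definition quantized :: "real \<Rightarrow> (nat \<Rightarrow> real) \<Rightarrow> bool" where
  "quantized \<mu> \<delta> \<longleftrightarrow> (\<forall>n. (odd n \<longrightarrow> \<delta> n = 0) \<and> 0 \<le> \<delta> n \<and> \<delta> n \<le> \<mu> / (real (n + 1) * pi) \<and>
      (even n \<longrightarrow> - 2 * kap \<delta> n * cos (kap \<delta> n / 2) = \<mu> * sin (kap \<delta> n / 2)))"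

definition rpsi :: "(nat \<Rightarrow> real) \<Rightarrow> nat \<Rightarrow> real \<Rightarrow> complex" where
  "rpsi \<delta> n = psi (kap \<delta> n) ((-1) ^ n)"

section \<open>Quantized momenta and completeness of the eigenfunctions\<close>

lemma sin_half_even_mult: "odd n \<Longrightarrow> sin (real (n + 1) * pi / 2) = 0"
proof -
  assume "odd n"
  then obtain m where "n = 2 * m + 1" by (rule oddE)
  then have "real (n + 1) * pi / 2 = real (m + 1) * pi" by (simp add: field_simps)
  then show ?thesis using sin_npi[of "m + 1"] by metis
qed

lemma cos_half_odd_mult: "even n \<Longrightarrow> cos (real (n + 1) * pi / 2) = 0"
proof -
  assume "even n"
  then obtain m where "n = 2 * m" by (rule evenE)
  then have e: "real (n + 1) * pi / 2 = real m * pi + pi / 2" by (simp add: field_simps)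
  show ?thesis unfolding e by (simp add: cos_add)
qed

text \<open>For odd \<open>n\<close> the sine at \<open>1/2\<close> and the factor
  \<open>1 + (-1) ^ n\<close> both vanish, so the coupling does not enter.\<close>

lemma rpsi_conditions:
  assumes "quantized \<mu> \<delta>"
  shows "\<bar>(-1) ^ n\<bar> = (1::real)" "sin (kap \<delta> n / 2) = (-1) ^ n * sin (kap \<delta> n / 2)"
    "- (1 + (-1) ^ n) * kap \<delta> n * cos (kap \<delta> n / 2) = \<mu> * sin (kap \<delta> n / 2)"
proof -
  show "\<bar>(-1) ^ n\<bar> = (1::real)" by (simp add: power_abs)
  have "sin (kap \<delta> n / 2) = 0" if "odd n"
    using assms that sin_half_even_mult[OF that] by (simp add: quantized_def kap_def)
  then show "sin (kap \<delta> n / 2) = (-1) ^ n * sin (kap \<delta> n / 2)"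
    "- (1 + (-1) ^ n) * kap \<delta> n * cos (kap \<delta> n / 2) = \<mu> * sin (kap \<delta> n / 2)"
    using assms by (cases "even n"; simp add: quantized_def)+
qed

lemma rpsi_H10: "quantized \<mu> \<delta> \<Longrightarrow> H10 (rpsi \<delta> n)"
  unfolding rpsi_def by (intro psi_H10 rpsi_conditions)

lemma rpsi_eig:
  "quantized \<mu> \<delta> \<Longrightarrow> H10 \<Phi> \<Longrightarrow> aform \<mu> \<Phi> (rpsi \<delta> n) = of_real ((kap \<delta> n)\<^sup>2) * cinn (cls \<Phi>) (cls (rpsi \<delta> n))"
  unfolding rpsi_def by (intro psi_eig rpsi_conditions)

text \<open>The \<open>1/3\<close> comes from \<open>\<mu> \<le> 1\<close> and
  \<open>(n + 1) * pi > 3\<close>. It is below \<open>pi\<close>, which keeps the momenta in order,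
  and below \<open>1 / sqrt 2\<close>, which keeps the eigenfunctions away from zero.\<close>

lemma kap_bounds:
  assumes "quantized \<mu> \<delta>" "\<mu> \<le> 1"
  shows "0 \<le> \<delta> n" "\<delta> n < 1/3" "\<delta> n \<le> \<mu> / (real (n + 1) * pi)" "kap \<delta> n > 0"
proof -
  show "0 \<le> \<delta> n" and le: "\<delta> n \<le> \<mu> / (real (n + 1) * pi)" using assms by (auto simp: quantized_def)
  have "1 * pi \<le> real (n + 1) * pi" by (intro mult_right_mono) auto
  then have "3 < real (n + 1) * pi" using pi_gt3 by linarith
  moreover have "\<mu> / K \<le> 1 / K" "1 / K < 1/3" if "3 < K" for K :: real
    using assms(2) that by (auto intro!: divide_right_mono divide_strict_left_mono)
  ultimately have "\<mu> / (real (n + 1) * pi) \<le> 1 / (real (n + 1) * pi)" "1 / (real (n + 1) * pi) < 1/3" by blast+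
  then show "\<delta> n < 1/3" using le by linarith
  show "kap \<delta> n > 0" using \<open>0 \<le> \<delta> n\<close> by (simp add: kap_def add_pos_nonneg)
qed

lemma kap_strict_mono:
  assumes "quantized \<mu> \<delta>" "\<mu> \<le> 1" "i < j" shows "kap \<delta> i < kap \<delta> j"
proof -
  have "kap \<delta> i < real (i + 1) * pi + pi" using kap_bounds(2)[OF assms(1,2), of i] pi_gt3 by (simp add: kap_def)
  also have "\<dots> = real (i + 2) * pi" by (simp add: algebra_simps)
  also have "\<dots> \<le> real (j + 1) * pi" using assms(3) by (intro mult_right_mono) auto
  also have "\<dots> \<le> kap \<delta> j" using kap_bounds(1)[OF assms(1,2), of j] by (simp add: kap_def)
  finally show ?thesis .
qed

lemma kap_sq_inj:
  assumes "quantized \<mu> \<delta>" "\<mu> \<le> 1" "(kap \<delta> i)\<^sup>2 = (kap \<delta> j)\<^sup>2" shows "i = j"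
proof -
  have "kap \<delta> i = kap \<delta> j"
    using assms(3) kap_bounds(4)[OF assms(1,2)] by (metis less_imp_le power2_eq_iff_nonneg)
  then show ?thesis using kap_strict_mono[OF assms(1,2)] by (metis linorder_neqE_nat less_irrefl)
qed

text \<open>Up to sign the value is \<open>cos (\<delta> n / 2)\<close>. This is what separates the
  eigenfunctions of different couplings.\<close>

lemma psi_half_nonzero:
  assumes "quantized \<mu> \<delta>" "\<mu> \<le> 1" "even n" shows "rpsi \<delta> n (1/2) \<noteq> 0"
proof -
  note b = kap_bounds[OF assms(1,2), of n]
  have "sin (kap \<delta> n / 2) = sin (real (n + 1) * pi / 2) * cos (\<delta> n / 2) + cos (real (n + 1) * pi / 2) * sin (\<delta> n / 2)"
    by (simp add: kap_def add_divide_distrib sin_add)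
  moreover have "cos (real (n + 1) * pi / 2) = 0"
    using assms(3) by (rule cos_half_odd_mult)
  moreover have "sin (real (n + 1) * pi / 2) \<noteq> 0"
    using sin_cos_squared_add[of "real (n + 1) * pi / 2"] \<open>cos (real (n + 1) * pi / 2) = 0\<close> by (metis add.right_neutral power_zero_numeral zero_neq_one)
  moreover have "cos (\<delta> n / 2) > 0" using b pi_gt3 by (intro cos_gt_zero_pi) auto
  ultimately show ?thesis by (simp add: rpsi_def psi_def)
qed

lemma quantized_0: "quantized 0 (\<lambda>_. 0)"
  using cos_half_odd_mult by (simp add: quantized_def kap_def)

lemma rpsi_0: "x \<in> {0..1} \<Longrightarrow> rpsi (\<lambda>_. 0) n x = complex_of_real (sin (real (n + 1) * pi * x))"
proof -
  have "sin (real (n + 1) * pi * (1 - x)) = (-1) ^ n * sin (real (n + 1) * pi * x)"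
  proof -
    have "sin (real (n + 1) * pi * (1 - x)) = sin (real (n + 1) * pi - real (n + 1) * pi * x)" by (simp add: algebra_simps)
    also have "\<dots> = - cos (real (n + 1) * pi) * sin (real (n + 1) * pi * x)" unfolding sin_diff sin_npi by simp
    also have "cos (real (n + 1) * pi) = (-1) ^ (n + 1)" by (rule cos_npi)
    finally show ?thesis by simp
  qed
  then show ?thesis by (simp add: rpsi_def psi_def kap_def flip: mult.assoc power_add)
qed

lemma norm_rpsi_0: "norm (cls (\<lambda>x. of_real (sqrt 2) * rpsi (\<lambda>_. 0) n x)) = 1"
proof -
  let ?k = "real (n + 1) * pi"
  have k: "?k > 0" by simp
  have L: "L2 (\<lambda>x. of_real (sqrt 2) * rpsi (\<lambda>_. 0) n x)"
    by (intro L2_cmult H10_L2 rpsi_H10[OF quantized_0])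
  have "integral\<^sup>L unitI (\<lambda>x. (cmod (of_real (sqrt 2) * rpsi (\<lambda>_. 0) n x))\<^sup>2) = integral\<^sup>L unitI (\<lambda>x. 1 - cos (2 * ?k * x))"
  proof (intro Bochner_Integration.integral_cong refl)
    fix x assume "x \<in> space unitI"
    then have "x \<in> {0..1}" by simp
    have "1 - cos (2 * ?k * x) = 2 * (sin (?k * x))\<^sup>2" using cos_double_sin[of "?k * x"] by (simp add: mult.assoc)
    then show "(cmod (of_real (sqrt 2) * rpsi (\<lambda>_. 0) n x))\<^sup>2 = 1 - cos (2 * ?k * x)"
      using rpsi_0[OF \<open>x \<in> {0..1}\<close>, of n] by (simp add: norm_mult power_mult_distrib del: of_nat_add of_nat_Suc)
  qed
  also have "\<dots> = integral {0..1} (\<lambda>x. 1 - cos (2 * ?k * x))"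
    by (intro lebesgue_integral_eq_integral continuous_imp_integrable_real continuous_intros) auto
  also have "((\<lambda>x. 1 - cos (2 * ?k * x)) has_integral (1 - sin (2 * ?k * 1) / (2 * ?k)) - (0 - sin (2 * ?k * 0) / (2 * ?k))) {0..1}"
    using k by (intro fundamental_theorem_of_calculus) (auto intro!: derivative_eq_intros simp: has_real_derivative_iff_has_vector_derivative[symmetric])
  then have "integral {0..1} (\<lambda>x. 1 - cos (2 * ?k * x)) = 1 - sin (2 * ?k) / (2 * ?k)" by (simp add: integral_unique)
  also have "sin (2 * ?k) = 0" using sin_npi[of "2 * (n + 1)"] by (simp add: algebra_simps)
  finally show ?thesis using L by (simp add: norm_cls l2norm_def)
qed

text \<open>The Dirichlet sine basis as the case of coupling zero. It is the reference for the
  perturbation argument and the basis in which \<open>H_even\<close> is given.\<close>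

interpretation fourier: eigensys 0 "\<lambda>n x. of_real (sqrt 2) * rpsi (\<lambda>_. 0) n x" "\<lambda>n. (kap (\<lambda>_. 0) n)\<^sup>2"
proof
  fix n i j :: nat and \<Phi> u
  note H = rpsi_H10[OF quantized_0]
  show "H10 (\<lambda>x. of_real (sqrt 2) * rpsi (\<lambda>_. 0) n x)" by (rule H10_cmult[OF H])
  show "0 < (kap (\<lambda>_. 0) n)\<^sup>2" using kap_bounds(4)[OF quantized_0, of n] by simp
  show "i = j" if "(kap (\<lambda>_. 0) i)\<^sup>2 = (kap (\<lambda>_. 0) j)\<^sup>2" using kap_sq_inj[OF quantized_0 _ that] by simp
  show "norm (cls (\<lambda>x. of_real (sqrt 2) * rpsi (\<lambda>_. 0) n x)) = 1" by (rule norm_rpsi_0)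
  show "aform 0 \<Phi> (\<lambda>x. of_real (sqrt 2) * rpsi (\<lambda>_. 0) n x) = of_real ((kap (\<lambda>_. 0) n)\<^sup>2) * cinn (cls \<Phi>) (cls (\<lambda>x. of_real (sqrt 2) * rpsi (\<lambda>_. 0) n x))"
    if "H10 \<Phi>"
    using rpsi_eig[OF quantized_0 that, of n] by (simp add: aform_def H10_cmult[OF H] cinn_csc_right)
  show "u = 0" if 0: "\<And>n. cinn (cls (\<lambda>x. of_real (sqrt 2) * rpsi (\<lambda>_. 0) n x)) u = 0"
  proof -
    have "AE x in unitI. rep_ltwo u x = 0"
    proof (rule sin_orthogonal_imp_AE_zero)
      fix k :: nat assume "k > 0"
      then obtain m where m: "k = m + 1" by (metis Suc_eq_plus1 gr0_implies_Suc)
      have "cinn (cls (rpsi (\<lambda>_. 0) m)) u = 0" using 0[of m] by (simp add: H10_cmult[OF H] cinn_csc_left)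
      moreover have "cinn (cls (rpsi (\<lambda>_. 0) m)) (cls (rep_ltwo u)) = l2inner (rpsi (\<lambda>_. 0) m) (rep_ltwo u)"
        by (intro cinn_cls H10_L2[OF H] L2_rep)
      ultimately have "l2inner (rpsi (\<lambda>_. 0) m) (rep_ltwo u) = 0" by simp
      moreover have "l2inner (rpsi (\<lambda>_. 0) m) (rep_ltwo u) = integral\<^sup>L unitI (\<lambda>x. rep_ltwo u x * complex_of_real (sin (real k * pi * x)))"
        unfolding l2inner_def
      proof (intro Bochner_Integration.integral_cong refl)
        fix x assume "x \<in> space unitI"
        then show "cnj (rpsi (\<lambda>_. 0) m x) * rep_ltwo u x = rep_ltwo u x * complex_of_real (sin (real k * pi * x))"
          using rpsi_0[of x m] by (simp add: m mult.commute del: of_nat_add)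
      qed
      ultimately show "integral\<^sup>L unitI (\<lambda>x. rep_ltwo u x * complex_of_real (sin (real k * pi * x))) = 0" by simp
    qed simp
    then have "cls (rep_ltwo u) = cls (\<lambda>_. 0)" by (subst cls_eq_iff) (auto simp: L2_zero)
    then show ?thesis by (simp flip: cls_zero)
  qed
qed simp

text \<open>The sine is 1-Lipschitz and the momentum is multiplied by a number in
  \<open>[0, 1]\<close>, so the functions differ by at most \<open>\<delta> n\<close>
  everywhere.\<close>

lemma rpsi_close:
  assumes "quantized \<mu> \<delta>"
  shows "norm (fourier.e n - csc (of_real (sqrt 2)) (cls (rpsi \<delta> n))) \<le> sqrt 2 * \<delta> n"
proof -
  note H = rpsi_H10[OF quantized_0] and H' = rpsi_H10[OF assms]
  have d0: "\<delta> n \<ge> 0" using assms by (simp add: quantized_def)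
  have "fourier.e n - csc (of_real (sqrt 2)) (cls (rpsi \<delta> n)) = csc (of_real (sqrt 2)) (cls (rpsi (\<lambda>_. 0) n) - cls (rpsi \<delta> n))"
    by (simp add: fourier.e_def H10_cmult[OF H] csc_diff_right)
  also have "norm \<dots> = sqrt 2 * l2norm (\<lambda>x. rpsi (\<lambda>_. 0) n x - rpsi \<delta> n x)"
    using H10_L2[OF H] H10_L2[OF H'] by (simp add: norm_csc norm_cls[symmetric] cls_diff L2_diff)
  also have "l2norm (\<lambda>x. rpsi (\<lambda>_. 0) n x - rpsi \<delta> n x) \<le> \<delta> n"
  proof (rule L2_bounded(2))
    show "(\<lambda>x. rpsi (\<lambda>_. 0) n x - rpsi \<delta> n x) \<in> borel_measurable unitI"
      using L2_diff[OF H10_L2[OF H] H10_L2[OF H'], of n n] by (simp add: L2_def)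
    fix x :: real assume x: "x \<in> {0..1}"
    have s: "\<bar>sin a - sin b\<bar> \<le> \<bar>a - b\<bar>" for a b :: real
    proof -
      have "\<bar>sin a - sin b\<bar> = 2 * \<bar>sin ((a - b) / 2)\<bar> * \<bar>cos ((a + b) / 2)\<bar>"
        unfolding sin_diff_sin by (simp add: abs_mult)
      also have "\<dots> \<le> 2 * \<bar>(a - b) / 2\<bar> * 1"
        by (intro mult_mono abs_sin_x_le_abs_x) auto
      finally show ?thesis by simp
    qed
    have y: "\<bar>sin (kap (\<lambda>_. 0) n * y) - sin (kap \<delta> n * y)\<bar> \<le> \<delta> n" if "0 \<le> y" "y \<le> 1" for y
    proof -
      have "\<bar>sin (kap (\<lambda>_. 0) n * y) - sin (kap \<delta> n * y)\<bar> \<le> \<bar>kap (\<lambda>_. 0) n * y - kap \<delta> n * y\<bar>" by (rule s)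
      also have "\<dots> = \<delta> n * y" using d0 that by (simp add: kap_def abs_mult flip: left_diff_distrib)
      also have "\<dots> \<le> \<delta> n * 1" using d0 that by (intro mult_left_mono) auto
      finally show ?thesis by simp
    qed
    have eq: "rpsi (\<lambda>_. 0) n x - rpsi \<delta> n x = (if x \<le> 1/2 then of_real (sin (kap (\<lambda>_. 0) n * x) - sin (kap \<delta> n * x))
       else (-1)^n * of_real (sin (kap (\<lambda>_. 0) n * (1 - x)) - sin (kap \<delta> n * (1 - x))))"
      by (simp add: rpsi_def psi_def algebra_simps)
    show "cmod (rpsi (\<lambda>_. 0) n x - rpsi \<delta> n x) \<le> \<delta> n"
    proof (cases "x \<le> 1/2")
      case True
      then show ?thesis unfolding eq using y[of x] x by (simp del: of_real_diff)
    next
      case False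
      then show ?thesis unfolding eq using y[of "1 - x"] x by (simp add: norm_mult norm_power del: of_real_diff)
    qed
  qed
  finally show ?thesis by simp
qed

text \<open>Were \<open>u\<close> orthogonal to all perturbed functions, its Fourier coefficients
  would be inner products with the perturbations, of size at most
  \<open>sqrt 2 * \<delta> n * norm u\<close>. By Parseval and the sum \<open>pi^2 / 6\<close> of
  the inverse squares, \<open>(norm u)^2\<close> would be at most a third of itself.\<close>

lemma rpsi_complete:
  assumes q: "quantized \<mu> \<delta>" and mu: "0 \<le> \<mu>" "\<mu> \<le> 1" and orth: "\<And>n. cinn (cls (rpsi \<delta> n)) u = 0"
  shows "u = 0"
proof (rule ccontr)
  assume "u \<noteq> 0"
  then have u: "(norm u)\<^sup>2 > 0" by simp
  have b: "(cmod (cinn (fourier.e n) u))\<^sup>2 \<le> (2 * \<mu>\<^sup>2 / pi\<^sup>2 * (norm u)\<^sup>2) * (1 / (n + 1)\<^sup>2)" for n :: nat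
  proof -
    have "cinn (fourier.e n) u = cinn (fourier.e n - csc (of_real (sqrt 2)) (cls (rpsi \<delta> n))) u"
      by (simp add: cinn_diff_left cinn_csc_left orth)
    then have "cmod (cinn (fourier.e n) u) \<le> norm (fourier.e n - csc (of_real (sqrt 2)) (cls (rpsi \<delta> n))) * norm u"
      using cinn_Cauchy_Schwarz by metis
    also have "\<dots> \<le> (sqrt 2 * \<delta> n) * norm u" by (intro mult_right_mono rpsi_close[OF q]) simp
    also have "\<dots> \<le> (sqrt 2 * (\<mu> / (real (n + 1) * pi))) * norm u"
      using kap_bounds(3)[OF q mu(2), of n] by (intro mult_right_mono mult_left_mono) auto
    finally have "(cmod (cinn (fourier.e n) u))\<^sup>2 \<le> ((sqrt 2 * (\<mu> / (real (n + 1) * pi))) * norm u)\<^sup>2"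
      by (intro power_mono) auto
    also have "\<dots> = (2 * \<mu>\<^sup>2 / pi\<^sup>2 * (norm u)\<^sup>2) * (1 / (n + 1)\<^sup>2)"
      by (simp add: power_mult_distrib power_divide del: of_nat_add)
    finally show ?thesis .
  qed
  have "(norm u)\<^sup>2 \<le> (2 * \<mu>\<^sup>2 / pi\<^sup>2 * (norm u)\<^sup>2) * (pi\<^sup>2 / 6)"
    by (rule sums_le[OF b onb_parseval[OF fourier.onb_e] sums_mult[OF inverse_squares_sums]])
  also have "\<dots> = (\<mu>\<^sup>2 / 3) * (norm u)\<^sup>2" by simp
  also have "\<dots> \<le> (1/3) * (norm u)\<^sup>2"
    using mu by (intro mult_right_mono divide_right_mono) (auto simp: power_le_one)
  finally show False using u by simp
qed

definition eigf :: "(nat \<Rightarrow> real) \<Rightarrow> nat \<Rightarrow> real \<Rightarrow> complex" where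
  "eigf \<delta> n x = of_real (1 / norm (cls (rpsi \<delta> n))) * rpsi \<delta> n x"

text \<open>A unit vector lies within \<open>sqrt 2 / 3\<close> of a multiple of this
  function.\<close>

lemma rpsi_nonzero:
  assumes q: "quantized \<mu> \<delta>" and mu: "0 \<le> \<mu>" "\<mu> \<le> 1"
  shows "cls (rpsi \<delta> n) \<noteq> 0"
proof
  assume "cls (rpsi \<delta> n) = 0"
  then have "1 \<le> sqrt 2 * \<delta> n"
    using rpsi_close[OF q, of n] orthonormal_norm[OF fourier.orth] by simp
  also have "\<dots> \<le> 2 * (1/3)" using kap_bounds(1,2)[OF q mu(2), of n] sqrt2_less_2 by (intro mult_mono) auto
  finally show False by simp
qed

lemma eigensys_eigf:
  assumes q: "quantized \<mu> \<delta>" and mu: "0 \<le> \<mu>" "\<mu> \<le> 1"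
  shows "eigensys \<mu> (eigf \<delta>) (\<lambda>n. (kap \<delta> n)\<^sup>2)"
proof
  fix n i j :: nat and \<Phi> u
  note H = rpsi_H10[OF q] and nz = rpsi_nonzero[OF assms]
  have c: "H10 (eigf \<delta> n)" "dcl (eigf \<delta> n) = csc (of_real (1 / norm (cls (rpsi \<delta> n)))) (dcl (rpsi \<delta> n))"
    "cls (eigf \<delta> n) = csc (of_real (1 / norm (cls (rpsi \<delta> n)))) (cls (rpsi \<delta> n))" for n
    unfolding eigf_def[abs_def] by (intro H10_cmult H)+
  show "0 \<le> \<mu>" by fact
  show "H10 (eigf \<delta> n)" by (rule c)
  show "0 < (kap \<delta> n)\<^sup>2" using kap_bounds(4)[OF q mu(2), of n] by simp
  show "i = j" if "(kap \<delta> i)\<^sup>2 = (kap \<delta> j)\<^sup>2" using kap_sq_inj[OF q mu(2) that] .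
  show "norm (cls (eigf \<delta> n)) = 1" using nz[of n] unfolding c(3) norm_csc by (simp add: norm_divide)
  show "aform \<mu> \<Phi> (eigf \<delta> n) = of_real ((kap \<delta> n)\<^sup>2) * cinn (cls \<Phi>) (cls (eigf \<delta> n))" if "H10 \<Phi>"
    using arg_cong[OF rpsi_eig[OF q that, of n], of "\<lambda>z. of_real (1 / norm (cls (rpsi \<delta> n))) * z"]
    unfolding aform_def c cinn_csc_right eigf_def by (simp add: algebra_simps)
  show "u = 0" if "\<And>n. cinn (cls (eigf \<delta> n)) u = 0"
  proof (rule rpsi_complete[OF q mu])
    fix n show "cinn (cls (rpsi \<delta> n)) u = 0"
      using that[of n] nz[of n] unfolding c(3) cinn_csc_left by simp
  qed
qed

subsection \<open>Rational independence of the eigenvalues\<close>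

text \<open>With \<open>a = k * pi\<close> the quantization condition for the shift reads
  \<open>shiftP a \<delta> = \<mu>\<close>. The complex extension makes the shift a holomorphic
  function of the coupling.\<close>

definition shiftP :: "real \<Rightarrow> complex \<Rightarrow> complex" where
  "shiftP a z = 2 * (of_real a + z) * tan (z / 2)"

definition dshiftP :: "real \<Rightarrow> complex \<Rightarrow> complex" where
  "dshiftP a z = 2 * tan (z / 2) + (of_real a + z) * (1 + (tan (z / 2))\<^sup>2)"

text \<open>With \<open>w = z / 2\<close> the Taylor remainders carry the factor
  \<open>exp \<bar>Im w\<bar> \<le> 4/3\<close>. So \<open>cmod (sin w) \<le> (4/3) * cmod w\<close>
  and \<open>cmod (cos w) \<ge> 2/3\<close>, with quotient at most
  \<open>2 * cmod w\<close>.\<close>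

lemma cos_tan_small:
  fixes z :: complex assumes "cmod z \<le> 1/2"
  shows "cos (z / 2) \<noteq> 0" "cmod (tan (z / 2)) \<le> cmod z"
proof -
  let ?w = "z / 2"
  have w: "cmod ?w \<le> 1/4" using assms by (simp add: norm_divide)
  have "exp \<bar>Im ?w\<bar> \<le> exp (1/4::real)" using abs_Im_le_cmod[of ?w] w by simp
  also have "\<dots> \<le> 1 + 1/4 + (1/4)\<^sup>2" by (rule exp_bound) auto
  also have "\<dots> \<le> (4/3::real)" by (simp add: power2_eq_square)
  finally have ex: "exp \<bar>Im ?w\<bar> \<le> 4/3" .
  have s: "cmod (sin ?w) \<le> (4/3) * cmod ?w"
  proof -
    have "cmod (sin ?w) \<le> exp \<bar>Im ?w\<bar> * cmod ?w" using Taylor_sin[of ?w 0] by simp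
    also have "\<dots> \<le> (4/3) * cmod ?w" by (intro mult_right_mono ex) auto
    finally show ?thesis .
  qed
  have "cmod (cos ?w - 1) \<le> exp \<bar>Im ?w\<bar> * cmod ?w" using Taylor_cos[of ?w 0] by simp
  also have "\<dots> \<le> (4/3) * (1/4)" by (intro mult_mono ex w) auto
  finally have "cmod (cos ?w - 1) \<le> 1/3" by simp
  moreover have "1 = cmod (cos ?w - (cos ?w - 1))" by simp
  then have "1 \<le> cmod (cos ?w) + cmod (cos ?w - 1)" by (metis norm_triangle_ineq4)
  ultimately have c: "cmod (cos ?w) \<ge> 2/3" by linarith
  show c0: "cos (z / 2) \<noteq> 0" using c by auto
  have "cmod (tan ?w) = cmod (sin ?w) / cmod (cos ?w)" by (simp add: tan_def norm_divide)
  also have "\<dots> \<le> ((4/3) * cmod ?w) / (2/3)" using s c by (intro frac_le) auto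
  also have "\<dots> = cmod z" by (simp add: norm_divide)
  finally show "cmod (tan (z / 2)) \<le> cmod z" .
qed

lemma shiftP_deriv:
  assumes "cmod z \<le> 1/2" shows "(shiftP a has_field_derivative dshiftP a z) (at z)"
proof -
  have c: "cos (z / 2) \<noteq> 0" by (rule cos_tan_small[OF assms])
  have half: "((\<lambda>z::complex. z / 2) has_field_derivative 1/2) (at z)" by (auto intro!: derivative_eq_intros)
  have "((\<lambda>z. tan (z / 2)) has_field_derivative inverse ((cos (z / 2))\<^sup>2) * (1/2)) (at z)"
    by (rule DERIV_chain2[where g="\<lambda>z. z / 2", OF DERIV_tan[OF c] half])
  then have t: "((\<lambda>z. tan (z / 2)) has_field_derivative (1 + (tan (z / 2))\<^sup>2) * (1/2)) (at z)"
    using tan_sec[OF c] by (simp only: power_inverse)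
  show ?thesis unfolding shiftP_def[abs_def] dshiftP_def
    by (rule derivative_eq_intros t refl)+ (simp add: algebra_simps)
qed

text \<open>On this disc the derivative differs from \<open>a\<close> by at most
  \<open>1/2 + 1/4 + (a + 1/4) / 16\<close>, which is below \<open>a / 2\<close> for
  \<open>a \<ge> 3\<close>. The radius is the same for every \<open>a\<close>.\<close>

lemma shiftP_bilipschitz:
  assumes a: "a \<ge> 3" and x: "x \<in> cball 0 (1/4)" and y: "y \<in> cball 0 (1/4)"
  shows "cmod (shiftP a x - shiftP a y - of_real a * (x - y)) \<le> (a / 2) * cmod (x - y)"
proof -
  have "cmod ((shiftP a x - of_real a * x) - (shiftP a y - of_real a * y)) \<le> (a / 2) * cmod (x - y)"
  proof (rule field_differentiable_bound[OF convex_cball _ _ x y])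
    fix z :: complex assume z: "z \<in> cball 0 (1/4)"
    then have z2: "cmod z \<le> 1/2" and z4: "cmod z \<le> 1/4" by auto
    show "((\<lambda>z. shiftP a z - of_real a * z) has_field_derivative dshiftP a z - of_real a) (at z within cball 0 (1/4))"
      by (rule derivative_eq_intros has_field_derivative_at_within[OF shiftP_deriv[OF z2]] refl | simp)+
    let ?t = "tan (z / 2)"
    have t: "cmod ?t \<le> 1/4" using cos_tan_small(2)[OF z2] z4 by linarith
    have t2: "cmod (?t\<^sup>2) \<le> 1/16" using power_mono[OF t, of 2] by (simp add: norm_power power_divide)
    have "dshiftP a z - of_real a = 2 * ?t + z + (of_real a + z) * ?t\<^sup>2"
      by (simp add: dshiftP_def algebra_simps)
    also have "cmod \<dots> \<le> cmod (2 * ?t) + cmod z + cmod ((of_real a + z) * ?t\<^sup>2)"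
      by (rule order_trans[OF norm_triangle_ineq add_right_mono[OF norm_triangle_ineq]])
    finally have "cmod (dshiftP a z - of_real a) \<le> cmod (2 * ?t) + cmod z + cmod ((of_real a + z) * ?t\<^sup>2)" .
    moreover have "cmod ((of_real a + z) * ?t\<^sup>2) \<le> (a + 1/4) * (1/16)"
      unfolding norm_mult using z4 a t2 by (intro mult_mono order_trans[OF norm_triangle_ineq]) auto
    moreover have "cmod (2 * ?t) \<le> 1/2" using t by (simp add: norm_mult)
    moreover have "(a + 1/4) * (1/16) = a / 16 + 1/64" by (simp add: algebra_simps)
    ultimately show "cmod (dshiftP a z - of_real a) \<le> a / 2" using z4 a by simp
  qed
  then show ?thesis by (simp add: algebra_simps)
qed

lemma shiftP_lower:
  assumes a: "a \<ge> 3" and x: "x \<in> cball 0 (1/4)" and y: "y \<in> cball 0 (1/4)"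
  shows "(a / 2) * cmod (x - y) \<le> cmod (shiftP a x - shiftP a y)"
proof -
  have "cmod (of_real a * (x - y)) \<le> cmod (shiftP a x - shiftP a y) + cmod (shiftP a x - shiftP a y - of_real a * (x - y))"
    using norm_triangle_ineq4[of "shiftP a x - shiftP a y" "shiftP a x - shiftP a y - of_real a * (x - y)"] by simp
  then show ?thesis using shiftP_bilipschitz[OF assms] a by (simp add: norm_mult)
qed

text \<open>The lower bound moves the boundary circle to distance at least
  \<open>(3/2) * (1/4) = 3/8\<close> from 0, so the image of the disc covers this ball. One ball for
  every \<open>a\<close> lets all eigenvalues be continued to the same couplings.\<close>

lemma shiftP_inverse:
  assumes a: "a \<ge> 3"
  obtains g where "g holomorphic_on ball 0 (3/8)" "\<And>w. w \<in> ball 0 (3/8) \<Longrightarrow> cmod (g w) < 1/4 \<and> shiftP a (g w) = w"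
proof -
  let ?S = "ball (0::complex) (1/4)"
  have hol: "shiftP a holomorphic_on ball 0 (1/2)"
    unfolding holomorphic_on_open[OF open_ball]
  proof (intro ballI exI)
    fix z :: complex assume "z \<in> ball 0 (1/2)"
    then show "(shiftP a has_field_derivative dshiftP a z) (at z)" by (intro shiftP_deriv) simp
  qed
  have inj: "inj_on (shiftP a) (cball 0 (1/4))"
  proof (rule inj_onI)
    fix x y assume xy: "x \<in> cball 0 (1/4)" "y \<in> cball 0 (1/4)" "shiftP a x = shiftP a y"
    have "(a / 2) * cmod (x - y) \<le> 0" using shiftP_lower[OF a xy(1,2)] unfolding xy(3) by simp
    then have "cmod (x - y) \<le> 0" using a by (simp add: mult_le_0_iff)
    then show "x = y" by simp
  qed
  have inj': "inj_on (shiftP a) ?S" by (rule inj_on_subset[OF inj]) auto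
  have hol': "shiftP a holomorphic_on ?S" by (rule holomorphic_on_subset[OF hol]) auto
  obtain g where g: "g holomorphic_on (shiftP a ` ?S)"
      "\<And>z. z \<in> ?S \<Longrightarrow> deriv (shiftP a) z * deriv g (shiftP a z) = 1"
      "\<And>z. z \<in> ?S \<Longrightarrow> g (shiftP a z) = z"
    by (rule holomorphic_has_inverse[OF hol' open_ball inj']; rule that)
  have P0: "shiftP a 0 = 0" by (simp add: shiftP_def)
  have "ball (shiftP a 0) (3/8) \<subseteq> shiftP a ` ?S"
  proof (rule ball_subset_open_map_image)
    show "continuous_on (closure ?S) (shiftP a)"
      by (rule continuous_on_subset[OF holomorphic_on_imp_continuous_on[OF hol]]) auto
    show "open (shiftP a ` interior ?S)"
      using open_mapping_thm3[OF hol' open_ball inj'] by (simp add: interior_open)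
    show "3/8 \<le> cmod (shiftP a z - shiftP a 0)" if "z \<in> frontier ?S" for z
    proof -
      have z: "cmod z = 1/4" using that by (simp add: frontier_ball)
      have "(3/2) * (1/4) \<le> (a / 2) * (1/4)" using a by simp
      also have "\<dots> \<le> cmod (shiftP a z - shiftP a 0)" using shiftP_lower[OF a, of z 0] z by simp
      finally show ?thesis by simp
    qed
  qed auto
  then have sub: "ball 0 (3/8) \<subseteq> shiftP a ` ?S" by (simp add: P0)
  show ?thesis
  proof
    show "g holomorphic_on ball 0 (3/8)" by (rule holomorphic_on_subset[OF g(1) sub])
    fix w :: complex assume "w \<in> ball 0 (3/8)"
    then obtain z where z: "z \<in> ?S" "w = shiftP a z" using sub by blast
    then show "cmod (g w) < 1/4 \<and> shiftP a (g w) = w" using g(3)[OF z(1)] by simp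
  qed
qed

text \<open>\<open>shiftP\<close> commutes with conjugation and is injective on the disc, so the
  solution is real. Its sign is that of the tangent, and the upper bound comes from
  \<open>x \<le> tan x\<close>.\<close>

lemma shiftP_inverse_real:
  assumes a: "a \<ge> 3" and \<mu>: "0 < \<mu>" and z: "cmod z < 1/4" "shiftP a z = of_real \<mu>"
  shows "z = of_real (Re z)" "0 < Re z" "Re z \<le> \<mu> / a" "2 * (a + Re z) * tan (Re z / 2) = \<mu>"
proof -
  have "cnj z = z"
  proof -
    have "shiftP a (cnj z) = cnj (shiftP a z)" by (simp add: shiftP_def tan_def cnj_sin cnj_cos)
    then have "shiftP a (cnj z) = shiftP a z" by (simp add: z)
    then have "(a / 2) * cmod (cnj z - z) \<le> 0" using shiftP_lower[OF a, of "cnj z" z] z(1) by simp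
    then show ?thesis using a by (simp add: mult_le_0_iff)
  qed
  then show re: "z = of_real (Re z)" by (simp add: complex_eq_iff)
  let ?d = "Re z"
  have d: "\<bar>?d\<bar> < 1/4" using z(1) abs_Re_le_cmod[of z] by linarith
  have "of_real (2 * (a + ?d) * tan (?d / 2)) = shiftP a (of_real ?d)"
    by (simp add: shiftP_def tan_of_real)
  also have "\<dots> = of_real \<mu>" using re z(2) by simp
  finally show e: "2 * (a + ?d) * tan (?d / 2) = \<mu>" by (simp only: of_real_eq_iff)
  have "tan (?d / 2) > 0"
  proof (rule ccontr)
    assume "\<not> tan (?d / 2) > 0"
    then have "2 * (a + ?d) * tan (?d / 2) \<le> 0" using a d by (intro mult_nonneg_nonpos) auto
    then show False using e \<mu> by linarith
  qed
  have pi: "?d / 2 < pi / 2" "- (pi / 2) < ?d / 2" using d pi_gt3 by auto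
  show d0: "0 < ?d"
  proof (rule ccontr)
    assume "\<not> 0 < ?d"
    then have "tan (?d / 2) \<le> tan 0" using pi by (intro tan_mono_le) auto
    then show False using \<open>tan (?d / 2) > 0\<close> by simp
  qed
  have "?d / 2 \<le> tan (?d / 2)" using abs_tan_ge[of "?d / 2"] d0 pi \<open>tan (?d / 2) > 0\<close> by simp
  then have "2 * a * (?d / 2) \<le> 2 * (a + ?d) * tan (?d / 2)" using a d0 by (intro mult_mono) auto
  then have "a * ?d \<le> \<mu>" using e by simp
  then show "?d \<le> \<mu> / a" using a by (simp add: field_simps)
qed

text \<open>Put \<open>k = a + g w\<close> and let \<open>T\<close> be the tangent. Differentiating
  \<open>shiftP a (g w) = w\<close> and eliminating \<open>T\<close> by \<open>w = 2 * k * T\<close>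
  gives \<open>4 * k * dshiftP a (g w) = 4 * k^2 + 4 * w + w^2\<close>. In terms of
  \<open>k^2\<close> the equation no longer contains \<open>a\<close>.\<close>

lemma shiftP_ode:
  assumes a: "a \<ge> 3" and g: "g holomorphic_on ball 0 (3/8)"
    and inv: "\<And>w. w \<in> ball 0 (3/8) \<Longrightarrow> cmod (g w) < 1/4 \<and> shiftP a (g w) = w"
    and w: "w \<in> ball 0 (3/8)"
  shows "deriv (\<lambda>w. (of_real a + g w)\<^sup>2) w * (4 * (of_real a + g w)\<^sup>2 + 4 * w + w\<^sup>2) = 8 * (of_real a + g w)\<^sup>2"
proof -
  let ?k = "of_real a + g w" and ?T = "tan (g w / 2)"
  have gd: "(g has_field_derivative deriv g w) (at w)"
    by (rule holomorphic_derivI[OF g open_ball w])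
  have gb: "cmod (g w) \<le> 1/2" using inv[OF w] by simp
  have "((\<lambda>w. shiftP a (g w)) has_field_derivative dshiftP a (g w) * deriv g w) (at w)"
    by (rule DERIV_chain2[OF shiftP_deriv[OF gb] gd])
  moreover have "((\<lambda>w. shiftP a (g w)) has_field_derivative 1) (at w)"
    by (rule has_field_derivative_transform_within_open[OF DERIV_ident open_ball w]) (use inv in auto)
  ultimately have one: "dshiftP a (g w) * deriv g w = 1" by (rule DERIV_unique)
  have "((\<lambda>w. (of_real a + g w)\<^sup>2) has_field_derivative 2 * ?k * deriv g w) (at w)"
    by (rule derivative_eq_intros gd refl | simp)+
  then have d: "deriv (\<lambda>w. (of_real a + g w)\<^sup>2) w = 2 * ?k * deriv g w" by (rule DERIV_imp_deriv)
  have weq: "w = 2 * ?k * ?T" using inv[OF w] by (simp add: shiftP_def)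
  have "4 * ?k\<^sup>2 + 4 * w + w\<^sup>2 = 4 * ?k * dshiftP a (g w)"
    by (subst (1 2) weq) (simp add: dshiftP_def power2_eq_square algebra_simps)
  then have "deriv (\<lambda>w. (of_real a + g w)\<^sup>2) w * (4 * ?k\<^sup>2 + 4 * w + w\<^sup>2) = 8 * ?k\<^sup>2 * (dshiftP a (g w) * deriv g w)"
    unfolding d by (simp add: power2_eq_square algebra_simps)
  then show ?thesis by (simp add: one)
qed

text \<open>The Taylor coefficients of a solution of \<open>\<lambda>' (4 \<lambda> + 4 w + w\<^sup>2) = 8 \<lambda>\<close> with \<open>\<lambda>(0) = a\<close>.
  At \<open>n = 0\<close> the truncated \<open>n - 1\<close> makes the last summand vanish.\<close>

definition eig_rec :: "real \<Rightarrow> (nat \<Rightarrow> complex) \<Rightarrow> bool" where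
  "eig_rec a L \<longleftrightarrow> a > 0 \<and> L 0 = of_real a \<and>
     (\<forall>n. 4 * (\<Sum>i\<le>n. of_nat (i + 1) * L (i + 1) * L (n - i)) + 4 * of_nat n * L n + of_nat (n - 1) * L (n - 1) = 8 * L n)"

section \<open>Taylor coefficients and linear independence of the eigenvalues\<close>

lemma eig_rec_step:
  assumes "eig_rec a L"
  shows "L (Suc n) = of_real (1 / a / (4 * real (n + 1))) *
    ((8 - 4 * of_nat n) * L n - of_nat (n - 1) * L (n - 1) - 4 * (\<Sum>i<n. of_nat (i + 1) * L (i + 1) * L (n - i)))"
proof -
  have a: "a > 0" and L0: "L 0 = of_real a"
    and r: "4 * (\<Sum>i\<le>n. of_nat (i + 1) * L (i + 1) * L (n - i)) + 4 * of_nat n * L n + of_nat (n - 1) * L (n - 1) = 8 * L n"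
    using assms by (auto simp: eig_rec_def)
  have "(\<Sum>i\<le>n. of_nat (i + 1) * L (i + 1) * L (n - i)) = (\<Sum>i<n. of_nat (i + 1) * L (i + 1) * L (n - i)) + of_nat (n + 1) * L (Suc n) * of_real a"
    by (simp add: lessThan_Suc_atMost[symmetric] L0)
  with r have "4 * of_nat (n + 1) * of_real a * L (Suc n) =
     (8 - 4 * of_nat n) * L n - of_nat (n - 1) * L (n - 1) - 4 * (\<Sum>i<n. of_nat (i + 1) * L (i + 1) * L (n - i))"
    by (simp add: algebra_simps)
  moreover have "of_real (1 / a / (4 * real (n + 1))) * (4 * of_nat (n + 1) * of_real a) = (1::complex)"
  proof -
    have "(1 / a / (4 * K)) * (4 * K * a) = 1" if "K > 0" for K using a that by (simp add: field_simps)
    from this[of "real (n + 1)"] have "(1 / a / (4 * real (n + 1))) * (4 * real (n + 1) * a) = 1" by simp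
    then have "complex_of_real ((1 / a / (4 * real (n + 1))) * (4 * real (n + 1) * a)) = 1" by simp
    then show ?thesis by (simp only: of_real_mult of_real_of_nat_eq of_real_numeral)
  qed
  ultimately show ?thesis by (metis mult.assoc mult_1)
qed

text \<open>Each step of the recursion contributes one factor \<open>1 / a\<close>, so the degree
  grows by at most one. That it does grow rests on signs: leading coefficients alternate, so the
  convolution and the linear term do not cancel. The first polynomial is fixed exactly for the one
  step where their signs disagree.\<close>

lemma eig_rec_poly:
  assumes "n \<ge> 1"
  shows "\<exists>q::real poly. degree q = n - 1 \<and> 0 < (-1) ^ (n - 1) * coeff q (n - 1) \<and> (n = 1 \<longrightarrow> q = [:2:]) \<and>
    (\<forall>a L. eig_rec a L \<longrightarrow> L n = of_real (poly q (1 / a)))"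
  using assms
proof (induction n rule: less_induct)
  case (less m)
  then obtain n where m: "m = Suc n" by (cases m) auto
  show ?case
  proof (cases "n = 0")
    case True
    have "L (Suc 0) = 2" if r: "eig_rec a L" for a L
    proof -
      have "a > 0" "L 0 = of_real a" using r by (auto simp: eig_rec_def)
      then show ?thesis using eig_rec_step[OF r, of 0] by simp
    qed
    then show ?thesis using True m by (intro exI[of _ "[:2:]"]) simp
  next
    case False
    have "\<forall>k\<in>{1..n}. \<exists>q::real poly. degree q = k - 1 \<and> 0 < (-1) ^ (k - 1) * coeff q (k - 1) \<and> (k = 1 \<longrightarrow> q = [:2:]) \<and>
       (\<forall>a L. eig_rec a L \<longrightarrow> L k = of_real (poly q (1 / a)))"
      using less.IH m by simp
    from bchoice[OF this] obtain p :: "nat \<Rightarrow> real poly" where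
      p: "\<forall>k\<in>{1..n}. degree (p k) = k - 1 \<and> 0 < (-1) ^ (k - 1) * coeff (p k) (k - 1) \<and> (k = 1 \<longrightarrow> p k = [:2:]) \<and>
       (\<forall>a L. eig_rec a L \<longrightarrow> L k = of_real (poly (p k) (1 / a)))" by blast
    have deg: "degree (p k) = k - 1" and pos: "0 < (-1) ^ (k - 1) * coeff (p k) (k - 1)"
      and val: "eig_rec a L \<Longrightarrow> L k = of_real (poly (p k) (1 / a))" if "1 \<le> k" "k \<le> n" for k a L
      using p that by auto
    have p1: "p 1 = [:2:]" using p False by auto
    define T where "T i = smult (real (i + 1)) (p (i + 1) * p (n - i))" for i
    \<comment> \<open>The bracket of \<open>eig_rec_step\<close>; in \<open>q\<close> the
      \<open>pCons 0\<close> supplies its factor \<open>1 / a\<close>.\<close>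
    define B where "B = smult (8 - 4 * real n) (p n) - smult (real (n - 1)) (p (n - 1)) - smult 4 (\<Sum>i<n. T i)"
    define q where "q = smult (1 / (4 * real (n + 1))) (pCons 0 B)"
    have degT: "degree (T i) \<le> n - 1" if "i < n" for i
    proof -
      have "degree (T i) \<le> degree (p (i + 1)) + degree (p (n - i))"
        unfolding T_def by (rule order_trans[OF degree_smult_le degree_mult_le])
      also have "\<dots> = n - 1" using that by (simp add: deg)
      finally show ?thesis .
    qed
    have degB: "degree B \<le> n - 1"
      unfolding B_def
    proof (intro degree_diff_le)
      show "degree (smult (8 - 4 * real n) (p n)) \<le> n - 1"
        using False by (intro order_trans[OF degree_smult_le]) (simp add: deg)
      show "degree (smult (real (n - 1)) (p (n - 1))) \<le> n - 1"
        using deg[of "n - 1"] by (cases "n = 1") (auto intro!: order_trans[OF degree_smult_le])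
      show "degree (smult 4 (\<Sum>i<n. T i)) \<le> n - 1"
        by (rule order_trans[OF degree_smult_le], rule degree_sum_le) (use degT in simp_all)
    qed
    have cT: "(-1) ^ n * coeff (T i) (n - 1) < 0" if "i < n" for i
    proof -
      let ?x = "coeff (p (i + 1)) i" and ?y = "coeff (p (n - i)) (n - i - 1)"
      have "coeff (p (i + 1) * p (n - i)) (degree (p (i + 1)) + degree (p (n - i))) = ?x * ?y"
        using that by (subst coeff_mult_degree_sum) (simp add: deg)
      moreover have "degree (p (i + 1)) + degree (p (n - i)) = n - 1" using that by (simp add: deg)
      ultimately have c: "coeff (T i) (n - 1) = real (i + 1) * (?x * ?y)" by (simp add: T_def)
      have "0 < ((-1) ^ i * ?x) * ((-1) ^ (n - i - 1) * ?y)"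
        using pos[of "i + 1"] pos[of "n - i"] that by (intro mult_pos_pos[of "_ * _" "_ * _"]) auto
      also have "\<dots> = (-1) ^ (n - 1) * (?x * ?y)"
        using that by (simp add: power_add[symmetric] mult_ac)
      also have "(-1) ^ (n - 1) = - ((-1) ^ n :: real)" using that by (cases n) auto
      finally have "(-1) ^ n * (?x * ?y) < 0" by simp
      then have "real (i + 1) * ((-1) ^ n * (?x * ?y)) < 0" by (rule mult_pos_neg[rotated]) simp
      then show ?thesis unfolding c by (simp only: mult.left_commute)
    qed
    have sgnB: "0 < (-1) ^ n * coeff B (n - 1)"
    proof (cases "n = 1")
      case True
      \<comment> \<open>Here \<open>8 - 4 * n\<close> is positive and opposes the convolution; the
        explicit value \<open>8 - 16 = -8\<close> still has the required sign.\<close>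
      have "T 0 = [:4:]" using p1 True by (simp add: T_def)
      then have "coeff B 0 = (8 - 4) * 2 - 4 * 4" using p1 True by (simp add: B_def)
      then show ?thesis using True by simp
    next
      case n1: False
      have n2: "n \<ge> 2" using False n1 by simp
      have z: "coeff (p (n - 1)) (n - 1) = 0" using n2 by (intro coeff_eq_0) (simp add: deg)
      have cB: "coeff B (n - 1) = (8 - 4 * real n) * coeff (p n) (n - 1) - 4 * (\<Sum>i<n. coeff (T i) (n - 1))"
        unfolding B_def coeff_diff coeff_smult coeff_sum z by simp
      have "(-1) ^ (n - 1) * coeff (p n) (n - 1) > 0" using pos[of n] n2 by simp
      also have "(-1) ^ (n - 1) = - ((-1) ^ n :: real)" using n2 by (cases n) auto
      finally have "(-1) ^ n * coeff (p n) (n - 1) \<le> 0" by simp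
      then have 1: "0 \<le> (8 - 4 * real n) * ((-1) ^ n * coeff (p n) (n - 1))"
        using n2 by (intro mult_nonpos_nonpos) auto
      have 2: "(\<Sum>i<n. (-1) ^ n * coeff (T i) (n - 1)) < 0"
      proof -
        have "(\<Sum>i<n. (-1) ^ n * coeff (T i) (n - 1)) < (\<Sum>i<n. 0)"
          using n2 cT by (intro sum_strict_mono) (auto simp: lessThan_empty_iff)
        then show ?thesis by simp
      qed
      have "(-1) ^ n * coeff B (n - 1) = (8 - 4 * real n) * ((-1) ^ n * coeff (p n) (n - 1)) - 4 * (\<Sum>i<n. (-1) ^ n * coeff (T i) (n - 1))"
        unfolding cB sum_distrib_left[symmetric] by (simp add: algebra_simps)
      then show ?thesis using 1 2 by linarith
    qed
    have cq: "coeff q n = coeff B (n - 1) / (4 * real (n + 1))"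
      using False by (cases n) (auto simp: q_def)
    have sq: "0 < (-1) ^ n * coeff q n"
      using sgnB unfolding cq by (simp add: divide_pos_pos)
    have dq: "degree q = n"
    proof (rule antisym)
      have "degree q \<le> degree (pCons 0 B)" unfolding q_def by (rule degree_smult_le)
      also have "\<dots> \<le> Suc (degree B)" by (rule degree_pCons_le)
      also have "\<dots> \<le> n" using degB False by simp
      finally show "degree q \<le> n" .
      have "coeff q n \<noteq> 0" using sq by auto
      then show "n \<le> degree q" by (rule le_degree)
    qed
    have vq: "L (Suc n) = of_real (poly q (1 / a))" if r: "eig_rec a L" for a L
    proof -
      have Ln: "L n = of_real (poly (p n) (1 / a))" using val[OF _ _ r] False by simp
      have Ln1: "of_nat (n - 1) * L (n - 1) = of_real (real (n - 1) * poly (p (n - 1)) (1 / a))"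
      proof (cases "n = 1")
        case n1: False
        then have "L (n - 1) = of_real (poly (p (n - 1)) (1 / a))" using False by (intro val[OF _ _ r]) auto
        then show ?thesis by simp
      qed simp
      have Ls: "(\<Sum>i<n. of_nat (i + 1) * L (i + 1) * L (n - i)) = of_real (poly (\<Sum>i<n. T i) (1 / a))"
        unfolding poly_sum of_real_sum
      proof (intro sum.cong refl)
        fix i assume "i \<in> {..<n}"
        then have "L (i + 1) = of_real (poly (p (i + 1)) (1 / a))" "L (n - i) = of_real (poly (p (n - i)) (1 / a))"
          using val[OF _ _ r, of "i + 1"] val[OF _ _ r, of "n - i"] by auto
        then show "of_nat (i + 1) * L (i + 1) * L (n - i) = of_real (poly (T i) (1 / a))"
          by (simp add: T_def)
      qed
      have "L (Suc n) = of_real (1 / a / (4 * real (n + 1))) * of_real (poly B (1 / a))"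
        unfolding eig_rec_step[OF r, of n] Ln1 Ls Ln by (simp add: B_def)
      also have "\<dots> = of_real (1 / a / (4 * real (n + 1)) * poly B (1 / a))" by (simp only: of_real_mult)
      also have "1 / a / (4 * real (n + 1)) * poly B (1 / a) = poly q (1 / a)"
        by (simp add: q_def)
      finally show ?thesis .
    qed
    show ?thesis using dq sq vq False m by (intro exI[of _ q]) simp
  qed
qed

text \<open>The functional that sends \<open>q\<close> to the sum of the
  \<open>c j * poly q (1 / a j)\<close> vanishes on one polynomial of every degree, hence on all
  polynomials. A Lagrange polynomial for the distinct nodes \<open>1 / a i\<close> then isolates
  \<open>c j\<close>.\<close>

lemma eig_rec_independent:
  assumes fin: "finite J" and rec: "\<And>j. j \<in> J \<Longrightarrow> eig_rec (a j) (L j)"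
    and inj: "inj_on a J" and zero: "\<And>n. (\<Sum>j\<in>J. of_real (c j) * L j n) = 0" and j: "j \<in> J"
  shows "c j = 0"
proof -
  obtain p :: "nat \<Rightarrow> real poly" where deg: "\<And>n. n \<ge> 1 \<Longrightarrow> degree (p n) = n - 1"
    and pos: "\<And>n. n \<ge> 1 \<Longrightarrow> 0 < (-1) ^ (n - 1) * coeff (p n) (n - 1)"
    and val: "\<And>n a L. n \<ge> 1 \<Longrightarrow> eig_rec a L \<Longrightarrow> L n = of_real (poly (p n) (1 / a))"
    using eig_rec_poly by metis
  have pz: "(\<Sum>j\<in>J. c j * poly (p n) (1 / a j)) = 0" if "n \<ge> 1" for n
  proof -
    have "complex_of_real (\<Sum>j\<in>J. c j * poly (p n) (1 / a j)) = (\<Sum>j\<in>J. of_real (c j) * L j n)"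
      using val[OF that rec] by simp
    then show ?thesis using zero[of n] by (simp only: of_real_eq_0_iff)
  qed
  have all: "(\<Sum>j\<in>J. c j * poly q (1 / a j)) = 0" if "\<And>i. i \<ge> m \<Longrightarrow> coeff q i = 0" for q m
    using that
  proof (induction m arbitrary: q)
    case 0
    then have "q = 0" by (simp add: poly_eq_iff)
    then show ?case by simp
  next
    case (Suc m)
    let ?P = "p (Suc m)"
    have lc: "coeff ?P m \<noteq> 0" using pos[of "Suc m"] by auto
    define r where "r = q - smult (coeff q m / coeff ?P m) ?P"
    have "coeff r i = 0" if "i \<ge> m" for i
    proof (cases "i = m")
      case True then show ?thesis using lc by (simp add: r_def)
    next
      case False
      then have "coeff q i = 0" "coeff ?P i = 0" using that Suc.prems[of i] deg[of "Suc m"] by (auto intro: coeff_eq_0)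
      then show ?thesis by (simp add: r_def)
    qed
    then have "(\<Sum>j\<in>J. c j * poly r (1 / a j)) = 0" by (rule Suc.IH)
    moreover have "(\<Sum>j\<in>J. c j * poly r (1 / a j)) = (\<Sum>j\<in>J. c j * poly q (1 / a j)) - (coeff q m / coeff ?P m) * (\<Sum>j\<in>J. c j * poly ?P (1 / a j))"
      by (simp add: r_def right_diff_distrib sum_subtractf sum_distrib_left mult_ac)
    ultimately show ?case using pz[of "Suc m"] by simp
  qed
  define q where "q = (\<Prod>i\<in>J - {j}. [:- (1 / a i), 1:])"
  have "(\<Sum>i\<in>J. c i * poly q (1 / a i)) = 0"
    by (rule all[of "Suc (degree q)"]) (auto intro: coeff_eq_0)
  also have "(\<Sum>i\<in>J. c i * poly q (1 / a i)) = c j * poly q (1 / a j) + (\<Sum>i\<in>J - {j}. c i * poly q (1 / a i))"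
    by (rule sum.remove[OF fin j])
  also have "(\<Sum>i\<in>J - {j}. c i * poly q (1 / a i)) = 0"
  proof (rule sum.neutral, rule ballI)
    fix i assume "i \<in> J - {j}"
    then have "poly q (1 / a i) = 0" unfolding q_def poly_prod using fin by (auto simp: prod_zero_iff)
    then show "c i * poly q (1 / a i) = 0" by simp
  qed
  finally have "c j * poly q (1 / a j) = 0" by simp
  moreover have "poly q (1 / a j) \<noteq> 0"
  proof -
    have "poly [:- (1 / a i), 1:] (1 / a j) \<noteq> 0" if i: "i \<in> J - {j}" for i
    proof
      assume "poly [:- (1 / a i), 1:] (1 / a j) = 0"
      then have "1 / a j = 1 / a i" by simp
      moreover have "a i > 0" "a j > 0" using rec i j by (auto simp: eig_rec_def)
      ultimately have "a i = a j" by (simp add: field_simps)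
      then show False using inj i j by (auto dest: inj_onD)
    qed
    then show ?thesis unfolding q_def poly_prod using fin by (subst prod_zero_iff) blast+
  qed
  ultimately show ?thesis by simp
qed

text \<open>The differential equation becomes an identity of power series at 0, and comparing
  coefficients gives the recursion.\<close>

lemma shiftP_inverse_eig_rec:
  assumes a: "a \<ge> 3" and g: "g holomorphic_on ball 0 (3/8)"
    and inv: "\<And>w. w \<in> ball 0 (3/8) \<Longrightarrow> cmod (g w) < 1/4 \<and> shiftP a (g w) = w"
  obtains F where "(\<lambda>w. (of_real a + g w)\<^sup>2) has_fps_expansion F" "eig_rec (a\<^sup>2) (fps_nth F)"
proof -
  define h where "h = (\<lambda>w. (of_real a + g w)\<^sup>2)"
  have "h holomorphic_on ball 0 (3/8)" unfolding h_def by (intro holomorphic_intros g)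
  then have "h analytic_on ball 0 (3/8)" by (simp add: analytic_on_open)
  then have an: "h analytic_on {0}" by (rule analytic_on_subset) auto
  define F where "F = fps_expansion h 0"
  have F: "h has_fps_expansion F"
    unfolding F_def by (rule analytic_at_imp_has_fps_expansion_0[OF an])
  have e1: "(\<lambda>w. deriv h w * (4 * h w + 4 * w + w\<^sup>2)) has_fps_expansion fps_deriv F * (4 * F + 4 * fps_X + fps_X\<^sup>2)"
    by (intro fps_expansion_intros F)
  have e2: "(\<lambda>w. 8 * h w) has_fps_expansion 8 * F" by (intro fps_expansion_intros F)
  have ev: "eventually (\<lambda>w. deriv h w * (4 * h w + 4 * w + w\<^sup>2) = 8 * h w) (nhds 0)"
  proof (rule eventually_mono[OF eventually_nhds_in_open[of "ball 0 (3/8)"]])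
    fix w :: complex assume "w \<in> ball 0 (3/8)"
    then show "deriv h w * (4 * h w + 4 * w + w\<^sup>2) = 8 * h w"
      unfolding h_def using shiftP_ode[OF a g] inv by blast
  qed auto
  have eq: "fps_deriv F * (4 * F + 4 * fps_X + fps_X\<^sup>2) = 8 * F"
    by (rule fps_expansion_unique_complex[OF e1 iffD2[OF has_fps_expansion_cong[OF ev refl] e2]])
  have g0: "g 0 = 0"
  proof -
    have g0: "cmod (g 0) < 1/4" "shiftP a (g 0) = 0" using inv[of 0] by auto
    moreover have "shiftP a 0 = 0" by (simp add: shiftP_def)
    ultimately have "(a / 2) * cmod (g 0 - 0) \<le> 0" using shiftP_lower[OF a, of "g 0" 0] by simp
    then show ?thesis using a by (simp add: mult_le_0_iff)
  qed
  have F0: "fps_nth F 0 = of_real (a\<^sup>2)"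
    using has_fps_expansion_imp_0_eq_fps_nth_0[OF F] g0 by (simp add: h_def)
  have rec: "4 * (\<Sum>i\<le>n. of_nat (i + 1) * fps_nth F (i + 1) * fps_nth F (n - i)) + 4 * of_nat n * fps_nth F n + of_nat (n - 1) * fps_nth F (n - 1) = 8 * fps_nth F n" for n
  proof -
    have "8 * fps_nth F n = fps_nth (fps_deriv F * (4 * F + 4 * fps_X + fps_X\<^sup>2)) n"
      unfolding eq by simp
    also have "fps_deriv F * (4 * F + 4 * fps_X + fps_X\<^sup>2) = 4 * (fps_deriv F * F) + 4 * (fps_X * fps_deriv F) + fps_X * (fps_X * fps_deriv F)"
      by (simp add: algebra_simps power2_eq_square)
    also have "fps_nth \<dots> n = 4 * fps_nth (fps_deriv F * F) n + 4 * fps_nth (fps_X * fps_deriv F) n + fps_nth (fps_X * (fps_X * fps_deriv F)) n"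
      by simp
    also have "fps_nth (fps_deriv F * F) n = (\<Sum>i\<le>n. of_nat (i + 1) * fps_nth F (i + 1) * fps_nth F (n - i))"
      by (simp add: fps_mult_nth atLeast0AtMost)
    also have "fps_nth (fps_X * fps_deriv F) n = of_nat n * fps_nth F n"
      by (cases n) auto
    also have "fps_nth (fps_X * (fps_X * fps_deriv F)) n = of_nat (n - 1) * fps_nth F (n - 1)"
    proof (cases n)
      case (Suc k) then show ?thesis by (cases k) auto
    qed simp
    finally show ?thesis by (simp add: mult.assoc)
  qed
  show ?thesis
    using that[of F] F F0 rec a unfolding h_def eig_rec_def by simp
qed

text \<open>\<open>holomorphic_countable_zeros\<close> asks for an F-sigma domain.\<close>

lemma fsigma_ball: "fsigma (ball (0::complex) r)"
proof -
  have "ball (0::complex) r = (\<Union>n. cball 0 (r - 1 / real (Suc n)))"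
  proof (intro equalityI subsetI)
    fix x :: complex assume "x \<in> ball 0 r"
    then obtain n where "inverse (real (Suc n)) < r - cmod x" using reals_Archimedean[of "r - cmod x"] by auto
    then show "x \<in> (\<Union>n. cball 0 (r - 1 / real (Suc n)))" by (intro UN_I[of n]) (auto simp: inverse_eq_divide)
  next
    fix x :: complex assume "x \<in> (\<Union>n. cball 0 (r - 1 / real (Suc n)))"
    then obtain n where "cmod x \<le> r - 1 / real (Suc n)" by auto
    moreover have "1 / real (Suc n) > 0" by simp
    ultimately have "cmod x < r" by linarith
    then show "x \<in> ball 0 r" by simp
  qed
  then show ?thesis using fsigma.intros[of "\<lambda>n. cball (0::complex) (r - 1 / real (Suc n))"] by simp
qed

text \<open>An integer relation defines a holomorphic function of the coupling on the common ball.
  By independence of the Taylor series it is not identically zero, so it has countably many zeros;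
  and there are countably many relations.\<close>

lemma rational_independence:
  fixes a :: "nat \<Rightarrow> real" and g :: "nat \<Rightarrow> complex \<Rightarrow> complex"
  assumes a: "\<And>j. a j \<ge> 3" and inja: "inj a"
    and g: "\<And>j. g j holomorphic_on ball 0 (3/8)"
    and inv: "\<And>j w. w \<in> ball 0 (3/8) \<Longrightarrow> cmod (g j w) < 1/4 \<and> shiftP (a j) (g j w) = w"
  obtains C where "countable C"
    "\<And>(\<mu>::real) (q::nat \<Rightarrow> int) N j. \<bar>\<mu>\<bar> < 3/8 \<Longrightarrow> \<mu> \<notin> C \<Longrightarrow>
      (\<Sum>j<N. of_int (q j) * (of_real (a j) + g j (of_real \<mu>))\<^sup>2) = 0 \<Longrightarrow> j < N \<Longrightarrow> q j = 0"
proof -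
  \<comment> \<open>Lists encode the finite integer vectors, which makes the union over all
    relations countable.\<close>
  define h where "h qs w = (\<Sum>j<length qs. of_int (qs ! j) * (of_real (a j) + g j w)\<^sup>2)" for qs :: "int list" and w
  define Z where "Z qs = {w \<in> ball 0 (3/8). h qs w = 0}" for qs
  have hol: "h qs holomorphic_on ball 0 (3/8)" for qs
    unfolding h_def[abs_def] by (intro holomorphic_intros g)
  have cnt: "countable (Z qs)" if nz: "\<exists>j<length qs. qs ! j \<noteq> 0" for qs
  proof (cases "Z qs = {}")
    case False
    have "\<not> h qs constant_on ball 0 (3/8)"
    proof
      assume "h qs constant_on ball 0 (3/8)"
      then obtain c where c: "\<And>w. w \<in> ball 0 (3/8) \<Longrightarrow> h qs w = c" by (auto simp: constant_on_def)
      with False have "c = 0" by (auto simp: Z_def)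
      have "\<exists>F. (\<lambda>w. (of_real (a j) + g j w)\<^sup>2) has_fps_expansion F \<and> eig_rec ((a j)\<^sup>2) (fps_nth F)" for j
        using shiftP_inverse_eig_rec[OF a g inv] by blast
      then obtain F where F: "\<And>j. (\<lambda>w. (of_real (a j) + g j w)\<^sup>2) has_fps_expansion F j"
          "\<And>j. eig_rec ((a j)\<^sup>2) (fps_nth (F j))" by metis
      have "h qs has_fps_expansion (\<Sum>j<length qs. fps_const (of_int (qs ! j)) * F j)"
        unfolding h_def[abs_def] by (intro fps_expansion_intros F)
      moreover have "eventually (\<lambda>w. h qs w = 0) (nhds 0)"
        by (rule eventually_mono[OF eventually_nhds_in_open[of "ball 0 (3/8)"]]) (use c \<open>c = 0\<close> in auto)
      then have "h qs has_fps_expansion 0" by (simp add: has_fps_expansion_0_iff)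
      ultimately have S: "(\<Sum>j<length qs. fps_const (of_int (qs ! j)) * F j) = 0"
        by (rule fps_expansion_unique_complex)
      have "real_of_int (qs ! j) = 0" if "j < length qs" for j
      proof (rule eig_rec_independent[where J="{..<length qs}" and a="\<lambda>j. (a j)\<^sup>2" and L="\<lambda>j. fps_nth (F j)" and c="\<lambda>j. real_of_int (qs ! j)"])
        show "inj_on (\<lambda>j. (a j)\<^sup>2) {..<length qs}"
        proof (rule inj_onI)
          fix i k assume "(a i)\<^sup>2 = (a k)\<^sup>2"
          then have "a i = a k" using a[of i] a[of k] by (simp add: power2_eq_iff_nonneg)
          then show "i = k" using inja by (auto dest: injD)
        qed
        fix n
        have "fps_nth (\<Sum>j<length qs. fps_const (of_int (qs ! j)) * F j) n = 0" by (simp add: S)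
        then show "(\<Sum>j<length qs. of_real (real_of_int (qs ! j)) * fps_nth (F j) n) = 0" by (simp add: fps_sum_nth)
      qed (use that F in auto)
      then show False using nz by auto
    qed
    then show ?thesis unfolding Z_def
      by (intro holomorphic_countable_zeros[OF hol]) (auto intro: fsigma_ball)
  qed simp
  define C where "C = (\<Union>qs\<in>{qs. \<exists>j<length qs. qs ! j \<noteq> 0}. Re ` Z qs)"
  have cC: "countable C" unfolding C_def by (intro countable_UN countable_image cnt) auto
  have "q j = 0"
    if "\<bar>\<mu>\<bar> < 3/8" "\<mu> \<notin> C" "(\<Sum>j<N. of_int (q j) * (of_real (a j) + g j (of_real \<mu>))\<^sup>2) = 0" "j < N"
    for \<mu> :: real and q :: "nat \<Rightarrow> int" and N j
  proof (rule ccontr)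
    assume *: "q j \<noteq> 0"
    let ?qs = "map q [0..<N]"
    have "h ?qs (of_real \<mu>) = 0" using that(3) by (simp add: h_def)
    then have "complex_of_real \<mu> \<in> Z ?qs" using that(1) by (simp add: Z_def)
    then have "\<mu> \<in> Re ` Z ?qs" by (metis Re_complex_of_real imageI)
    moreover have "\<exists>j<length ?qs. ?qs ! j \<noteq> 0" using * that(4) by (intro exI[of _ j]) simp
    ultimately have "\<mu> \<in> C" unfolding C_def by blast
    then show False using that(2) by contradiction
  qed
  then show ?thesis using that cC by blast
qed

subsection \<open>Phase rotations by free evolution\<close>

text \<open>Rational independence in the symmetric sector, with denominators cleared. The
  antisymmetric eigenvalues are integer multiples of \<open>pi^2\<close> and would violate
  it.\<close>

definition indep_even :: "(nat \<Rightarrow> real) \<Rightarrow> bool" where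
  "indep_even l \<longleftrightarrow> (\<forall>(q::nat \<Rightarrow> int) N. (\<Sum>j<N. of_int (q j) * l (2 * j)) = 0 \<longrightarrow> (\<forall>j<N. q j = 0))"

lemma quantized_of_tan:
  assumes mu: "\<mu> > 0" and \<delta>: "\<And>n. odd n \<Longrightarrow> \<delta> n = 0"
    and ev: "\<And>n. even n \<Longrightarrow> 0 < \<delta> n \<and> \<delta> n < 1 \<and> \<delta> n \<le> \<mu> / (real (n + 1) * pi) \<and> 2 * kap \<delta> n * tan (\<delta> n / 2) = \<mu>"
  shows "quantized \<mu> \<delta>"
  unfolding quantized_def
proof (intro allI conjI impI)
  fix n
  show "odd n \<Longrightarrow> \<delta> n = 0" by (rule \<delta>)
  show "0 \<le> \<delta> n" using \<delta>[of n] ev[of n] by (cases "even n") auto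
  have "0 \<le> \<mu> / (real (n + 1) * pi)" using mu by simp
  then show "\<delta> n \<le> \<mu> / (real (n + 1) * pi)" using \<delta>[of n] ev[of n] by (cases "even n") auto
  assume n: "even n"
  let ?A = "real (n + 1) * pi / 2" and ?d = "\<delta> n / 2"
  have c: "cos ?d \<noteq> 0" using ev[OF n] pi_gt3 cos_gt_zero_pi[of ?d] by auto
  have "\<mu> * cos ?d = 2 * kap \<delta> n * sin ?d" using ev[OF n] c by (auto simp: tan_def field_simps)
  moreover have "cos (kap \<delta> n / 2) = - sin ?A * sin ?d" "sin (kap \<delta> n / 2) = sin ?A * cos ?d"
    using cos_half_odd_mult[OF n] by (simp_all add: kap_def add_divide_distrib cos_add sin_add)
  ultimately show "- 2 * kap \<delta> n * cos (kap \<delta> n / 2) = \<mu> * sin (kap \<delta> n / 2)"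
    by (simp add: algebra_simps)
qed

text \<open>An interval is uncountable, so it survives the removal of the countable exceptional set
  with room for two couplings.\<close>

lemma generic_controls:
  assumes "r > 0"
  obtains \<mu>1 \<mu>2 \<delta>1 \<delta>2 where "0 < \<mu>1" "\<mu>1 < r" "\<mu>1 \<le> 1" "0 < \<mu>2" "\<mu>2 < r" "\<mu>2 \<le> 1" "\<mu>1 \<noteq> \<mu>2"
    "quantized \<mu>1 \<delta>1" "quantized \<mu>2 \<delta>2" "indep_even (\<lambda>n. (kap \<delta>1 n)\<^sup>2)" "indep_even (\<lambda>n. (kap \<delta>2 n)\<^sup>2)"
proof -
  define a where "a j = real (2 * j + 1) * pi" for j :: nat
  have a: "a j \<ge> 3" for j
  proof -
    have "1 * pi \<le> a j" unfolding a_def by (intro mult_right_mono) auto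
    then show ?thesis using pi_gt3 by linarith
  qed
  have ex: "\<forall>j. \<exists>g. g holomorphic_on ball 0 (3/8) \<and> (\<forall>w\<in>ball 0 (3/8). cmod (g w) < 1/4 \<and> shiftP (a j) (g w) = w)"
  proof
    fix j
    obtain g where h: "g holomorphic_on ball 0 (3/8)"
      and i: "\<And>w. w \<in> ball 0 (3/8) \<Longrightarrow> cmod (g w) < 1/4 \<and> shiftP (a j) (g w) = w"
      by (rule shiftP_inverse[OF a[of j]]; rule that)
    show "\<exists>g. g holomorphic_on ball 0 (3/8) \<and> (\<forall>w\<in>ball 0 (3/8). cmod (g w) < 1/4 \<and> shiftP (a j) (g w) = w)"
      by (intro exI[of _ g] conjI ballI h i[THEN conjunct1] i[THEN conjunct2])
  qed
  obtain g where gg: "\<And>j. g j holomorphic_on ball 0 (3/8) \<and> (\<forall>w\<in>ball 0 (3/8). cmod (g j w) < 1/4 \<and> shiftP (a j) (g j w) = w)"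
    using choice[OF ex] by (elim exE) (rule that, erule allE)
  note g = gg[THEN conjunct1] and inv = gg[THEN conjunct2, THEN bspec]
  have "inj a" by (rule injI) (simp add: a_def)
  note ia = this
  have "\<exists>C. countable C \<and> (\<forall>(\<mu>::real) (q::nat \<Rightarrow> int) N j. \<bar>\<mu>\<bar> < 3/8 \<longrightarrow> \<mu> \<notin> C \<longrightarrow>
     (\<Sum>j<N. of_int (q j) * (of_real (a j) + g j (of_real \<mu>))\<^sup>2) = 0 \<longrightarrow> j < N \<longrightarrow> q j = 0)"
  proof (rule rational_independence[where a=a and g=g])
    show "3 \<le> a j" for j by (rule a)
    show "inj a" by (rule ia)
    show "g j holomorphic_on ball 0 (3/8)" for j by (rule g)
    show "cmod (g j w) < 1/4 \<and> shiftP (a j) (g j w) = w" if "w \<in> ball 0 (3/8)" for j w by (rule inv[OF that])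
  next
    fix C :: "real set"
    assume "countable C" and ind: "\<And>(\<mu>::real) (q::nat \<Rightarrow> int) N j. \<bar>\<mu>\<bar> < 3/8 \<Longrightarrow> \<mu> \<notin> C \<Longrightarrow>
     (\<Sum>j<N. of_int (q j) * (of_real (a j) + g j (of_real \<mu>))\<^sup>2) = 0 \<Longrightarrow> j < N \<Longrightarrow> q j = 0"
    show ?thesis by (intro exI[of _ C] conjI allI impI \<open>countable C\<close>) (rule ind)
  qed
  then obtain C where CC: "countable C \<and> (\<forall>(\<mu>::real) (q::nat \<Rightarrow> int) N j. \<bar>\<mu>\<bar> < 3/8 \<longrightarrow> \<mu> \<notin> C \<longrightarrow>
     (\<Sum>j<N. of_int (q j) * (of_real (a j) + g j (of_real \<mu>))\<^sup>2) = 0 \<longrightarrow> j < N \<longrightarrow> q j = 0)" ..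
  note C = CC[THEN conjunct1] and ind = CC[THEN conjunct2, rule_format]
  define S where "S = {0<..<min r (3/8)} - C"
  have unc: "uncountable S" unfolding S_def
    by (rule uncountable_minus_countable[OF _ C]) (use assms in \<open>simp add: uncountable_open_interval\<close>)
  \<comment> \<open>Symmetric levels are numbered by \<open>j = n div 2\<close>, with unperturbed
    momentum \<open>a j\<close>; for couplings in \<open>S\<close> the branch is real, so
    \<open>Re\<close> only changes its type.\<close>
  define \<delta> where "\<delta> \<mu> n = (if odd n then 0 else Re (g (n div 2) (of_real \<mu>)))" for \<mu> :: real and n
  have key: "quantized \<mu> (\<delta> \<mu>) \<and> indep_even (\<lambda>n. (kap (\<delta> \<mu>) n)\<^sup>2)" if "\<mu> \<in> S" for \<mu>
  proof
    have mu: "0 < \<mu>" "\<mu> < 3/8" "\<mu> \<notin> C" using that by (auto simp: S_def)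
    have gb: "cmod (g j (of_real \<mu>)) < 1/4" "shiftP (a j) (g j (of_real \<mu>)) = of_real \<mu>" for j
      using inv[of "of_real \<mu>" j] mu by auto
    note re = shiftP_inverse_real[OF a mu(1) gb]
    have kap: "kap (\<delta> \<mu>) (2 * j) = a j + Re (g j (of_real \<mu>))" for j by (simp add: kap_def \<delta>_def a_def)
    show "quantized \<mu> (\<delta> \<mu>)"
    proof (rule quantized_of_tan[OF mu(1)])
      show "\<delta> \<mu> n = 0" if "odd n" for n using that by (simp add: \<delta>_def)
      fix n :: nat assume "even n"
      then obtain j where n: "n = 2 * j" by (rule evenE)
      have \<delta>n: "\<delta> \<mu> n = Re (g j (of_real \<mu>))" by (simp add: \<delta>_def n)
      have an: "real (n + 1) * pi = a j" by (simp add: n a_def)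
      have "Re (g j (of_real \<mu>)) < 1" using gb(1)[of j] complex_Re_le_cmod[of "g j (of_real \<mu>)"] by linarith
      then show "0 < \<delta> \<mu> n \<and> \<delta> \<mu> n < 1 \<and> \<delta> \<mu> n \<le> \<mu> / (real (n + 1) * pi) \<and> 2 * kap (\<delta> \<mu>) n * tan (\<delta> \<mu> n / 2) = \<mu>"
        unfolding \<delta>n an using re[of j] kap[of j] by (simp add: n)
    qed
    show "indep_even (\<lambda>n. (kap (\<delta> \<mu>) n)\<^sup>2)"
      unfolding indep_even_def
    proof (intro allI impI)
      fix q :: "nat \<Rightarrow> int" and N j
      assume z: "(\<Sum>j<N. of_int (q j) * (kap (\<delta> \<mu>) (2 * j))\<^sup>2) = 0" and j: "j < N"
      have "of_real (a j) + g j (of_real \<mu>) = of_real (kap (\<delta> \<mu>) (2 * j))" for j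
        using re(1)[of j] by (simp add: kap)
      then have "(\<Sum>j<N. of_int (q j) * (of_real (a j) + g j (of_real \<mu>))\<^sup>2) = complex_of_real (\<Sum>j<N. of_int (q j) * (kap (\<delta> \<mu>) (2 * j))\<^sup>2)"
        by simp
      then have "(\<Sum>j<N. of_int (q j) * (of_real (a j) + g j (of_real \<mu>))\<^sup>2) = 0" unfolding z by simp
      then show "q j = 0" using ind[of \<mu> q N j] mu j by simp
    qed
  qed
  obtain \<mu>1 where m1: "\<mu>1 \<in> S" using unc by (metis countable_empty ex_in_conv)
  have "uncountable (S - {\<mu>1})" by (rule uncountable_minus_countable[OF unc]) simp
  then obtain \<mu>2 where m2: "\<mu>2 \<in> S" "\<mu>2 \<noteq> \<mu>1" by (metis countable_empty ex_in_conv Diff_iff singletonI)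
  show ?thesis
    by (rule that[of \<mu>1 \<mu>2 "\<delta> \<mu>1" "\<delta> \<mu>2"]) (use m1 m2 key in \<open>auto simp: S_def\<close>)
qed

section \<open>Kronecker's theorem and the approximation of phase rotations\<close>

lemma cmod_cis_minus_1: "cmod (cis d - 1) = 2 * \<bar>sin (d / 2)\<bar>"
proof -
  have "(cmod (cis d - 1))\<^sup>2 = (cos d - 1)\<^sup>2 + (sin d)\<^sup>2" by (simp add: cmod_power2)
  also have "\<dots> = 2 - 2 * cos d"
    using sin_cos_squared_add[of d] by (simp add: power2_eq_square algebra_simps)
  also have "\<dots> = (2 * \<bar>sin (d / 2)\<bar>)\<^sup>2"
    using cos_double_sin[of "d / 2"] by (simp add: power_mult_distrib)
  finally show ?thesis by (subst (asm) power2_eq_iff_nonneg) auto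
qed

lemma cmod_cis_diff_le: "cmod (cis x - cis y) \<le> \<bar>x - y\<bar>"
proof -
  have "cis x - cis y = cis y * (cis (x - y) - 1)" by (simp add: cis_mult right_diff_distrib)
  then have "cmod (cis x - cis y) = 2 * \<bar>sin ((x - y) / 2)\<bar>" by (simp add: norm_mult cmod_cis_minus_1)
  also have "\<dots> \<le> 2 * \<bar>(x - y) / 2\<bar>" by (intro mult_left_mono abs_sin_x_le_abs_x) auto
  finally show ?thesis by simp
qed

text \<open>Kronecker's theorem yields a time of either sign; adding a multiple of an almost-period from
  Dirichlet's theorem makes it positive.\<close>

lemma kronecker_positive:
  fixes \<theta> \<alpha> :: "nat \<Rightarrow> real"
  assumes ind: "\<And>q::nat \<Rightarrow> int. (\<Sum>j<n. of_int (q j) * \<theta> j) = 0 \<Longrightarrow> \<forall>j<n. q j = 0" and "\<epsilon> > 0"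
  obtains t h where "t > 0" "\<And>i. i < n \<Longrightarrow> \<bar>t * \<theta> i - of_int (h i) - \<alpha> i\<bar> < \<epsilon>"
proof -
  interpret M: Modules.module "\<lambda>r. (*) (real_of_int r)"
    by (simp add: Modules.module.intro distrib_left mult.commute)
  have inj: "inj_on \<theta> {..<n}"
  proof (rule inj_onI, rule ccontr)
    fix i j assume ij: "i \<in> {..<n}" "j \<in> {..<n}" "\<theta> i = \<theta> j" "i \<noteq> j"
    define q :: "nat \<Rightarrow> int" where "q k = (if k = i then 1 else 0) - (if k = j then 1 else 0)" for k
    have "(\<Sum>k<n. of_int (q k) * \<theta> k) = (\<Sum>k<n. (if k = i then \<theta> k else 0) - (if k = j then \<theta> k else 0))"
      by (intro sum.cong refl) (auto simp: q_def)
    also have "\<dots> = 0" using ij by (simp add: sum_subtractf)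
    finally have "q i = 0" using ind[of q] ij by auto
    then show False using ij by (simp add: q_def)
  qed
  have indp: "M.independent (\<theta> ` {..<n})"
    unfolding M.dependent_explicit
  proof clarify
    fix T u x assume T: "finite T" "T \<subseteq> \<theta> ` {..<n}" and s: "(\<Sum>v\<in>T. real_of_int (u v) * v) = 0" and x: "x \<in> T" "u x \<noteq> 0"
    define q where "q j = (if \<theta> j \<in> T then u (\<theta> j) else 0)" for j
    have "(\<Sum>j<n. of_int (q j) * \<theta> j) = (\<Sum>v\<in>\<theta> ` {..<n}. (if v \<in> T then real_of_int (u v) * v else 0))"
      by (subst sum.reindex[OF inj]) (auto simp: q_def intro!: sum.cong)
    also have "\<dots> = (\<Sum>v\<in>T. real_of_int (u v) * v)"
      using T by (simp add: sum.inter_restrict[symmetric] Int_absorb1 Int_absorb2 inf_commute)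
    finally have "\<forall>j<n. q j = 0" using ind s by simp
    moreover obtain j where "j < n" "x = \<theta> j" using T x by auto
    ultimately show False using x by (auto simp: q_def)
  qed
  obtain t h where t: "\<And>i. i < n \<Longrightarrow> \<bar>t * \<theta> i - of_int (h i) - \<alpha> i\<bar> < \<epsilon> / 2"
    using Kronecker_thm_1[OF indp inj, of "\<epsilon> / 2" \<alpha>] \<open>\<epsilon> > 0\<close> by auto
  obtain N :: nat where N: "N > 0" "1 / real N < \<epsilon> / 2"
    using reals_Archimedean[of "\<epsilon> / 2"] \<open>\<epsilon> > 0\<close> by (metis half_gt_zero inverse_eq_divide zero_less_Suc)
  \<comment> \<open>The almost-period is sought among multiples of \<open>\<bar>t\<bar> + 1\<close>,
    so that adding it makes the time positive.\<close>
  obtain q p where q: "0 < q" "q \<le> int (N ^ n)" "\<And>i. i < n \<Longrightarrow> \<bar>of_int q * ((\<bar>t\<bar> + 1) * \<theta> i) - of_int (p i)\<bar> < 1 / N"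
    by (rule Dirichlet_approx_simult[OF N(1), of n "\<lambda>i. (\<bar>t\<bar> + 1) * \<theta> i"]; rule that)
  show ?thesis
  proof
    have "1 * (\<bar>t\<bar> + 1) \<le> of_int q * (\<bar>t\<bar> + 1)" using q(1) by (intro mult_right_mono) auto
    moreover have "t + X > 0" if "1 * (\<bar>t\<bar> + 1) \<le> X" for X :: real
      using that abs_ge_minus_self[of t] by simp
    ultimately show "t + of_int q * (\<bar>t\<bar> + 1) > 0" by blast
    fix i assume i: "i < n"
    have "(t + of_int q * (\<bar>t\<bar> + 1)) * \<theta> i - of_int (h i + p i) - \<alpha> i
      = (t * \<theta> i - of_int (h i) - \<alpha> i) + (of_int q * ((\<bar>t\<bar> + 1) * \<theta> i) - of_int (p i))" by (simp add: algebra_simps)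
    also have "\<bar>\<dots>\<bar> < \<epsilon>" using t[OF i] q(3)[OF i] N(2) by linarith
    finally show "\<bar>(t + of_int q * (\<bar>t\<bar> + 1)) * \<theta> i - of_int (h i + p i) - \<alpha> i\<bar> < \<epsilon>" .
  qed
qed

text \<open>For a unit vector \<open>v\<close>, the unitary that multiplies \<open>v\<close> by
  \<open>cis \<theta>\<close> and fixes its orthogonal complement.\<close>

definition phase :: "ltwo \<Rightarrow> real \<Rightarrow> ltwo \<Rightarrow> ltwo" where
  "phase v \<theta> u = u + csc ((cis \<theta> - 1) * cinn v u) v"

text \<open>By \<open>diag_approx\<close> only finitely many phases matter, and only those of even
  index, where \<open>u\<close> lives. Kronecker's theorem brings \<open>t * l i\<close> near the
  desired value modulo \<open>2 * pi\<close> at these indices.\<close>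

lemma phase_approx:
  assumes e: "onb e" and ind: "indep_even l" and even: "\<And>n. odd n \<Longrightarrow> cinn (e n) u = 0" and m: "even m" and "\<epsilon> > 0"
  shows "\<exists>t>0. norm (grp e l t u - phase (e m) \<theta> u) < \<epsilon>"
proof -
  define c where "c i = (if i = m then cis \<theta> else 1)" for i
  have c1: "cmod (c i) = 1" for i by (simp add: c_def)
  have ph: "phase (e m) \<theta> u = diag e c u"
    by (rule onb_eqI[OF e])
       (simp add: phase_def coeff_diag[OF e c1] cinn_add_right cinn_csc_right orthonormal_cinn[OF onb_orthonormal[OF e]] c_def algebra_simps)
  obtain N \<delta> where "\<delta> > 0" and N: "\<And>m m'. \<lbrakk>\<forall>i. cmod (m i) = 1; \<forall>i. cmod (m' i) = 1;
     \<forall>i<N. cinn (e i) u \<noteq> 0 \<longrightarrow> cmod (m i - m' i) < \<delta>\<rbrakk> \<Longrightarrow> norm (diag e m u - diag e m' u) < \<epsilon>"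
    using diag_approx[OF e \<open>\<epsilon> > 0\<close>, of u] by blast
  \<comment> \<open>Phases in units of \<open>2 * pi\<close>; the sign is that of
    \<open>cis (- (t * l i))\<close>.\<close>
  define \<alpha> where "\<alpha> j = (if 2 * j = m then - \<theta> / (2 * pi) else 0)" for j
  have i': "\<forall>j<N. q j = 0" if "(\<Sum>j<N. of_int (q j) * (l (2 * j) / (2 * pi))) = 0" for q :: "nat \<Rightarrow> int"
  proof -
    have "(\<Sum>j<N. of_int (q j) * l (2 * j)) / (2 * pi) = 0" using that by (simp add: sum_divide_distrib)
    then show ?thesis using ind by (simp add: indep_even_def)
  qed
  obtain t h where t: "t > 0" "\<And>j. j < N \<Longrightarrow> \<bar>t * (l (2 * j) / (2 * pi)) - of_int (h j) - \<alpha> j\<bar> < \<delta> / (2 * pi)"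
    using kronecker_positive[where n=N and \<theta>="\<lambda>j. l (2 * j) / (2 * pi)" and \<epsilon>="\<delta> / (2 * pi)" and \<alpha>=\<alpha>, OF i'] \<open>\<delta> > 0\<close> by auto
  have "norm (diag e (\<lambda>i. cis (- (t * l i))) u - diag e c u) < \<epsilon>"
  proof (rule N)
    show "\<forall>i<N. cinn (e i) u \<noteq> 0 \<longrightarrow> cmod (cis (- (t * l i)) - c i) < \<delta>"
    proof (intro allI impI)
      fix i assume i: "i < N" "cinn (e i) u \<noteq> 0"
      then have "even i" using even by auto
      then obtain j where j: "i = 2 * j" by (rule evenE)
      have "cis (- (2 * pi * of_int (h j)) - 2 * pi * \<alpha> j) = c i"
      proof -
        have "cis (- (2 * pi * of_int (h j))) = 1" using cis_multiple_2pi[of "- of_int (h j)"] by simp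
        moreover have "cis (- (2 * pi * \<alpha> j)) = c i" by (simp add: \<alpha>_def c_def j)
        ultimately show ?thesis by (metis cis_mult diff_conv_add_uminus mult_1)
      qed
      then have "cmod (cis (- (t * l i)) - c i) \<le> \<bar>- (t * l i) - (- (2 * pi * of_int (h j)) - 2 * pi * \<alpha> j)\<bar>"
        using cmod_cis_diff_le by metis
      also have "\<dots> = 2 * pi * \<bar>t * (l (2 * j) / (2 * pi)) - of_int (h j) - \<alpha> j\<bar>"
      proof -
        have "- (t * l i) - (- (2 * pi * of_int (h j)) - 2 * pi * \<alpha> j) = - (2 * pi) * (t * (l (2 * j) / (2 * pi)) - of_int (h j) - \<alpha> j)"
          by (simp add: j algebra_simps)
        then show ?thesis by (simp add: abs_mult)
      qed
      also have "\<dots> < 2 * pi * (\<delta> / (2 * pi))" using t(2)[of j] i j by (intro mult_strict_left_mono) auto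
      finally show "cmod (cis (- (t * l i)) - c i) < \<delta>" by simp
    qed
  qed (simp_all add: c1)
  then show ?thesis using t(1) unfolding ph grp_def by blast
qed

subsection \<open>Transitivity of phase rotations\<close>

lemma phase_diff: "phase v \<theta> (u - w) = phase v \<theta> u - phase v \<theta> w"
  by (simp add: phase_def cinn_diff_right csc_diff_left right_diff_distrib)

text \<open>With \<open>c = cis \<theta> - 1\<close>, unimodularity of \<open>1 + c\<close> says
  \<open>(cmod c)^2 + 2 * Re c = 0\<close>, and this is the coefficient by which the squared norm
  would change.\<close>

lemma norm_phase:
  assumes "norm v = 1" shows "norm (phase v \<theta> u) = norm u"
proof -
  define c a where "c = cis \<theta> - 1" and "a = cinn v u"
  have "(cmod c)\<^sup>2 = (cos \<theta> - 1)\<^sup>2 + (sin \<theta>)\<^sup>2" by (simp add: cmod_power2 c_def)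
  then have z: "(cmod c)\<^sup>2 + 2 * Re c = 0"
    by (simp add: power2_diff sin_squared_eq c_def)
  have "cinn u (csc (c * a) v) = c * of_real ((cmod a)\<^sup>2)"
    by (simp add: cinn_csc_right complex_norm_square a_def cinn_commute mult.assoc del: of_real_power)
  then have "Re (cinn u (csc (c * a) v)) = Re c * (cmod a)\<^sup>2" by simp
  then have "(norm (phase v \<theta> u))\<^sup>2 = (norm u)\<^sup>2 + ((cmod c)\<^sup>2 + 2 * Re c) * (cmod a)\<^sup>2"
    unfolding phase_def norm_add_sq c_def[symmetric] a_def[symmetric]
    by (simp add: norm_csc norm_mult assms power_mult_distrib algebra_simps)
  then show ?thesis unfolding z by (simp add: power2_eq_iff_nonneg)
qed

lemma cinn_phase: "cinn w (phase v \<theta> u) = cinn w u + (cis \<theta> - 1) * cinn v u * cinn w v"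
  by (simp add: phase_def cinn_add_right cinn_csc_right)

lemma cinn_unit: "norm v = 1 \<Longrightarrow> cinn v v = 1"
  by (simp add: cinn_self)

lemma phase_inverse:
  assumes "norm v = 1" shows "phase v (- \<theta>) (phase v \<theta> u) = u"
proof -
  have "cinn v (phase v \<theta> u) = cis \<theta> * cinn v u" by (simp add: cinn_phase cinn_unit[OF assms] algebra_simps)
  then have "phase v (- \<theta>) (phase v \<theta> u) = u + csc ((cis \<theta> - 1) * cinn v u) v + csc ((cis (- \<theta>) - 1) * (cis \<theta> * cinn v u)) v"
    by (simp add: phase_def)
  also have "\<dots> = u + csc ((cis \<theta> - 1) * cinn v u + (cis (- \<theta>) - 1) * (cis \<theta> * cinn v u)) v"
    by (simp add: csc_add_left)
  also have "(cis \<theta> - 1) * cinn v u + (cis (- \<theta>) - 1) * (cis \<theta> * cinn v u) = (cis (- \<theta>) * cis \<theta> - 1) * cinn v u"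
    by (simp add: algebra_simps)
  also have "\<dots> = 0" by (simp add: cis_mult)
  finally show ?thesis by simp
qed

definition phases :: "(ltwo \<times> real) list \<Rightarrow> ltwo \<Rightarrow> ltwo" where
  "phases ps = fold (\<lambda>(v, \<theta>). phase v \<theta>) ps"

lemma phases_Nil [simp]: "phases [] u = u" and phases_append: "phases (ps @ qs) u = phases qs (phases ps u)"
  and phases_snoc: "phases (ps @ [(v, \<theta>)]) u = phase v \<theta> (phases ps u)"
  by (simp_all add: phases_def)

lemma norm_phases_diff:
  assumes "\<forall>(v, \<theta>)\<in>set ps. norm v = 1" shows "norm (phases ps u - phases ps w) = norm (u - w)"
  using assms
proof (induction ps rule: rev_induct)
  case (snoc p ps)
  then show ?case by (cases p) (simp add: phases_snoc norm_phase flip: phase_diff)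
qed simp

lemma norm_phases:
  assumes "\<forall>(v, \<theta>)\<in>set ps. norm v = 1" shows "norm (phases ps u) = norm u"
  using assms
proof (induction ps rule: rev_induct)
  case (snoc p ps)
  then show ?case by (cases p) (simp add: phases_snoc norm_phase)
qed simp

lemma phases_inverse:
  assumes "\<forall>(v, \<theta>)\<in>set ps. norm v = 1"
  shows "phases (rev (map (\<lambda>(v, \<theta>). (v, - \<theta>)) ps)) (phases ps u) = u"
  using assms
proof (induction ps arbitrary: u rule: rev_induct)
  case (snoc p ps)
  obtain v \<theta> where p: "p = (v, \<theta>)" by (cases p)
  have "phases (rev (map (\<lambda>(v, \<theta>). (v, - \<theta>)) (ps @ [p]))) (phases (ps @ [p]) u)
     = phases (rev (map (\<lambda>(v, \<theta>). (v, - \<theta>)) ps)) (phase v (- \<theta>) (phase v \<theta> (phases ps u)))"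
    by (simp add: p phases_def)
  then show ?case using snoc by (simp add: p phase_inverse)
qed simp

lemma align_phase: "\<exists>\<tau>. cmod (cis \<tau> * A + B) = cmod A + cmod B"
proof -
  have "rcis (cmod A) (Arg B) + rcis (cmod B) (Arg B) = rcis (cmod A + cmod B) (Arg B)"
    by (simp add: rcis_def distrib_right)
  moreover have "cis (Arg B - Arg A) * rcis (cmod A) (Arg A) = rcis (cmod A) (Arg B)"
    by (simp add: cis_rcis_eq rcis_mult)
  ultimately have "cis (Arg B - Arg A) * A + B = rcis (cmod A + cmod B) (Arg B)"
    by (simp only: rcis_cmod_Arg)
  then have "cmod (cis (Arg B - Arg A) * A + B) = cmod A + cmod B" by simp
  then show ?thesis by blast
qed

text \<open>Turning the component along \<open>w\<close> by a small angle \<open>\<theta>\<close> costs the \<open>v0\<close>-component only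
  second order in \<open>\<theta>\<close>, while it feeds the rest of the vector into it at first order, in phase
  after a preliminary rotation about \<open>v0\<close>.\<close>

lemma phase_gain:
  fixes \<xi> v0 w :: ltwo
  assumes v0: "norm v0 = 1" and w: "norm w = 1" and x: "0 \<le> x" "x \<le> 2"
  defines "\<alpha> \<equiv> cinn v0 \<xi>"
  shows "\<exists>\<tau> \<theta>. cmod \<alpha> * (1 - x\<^sup>2 / 4) + x * cmod (cinn v0 w) * cmod (cinn w (\<xi> - csc \<alpha> v0))
      \<le> cmod (cinn v0 (phase w \<theta> (phase v0 \<tau> \<xi>)))"
proof -
  \<comment> \<open>The rotation angle is parametrized by the chord length
    \<open>x = cmod (cis \<theta> - 1)\<close>.\<close>
  define \<theta> where "\<theta> = 2 * arcsin (x / 2)"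
  have cx: "cmod (cis \<theta> - 1) = x" using x by (simp add: cmod_cis_minus_1 \<theta>_def)
  define p where "p = (cmod (cinn v0 w))\<^sup>2"
  have p: "0 \<le> p" "p \<le> 1"
    using power_mono[OF cinn_Cauchy_Schwarz[of v0 w], of 2] v0 w by (auto simp: p_def)
  define \<eta> where "\<eta> = \<xi> - csc \<alpha> v0"
  have v\<eta>: "cinn v0 \<eta> = 0" by (simp add: \<eta>_def cinn_diff_right cinn_csc_right cinn_unit[OF v0] \<alpha>_def)
  have \<xi>: "\<xi> = csc \<alpha> v0 + \<eta>" by (simp add: \<eta>_def)
  \<comment> \<open>\<open>Z\<close> is the factor retained by the \<open>v0\<close>-component and
    \<open>B\<close> the amount fed in from \<open>\<eta>\<close>. The angle \<open>\<tau>\<close>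
    turns only the former, so the two can be aligned.\<close>
  define Z where "Z = 1 + (cis \<theta> - 1) * of_real p"
  define B where "B = (cis \<theta> - 1) * cinn w \<eta> * cinn v0 w"
  have wv: "cinn w v0 * cinn v0 w = of_real p"
    by (metis cinn_commute complex_norm_square mult.commute p_def)
  have eq: "cinn v0 (phase w \<theta> (phase v0 \<tau> \<xi>)) = cis \<tau> * (\<alpha> * Z) + B" for \<tau>
  proof -
    have 1: "cinn v0 (phase v0 \<tau> \<xi>) = cis \<tau> * \<alpha>"
      by (simp add: cinn_phase cinn_unit[OF v0] \<alpha>_def algebra_simps)
    have "cinn w (phase v0 \<tau> \<xi>) = cinn w \<xi> + (cis \<tau> - 1) * \<alpha> * cinn w v0"
      by (simp add: cinn_phase \<alpha>_def)
    also have "cinn w \<xi> = \<alpha> * cinn w v0 + cinn w \<eta>" by (subst \<xi>) (simp add: cinn_add_right cinn_csc_right)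
    finally have 2: "cinn w (phase v0 \<tau> \<xi>) = cis \<tau> * \<alpha> * cinn w v0 + cinn w \<eta>" by (simp add: algebra_simps)
    have "cinn v0 (phase w \<theta> (phase v0 \<tau> \<xi>)) = cis \<tau> * \<alpha> + (cis \<theta> - 1) * (cis \<tau> * \<alpha> * cinn w v0 + cinn w \<eta>) * cinn v0 w"
      unfolding cinn_phase[of v0 w] 1 2 ..
    also have "\<dots> = cis \<tau> * \<alpha> + (cis \<theta> - 1) * (cis \<tau> * \<alpha>) * (cinn w v0 * cinn v0 w) + B"
      by (simp add: B_def algebra_simps)
    also have "\<dots> = cis \<tau> * (\<alpha> * Z) + B" unfolding wv by (simp add: Z_def algebra_simps)
    finally show ?thesis .
  qed
  obtain \<tau> where \<tau>: "cmod (cis \<tau> * (\<alpha> * Z) + B) = cmod (\<alpha> * Z) + cmod B" using align_phase by blast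
  \<comment> \<open>The exact value is \<open>(cmod Z)^2 = 1 - p * (1 - p) * x^2\<close>, with
    \<open>p * (1 - p) \<le> 1/4\<close>; a number in \<open>[0, 1]\<close> is at least its
    square.\<close>
  have Z: "1 - x\<^sup>2 / 4 \<le> cmod Z"
  proof -
    have "x\<^sup>2 = (cos \<theta> - 1)\<^sup>2 + (sin \<theta>)\<^sup>2"
      unfolding cx[symmetric] by (simp add: cmod_power2)
    then have "x\<^sup>2 = 2 - 2 * cos \<theta>"
      by (simp add: power2_diff sin_squared_eq)
    then have cs: "cos \<theta> = 1 - x\<^sup>2 / 2" by linarith
    have "(cmod Z)\<^sup>2 = (1 + (cos \<theta> - 1) * p)\<^sup>2 + (sin \<theta> * p)\<^sup>2" by (simp add: Z_def cmod_power2)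
    also have "\<dots> = 1 - 2 * (p * (1 - p)) * (1 - cos \<theta>)"
      unfolding power_mult_distrib sin_squared_eq by (simp add: power2_eq_square algebra_simps)
    also have "\<dots> = 1 - (p * (1 - p)) * x\<^sup>2" by (simp add: cs)
    finally have Z2: "(cmod Z)\<^sup>2 = 1 - (p * (1 - p)) * x\<^sup>2" .
    have "p * (1 - p) \<le> 1/4" using zero_le_power2[of "p - 1/2"] by (simp add: power2_eq_square algebra_simps)
    then have "(p * (1 - p)) * x\<^sup>2 \<le> (1/4) * x\<^sup>2" by (intro mult_right_mono) auto
    then have "1 - x\<^sup>2 / 4 \<le> (cmod Z)\<^sup>2" using Z2 by simp
    moreover have x4: "0 \<le> 1 - x\<^sup>2 / 4" "1 - x\<^sup>2 / 4 \<le> 1" using power_mono[OF x(2) x(1), of 2] by auto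
    then have "(1 - x\<^sup>2 / 4)\<^sup>2 \<le> 1 - x\<^sup>2 / 4" by (simp add: power2_eq_square mult_left_le)
    ultimately have "(1 - x\<^sup>2 / 4)\<^sup>2 \<le> (cmod Z)\<^sup>2" by linarith
    then show ?thesis by (rule power2_le_imp_le) simp
  qed
  have "cmod \<alpha> * (1 - x\<^sup>2 / 4) + x * cmod (cinn v0 w) * cmod (cinn w \<eta>) \<le> cmod (\<alpha> * Z) + cmod B"
    using mult_left_mono[OF Z, of "cmod \<alpha>"] by (simp add: B_def norm_mult cx mult_ac)
  then show ?thesis unfolding \<eta>_def[symmetric] using \<tau> eq[of \<tau>] by metis
qed

section \<open>Steering within a finite dimensional span\<close>

definition in_span :: "nat \<Rightarrow> (nat \<Rightarrow> ltwo) \<Rightarrow> ltwo \<Rightarrow> ltwo \<Rightarrow> bool" where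
  "in_span n u v0 \<xi> \<longleftrightarrow> (\<exists>c b. \<xi> = (\<Sum>j<n. csc (c j) (u j)) + csc b v0)"

lemma in_span_phase:
  assumes "in_span n u v0 \<xi>" "w = v0 \<or> (\<exists>j<n. w = u j)" shows "in_span n u v0 (phase w \<theta> \<xi>)"
proof -
  obtain c b where \<xi>: "\<xi> = (\<Sum>j<n. csc (c j) (u j)) + csc b v0" using assms(1) by (auto simp: in_span_def)
  define k where "k = (cis \<theta> - 1) * cinn w \<xi>"
  have ph: "phase w \<theta> \<xi> = \<xi> + csc k w" by (simp add: phase_def k_def)
  show ?thesis
  proof (cases "w = v0")
    case True
    then have "phase w \<theta> \<xi> = (\<Sum>j<n. csc (c j) (u j)) + csc (b + k) v0" unfolding ph by (subst \<xi>) (simp add: csc_add_left)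
    then show ?thesis unfolding in_span_def by blast
  next
    case False
    then obtain i where i: "i < n" "w = u i" using assms(2) by blast
    define c' where "c' j = c j + (if j = i then k else 0)" for j
    have "(\<Sum>j<n. csc (c' j) (u j)) = (\<Sum>j<n. csc (c j) (u j)) + (\<Sum>j<n. if j = i then csc k (u j) else 0)"
      unfolding c'_def csc_add_left sum.distrib by (intro arg_cong2[of _ _ _ _ "(+)"] sum.cong refl) auto
    also have "(\<Sum>j<n. if j = i then csc k (u j) else 0) = csc k w" using i by simp
    finally have "phase w \<theta> \<xi> = (\<Sum>j<n. csc (c' j) (u j)) + csc b v0" unfolding ph by (subst \<xi>) simp
    then show ?thesis unfolding in_span_def by blast
  qed
qed

text \<open>In the span, a vector orthogonal to \<open>v0\<close> cannot be almost orthogonal to all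
  \<open>u j\<close>. Write it as its projection \<open>P \<eta>\<close> plus \<open>b\<close> times
  the part \<open>z\<close> of \<open>v0\<close> orthogonal to the \<open>u j\<close>; orthogonality
  to \<open>v0\<close> gives \<open>cmod b * (norm z)^2 \<le> norm (P \<eta>)\<close>. For
  \<open>z = 0\<close>, division by zero leaves the constant 1, which is right in that case.\<close>

lemma span_lower_bound:
  assumes o: "orthonormal u" and v0: "norm v0 = 1" and sp: "in_span n u v0 \<eta>" and perp: "cinn v0 \<eta> = 0"
  defines "z \<equiv> v0 - (\<Sum>j<n. csc (cinn (u j) v0) (u j))"
  shows "(norm \<eta>)\<^sup>2 \<le> (1 + 1 / (norm z)\<^sup>2) * (\<Sum>j<n. (cmod (cinn (u j) \<eta>))\<^sup>2)"
proof -
  define P where "P x = (\<Sum>j<n. csc (cinn (u j) x) (u j))" for x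
  have uP: "cinn (u j) (P x) = cinn (u j) x" if "j < n" for j x
    unfolding P_def using that by (simp add: cinn_sum_orthonormal[OF o])
  have nP: "(norm (P x))\<^sup>2 = (\<Sum>j<n. (cmod (cinn (u j) x))\<^sup>2)" for x
    unfolding P_def by (simp add: norm_sum_orthonormal[OF o])
  have cP: "cinn (P x) y = 0" if "\<And>j. j < n \<Longrightarrow> cinn (u j) y = 0" for x y
    unfolding P_def cinn_sum_left using that by (simp add: cinn_csc_left)
  have zdef: "z = v0 - P v0" by (simp add: z_def P_def)
  have uz: "cinn (u j) z = 0" if "j < n" for j using uP[OF that] by (simp add: zdef cinn_diff_right)
  obtain c b where \<eta>: "\<eta> = (\<Sum>j<n. csc (c j) (u j)) + csc b v0" using sp by (auto simp: in_span_def)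
  have "cinn (u j) \<eta> = c j + b * cinn (u j) v0" if "j < n" for j
    unfolding \<eta> using that by (simp add: cinn_add_right cinn_csc_right cinn_sum_orthonormal[OF o])
  then have "P \<eta> = (\<Sum>j<n. csc (c j) (u j)) + csc b (P v0)"
    unfolding P_def csc_sum_right by (simp add: csc_add_left sum.distrib csc_csc)
  then have dec: "\<eta> = P \<eta> + csc b z" by (simp add: \<eta> zdef csc_diff_right)
  have Pz: "cinn (P \<eta>) z = 0" by (rule cP[OF uz])
  have n2: "(norm \<eta>)\<^sup>2 = (norm (P \<eta>))\<^sup>2 + (cmod b)\<^sup>2 * (norm z)\<^sup>2"
  proof -
    have "(norm \<eta>)\<^sup>2 = (norm (P \<eta> + csc b z))\<^sup>2" using dec by simp
    then show ?thesis unfolding norm_add_sq by (simp add: norm_csc power_mult_distrib cinn_csc_right Pz)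
  qed
  show ?thesis
  proof (cases "z = 0")
    case True
    then show ?thesis using n2 nP[of \<eta>] by simp
  next
    case False
    have "cinn z \<eta> = b * of_real ((norm z)\<^sup>2)"
    proof -
      have "cinn z \<eta> = cinn z (P \<eta>) + b * cinn z z" by (subst dec) (simp add: cinn_add_right cinn_csc_right)
      moreover have "cinn z (P \<eta>) = 0" using Pz by (metis cinn_commute complex_cnj_zero)
      ultimately show ?thesis by (simp add: cinn_self)
    qed
    moreover have "cinn z \<eta> = - cinn (P v0) (P \<eta>)"
    proof -
      have "cinn (P v0) (\<eta> - P \<eta>) = 0" by (rule cP) (simp add: cinn_diff_right uP)
      then show ?thesis by (simp add: zdef cinn_diff_left perp cinn_diff_right)
    qed
    ultimately have "cmod b * (norm z)\<^sup>2 = cmod (cinn (P v0) (P \<eta>))"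
      by (metis norm_minus_cancel norm_mult norm_of_real abs_of_nonneg zero_le_power2)
    also have "\<dots> \<le> norm (P v0) * norm (P \<eta>)" by (rule cinn_Cauchy_Schwarz)
    also have "norm (P v0) \<le> 1"
    proof (rule power2_le_imp_le)
      show "(norm (P v0))\<^sup>2 \<le> 1\<^sup>2" unfolding nP using bessel[OF o, of "{..<n}" v0] v0 by simp
    qed simp
    finally have "cmod b * (norm z)\<^sup>2 \<le> norm (P \<eta>)" by (simp add: mult_left_le_one_le order_trans mult_right_mono)
    then have "(cmod b * (norm z)\<^sup>2)\<^sup>2 \<le> (norm (P \<eta>))\<^sup>2" by (intro power_mono) auto
    then have "(cmod b)\<^sup>2 * (norm z)\<^sup>2 \<le> (norm (P \<eta>))\<^sup>2 / (norm z)\<^sup>2"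
      using False by (simp add: field_simps power2_eq_square)
    then show ?thesis using n2 nP[of \<eta>] by (simp add: algebra_simps)
  qed
qed

text \<open>Take the supremum of the overlap with \<open>v0\<close> over all finite sequences of
  rotations. If it fell short of \<open>norm \<psi>\<close>, the part orthogonal to
  \<open>v0\<close> would stay bounded away from 0, and from a state of nearly maximal overlap one
  more pair of rotations would exceed the supremum.\<close>

lemma hub_reachable:
  assumes o: "orthonormal u" and v0: "norm v0 = 1" and ne: "\<And>j. cinn v0 (u j) \<noteq> 0"
    and sp: "in_span n u v0 \<psi>" and "\<epsilon> > 0"
  shows "\<exists>ps. set ps \<subseteq> insert v0 (range u) \<times> UNIV \<and> norm (phases ps \<psi> - csc (of_real (norm \<psi>)) v0) < \<epsilon>"
proof (cases "\<psi> = 0")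
  case True
  then show ?thesis using \<open>\<epsilon> > 0\<close> by (intro exI[of _ "[]"]) simp
next
  case False
  define R where "R = norm \<psi>"
  have R: "R > 0" using False by (simp add: R_def)
  define Q where "Q = {ps. set ps \<subseteq> insert v0 (u ` {..<n}) \<times> (UNIV::real set)}"
  have unit: "\<forall>(v, \<theta>)\<in>set ps. norm v = 1" if "ps \<in> Q" for ps
    using that v0 orthonormal_norm[OF o] by (auto simp: Q_def)
  have span: "in_span n u v0 (phases ps \<psi>)" if "ps \<in> Q" for ps
    using that
  proof (induction ps rule: rev_induct)
    case Nil then show ?case using sp by simp
  next
    case (snoc p ps)
    obtain v \<theta> where p: "p = (v, \<theta>)" by (cases p)
    from snoc have "in_span n u v0 (phases ps \<psi>)" "v = v0 \<or> (\<exists>j<n. v = u j)" by (auto simp: Q_def p)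
    then show ?case unfolding p phases_snoc by (rule in_span_phase)
  qed
  define f where "f ps = cmod (cinn v0 (phases ps \<psi>))" for ps
  have fR: "f ps \<le> R" if "ps \<in> Q" for ps
    using cinn_Cauchy_Schwarz[of v0 "phases ps \<psi>"] by (simp add: f_def v0 norm_phases[OF unit[OF that]] R_def)
  have bdd: "bdd_above (f ` Q)" using fR by (intro bdd_aboveI[of _ R]) auto
  have Nil: "[] \<in> Q" by (simp add: Q_def)
  define s where "s = Sup (f ` Q)"
  have fs: "f ps \<le> s" if "ps \<in> Q" for ps unfolding s_def using that bdd by (auto intro: cSup_upper)
  have "R \<le> s"
  proof (rule ccontr)
    assume "\<not> R \<le> s"
    then have sR: "s < R" by simp
    have s0: "0 \<le> s" using fs[OF Nil] order_trans[OF norm_ge_zero] by (simp add: f_def)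
    define C where "C = 1 + 1 / (norm (v0 - (\<Sum>j<n. csc (cinn (u j) v0) (u j))))\<^sup>2"
    have C: "C > 0" unfolding C_def by (simp add: add_pos_nonneg)
    define D where "D = R\<^sup>2 - s\<^sup>2"
    have D: "D > 0" using sR s0 by (simp add: D_def power_strict_mono)
    \<comment> \<open>The 1 keeps the set nonempty for \<open>n = 0\<close>.\<close>
    define pm where "pm = Min (insert 1 ((\<lambda>j. cmod (cinn v0 (u j))) ` {..<n}))"
    have pm: "pm > 0" unfolding pm_def using ne by (subst Min_gr_iff) auto
    have pmle: "pm \<le> cmod (cinn v0 (u j))" if "j < n" for j
      unfolding pm_def using that by (intro Min_le) auto
    \<comment> \<open>If all components were below \<open>\<gamma>\<close>, their squares would sum
      to at most \<open>n * \<gamma>^2\<close>, which is less than \<open>D / C\<close>.\<close>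
    define \<gamma> where "\<gamma> = sqrt (D / (C * (real n + 1)))"
    have \<gamma>: "\<gamma> > 0" unfolding \<gamma>_def using C D by (simp add: add_nonneg_pos)
    have \<gamma>2: "\<gamma>\<^sup>2 = D / (C * (real n + 1))" unfolding \<gamma>_def using C D by (simp add: add_nonneg_pos)
    define g0 where "g0 = pm * \<gamma>"
    have g0: "g0 > 0" using pm \<gamma> by (simp add: g0_def)
    \<comment> \<open>With \<open>x \<le> 2 * g0 / R\<close> the quadratic loss
      \<open>R * x^2 / 4\<close> takes at most half of the linear gain
      \<open>x * g0\<close>.\<close>
    define x where "x = min 1 (2 * g0 / R)"
    have x: "0 < x" "x \<le> 1" using g0 R by (auto simp: x_def)
    have "R * x \<le> 2 * g0" using R by (simp add: x_def min_def field_simps)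
    then have "x * (R * x) \<le> x * (2 * g0)" using x by (intro mult_left_mono) auto
    then have gain: "0 < x * g0 - R * x\<^sup>2 / 4"
      using mult_pos_pos[OF x(1) g0] by (simp add: power2_eq_square mult_ac)
    have "s - (x * g0 - R * x\<^sup>2 / 4) < Sup (f ` Q)" using gain by (simp add: s_def)
    then obtain ps where ps: "ps \<in> Q" "s - (x * g0 - R * x\<^sup>2 / 4) < f ps"
      using less_cSupE[of _ "f ` Q"] Nil by blast
    define \<xi> where "\<xi> = phases ps \<psi>"
    define \<alpha> where "\<alpha> = cinn v0 \<xi>"
    define \<eta> where "\<eta> = \<xi> - csc \<alpha> v0"
    have n\<xi>: "norm \<xi> = R" by (simp add: \<xi>_def R_def norm_phases[OF unit[OF ps(1)]])
    have a\<alpha>: "cmod \<alpha> = f ps" by (simp add: \<alpha>_def f_def \<xi>_def)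
    have \<eta>n: "(norm \<eta>)\<^sup>2 = R\<^sup>2 - (cmod \<alpha>)\<^sup>2"
    proof -
      have "cinn \<xi> (csc \<alpha> v0) = of_real ((cmod \<alpha>)\<^sup>2)"
        by (simp add: cinn_csc_right complex_norm_square \<alpha>_def cinn_commute del: of_real_power)
      then have "Re (cinn \<xi> (csc \<alpha> v0)) = (cmod \<alpha>)\<^sup>2" by simp
      then show ?thesis unfolding \<eta>_def norm_diff_sq by (simp add: norm_csc v0 n\<xi>)
    qed
    have "(cmod \<alpha>)\<^sup>2 \<le> s\<^sup>2" using fs[OF ps(1)] unfolding a\<alpha>[symmetric] by (intro power_mono) auto
    then have "D \<le> (norm \<eta>)\<^sup>2" unfolding \<eta>n D_def by simp
    also have "\<dots> \<le> C * (\<Sum>j<n. (cmod (cinn (u j) \<eta>))\<^sup>2)"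
      unfolding C_def
    proof (rule span_lower_bound[OF o v0])
      obtain c b where "\<xi> = (\<Sum>j<n. csc (c j) (u j)) + csc b v0" using span[OF ps(1)] by (auto simp: in_span_def \<xi>_def)
      then have "\<eta> = (\<Sum>j<n. csc (c j) (u j)) + csc (b - \<alpha>) v0" by (simp add: \<eta>_def csc_diff_left)
      then show "in_span n u v0 \<eta>" unfolding in_span_def by blast
      show "cinn v0 \<eta> = 0" by (simp add: \<eta>_def cinn_diff_right cinn_csc_right cinn_unit[OF v0] \<alpha>_def)
    qed
    finally have Ds: "D \<le> C * (\<Sum>j<n. (cmod (cinn (u j) \<eta>))\<^sup>2)" .
    have "\<exists>j<n. \<gamma> \<le> cmod (cinn (u j) \<eta>)"
    proof (rule ccontr)
      assume "\<not> ?thesis"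
      then have "(\<Sum>j<n. (cmod (cinn (u j) \<eta>))\<^sup>2) \<le> (\<Sum>j<n. \<gamma>\<^sup>2)"
        by (intro sum_mono power_mono) auto
      then have "C * (\<Sum>j<n. (cmod (cinn (u j) \<eta>))\<^sup>2) \<le> C * (real n * \<gamma>\<^sup>2)" using C by (intro mult_left_mono) auto
      also have "\<dots> = D * (real n / (real n + 1))" using C by (simp add: \<gamma>2)
      also have "\<dots> < D * 1" using D by (intro mult_strict_left_mono) (auto simp: divide_less_eq)
      finally show False using Ds by simp
    qed
    then obtain j where j: "j < n" "\<gamma> \<le> cmod (cinn (u j) \<eta>)" by blast
    have "0 \<le> x" "x \<le> 2" using x by auto
    then obtain \<tau> \<theta> where g: "cmod \<alpha> * (1 - x\<^sup>2 / 4) + x * cmod (cinn v0 (u j)) * cmod (cinn (u j) \<eta>)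
        \<le> cmod (cinn v0 (phase (u j) \<theta> (phase v0 \<tau> \<xi>)))"
      using phase_gain[OF v0 orthonormal_norm[OF o, of j], of x \<xi>] unfolding \<eta>_def \<alpha>_def by blast
    define qs where "qs = ps @ [(v0, \<tau>), (u j, \<theta>)]"
    have qs: "qs \<in> Q" using ps(1) j(1) by (auto simp: qs_def Q_def)
    have fq: "f qs = cmod (cinn v0 (phase (u j) \<theta> (phase v0 \<tau> \<xi>)))"
      by (simp add: f_def qs_def \<xi>_def phases_def)
    have "x * g0 \<le> x * (cmod (cinn v0 (u j)) * cmod (cinn (u j) \<eta>))"
      unfolding g0_def using x pmle[OF j(1)] j(2) pm \<gamma> by (intro mult_left_mono mult_mono) auto
    moreover have "cmod \<alpha> * (x\<^sup>2 / 4) \<le> R * (x\<^sup>2 / 4)" using fR[OF ps(1)] a\<alpha> by (intro mult_right_mono) auto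
    ultimately have "f qs \<ge> cmod \<alpha> + (x * g0 - R * x\<^sup>2 / 4)"
      unfolding fq using g by (simp add: algebra_simps)
    then show False using ps(2) fs[OF qs] a\<alpha> by linarith
  qed
  \<comment> \<open>Once a last rotation about \<open>v0\<close> has made the overlap real, the
    squared distance to the target is \<open>2 * R * (R - f ps)\<close>; the threshold makes this
    less than \<open>\<epsilon>^2\<close>.\<close>
  have "R - \<epsilon>\<^sup>2 / (2 * R) < Sup (f ` Q)" using \<open>R \<le> s\<close> R \<open>\<epsilon> > 0\<close> by (simp add: s_def less_le_trans[of _ R])
  then obtain ps where ps: "ps \<in> Q" "R - \<epsilon>\<^sup>2 / (2 * R) < f ps"
    using less_cSupE[of _ "f ` Q"] Nil by blast
  define \<alpha> where "\<alpha> = cinn v0 (phases ps \<psi>)"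
  define \<xi> where "\<xi> = phase v0 (- Arg \<alpha>) (phases ps \<psi>)"
  have "cinn v0 \<xi> = cis (- Arg \<alpha>) * \<alpha>"
    by (simp add: \<xi>_def cinn_phase cinn_unit[OF v0] \<alpha>_def algebra_simps)
  also have "\<dots> = cis (- Arg \<alpha>) * rcis (cmod \<alpha>) (Arg \<alpha>)" by (simp only: rcis_cmod_Arg)
  also have "\<dots> = of_real (cmod \<alpha>)" by (simp add: cis_rcis_eq rcis_mult)
  finally have c\<xi>: "cinn v0 \<xi> = of_real (f ps)" by (simp add: f_def \<alpha>_def)
  have n\<xi>: "norm \<xi> = R" by (simp add: \<xi>_def norm_phase[OF v0] norm_phases[OF unit[OF ps(1)]] R_def)
  have "(norm (\<xi> - csc (of_real R) v0))\<^sup>2 = 2 * R * (R - f ps)"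
  proof -
    have "cinn \<xi> (csc (of_real R) v0) = of_real (R * f ps)"
      using arg_cong[OF c\<xi>, of cnj] by (simp add: cinn_csc_right cinn_commute)
    then have "Re (cinn \<xi> (csc (of_real R) v0)) = R * f ps" by simp
    then show ?thesis unfolding norm_diff_sq using R by (simp add: n\<xi> norm_csc v0 power2_eq_square algebra_simps)
  qed
  also have "\<dots> < 2 * R * (\<epsilon>\<^sup>2 / (2 * R))" using ps(2) R by (intro mult_strict_left_mono) auto
  also have "\<dots> = \<epsilon>\<^sup>2" using R by simp
  finally have "norm (\<xi> - csc (of_real R) v0) < \<epsilon>" using \<open>\<epsilon> > 0\<close> by (simp add: power2_less_imp_less)
  then show ?thesis
    using ps(1) by (intro exI[of _ "ps @ [(v0, - Arg \<alpha>)]"]) (auto simp: phases_snoc \<xi>_def R_def Q_def)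
qed

text \<open>Rotations are isometries, so a finite combination close to \<open>\<psi>\<close> can be
  steered in its place.\<close>

lemma hub_reachable_closure:
  assumes o: "orthonormal u" and v0: "norm v0 = 1" and ne: "\<And>j. cinn v0 (u j) \<noteq> 0"
    and dense: "\<And>\<delta>. \<delta> > 0 \<Longrightarrow> \<exists>n c. norm (\<psi> - (\<Sum>j<n. csc (c j) (u j))) < \<delta>" and "\<epsilon> > 0"
  shows "\<exists>ps. set ps \<subseteq> insert v0 (range u) \<times> UNIV \<and> norm (phases ps \<psi> - csc (of_real (norm \<psi>)) v0) < \<epsilon>"
proof -
  obtain n c where nc: "norm (\<psi> - (\<Sum>j<n. csc (c j) (u j))) < \<epsilon> / 3" using dense[of "\<epsilon> / 3"] \<open>\<epsilon> > 0\<close> by auto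
  define y where "y = (\<Sum>j<n. csc (c j) (u j))"
  have "in_span n u v0 y" unfolding in_span_def y_def by (intro exI[of _ c] exI[of _ 0]) simp
  then obtain ps where ps: "set ps \<subseteq> insert v0 (range u) \<times> UNIV" "norm (phases ps y - csc (of_real (norm y)) v0) < \<epsilon> / 3"
    using hub_reachable[OF o v0 ne, of n y "\<epsilon> / 3"] \<open>\<epsilon> > 0\<close> by auto
  have unit: "\<forall>(v, \<theta>)\<in>set ps. norm v = 1" using ps(1) v0 orthonormal_norm[OF o] by auto
  have "norm (csc (of_real (norm y)) v0 - csc (of_real (norm \<psi>)) v0) = \<bar>norm y - norm \<psi>\<bar>"
    by (simp add: norm_csc v0 flip: csc_diff_left of_real_diff)
  also have "\<dots> \<le> norm (\<psi> - y)" using norm_triangle_ineq3[of \<psi> y] by (simp add: abs_minus_commute)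
  finally have 1: "norm (csc (of_real (norm y)) v0 - csc (of_real (norm \<psi>)) v0) < \<epsilon> / 3" using nc by (simp add: y_def)
  have 2: "norm (phases ps \<psi> - phases ps y) < \<epsilon> / 3" using nc by (simp add: norm_phases_diff[OF unit] y_def)
  have "norm (phases ps \<psi> - csc (of_real (norm \<psi>)) v0) \<le> norm (phases ps \<psi> - phases ps y)
     + norm (phases ps y - csc (of_real (norm y)) v0) + norm (csc (of_real (norm y)) v0 - csc (of_real (norm \<psi>)) v0)"
    using norm_triangle_ineq[of "phases ps \<psi> - phases ps y + (phases ps y - csc (of_real (norm y)) v0)" "csc (of_real (norm y)) v0 - csc (of_real (norm \<psi>)) v0"]
      norm_triangle_ineq[of "phases ps \<psi> - phases ps y" "phases ps y - csc (of_real (norm y)) v0"] by simp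
  then show ?thesis using 1 2 ps by (intro exI[of _ ps]) simp
qed

lemma phases_transitive:
  assumes o: "orthonormal u" and v0: "norm v0 = 1" and ne: "\<And>j. cinn v0 (u j) \<noteq> 0"
    and d1: "\<And>\<delta>. \<delta> > 0 \<Longrightarrow> \<exists>n c. norm (\<psi> - (\<Sum>j<n. csc (c j) (u j))) < \<delta>"
    and d2: "\<And>\<delta>. \<delta> > 0 \<Longrightarrow> \<exists>n c. norm (\<xi> - (\<Sum>j<n. csc (c j) (u j))) < \<delta>"
    and eq: "norm \<psi> = norm \<xi>" and "\<epsilon> > 0"
  shows "\<exists>ps. set ps \<subseteq> insert v0 (range u) \<times> UNIV \<and> norm (phases ps \<psi> - \<xi>) < \<epsilon>"
proof -
  obtain ps where ps: "set ps \<subseteq> insert v0 (range u) \<times> UNIV" "norm (phases ps \<psi> - csc (of_real (norm \<psi>)) v0) < \<epsilon> / 2"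
    using hub_reachable_closure[OF o v0 ne d1, of "\<epsilon> / 2"] \<open>\<epsilon> > 0\<close> by auto
  obtain qs where qs: "set qs \<subseteq> insert v0 (range u) \<times> UNIV" "norm (phases qs \<xi> - csc (of_real (norm \<xi>)) v0) < \<epsilon> / 2"
    using hub_reachable_closure[OF o v0 ne d2, of "\<epsilon> / 2"] \<open>\<epsilon> > 0\<close> by auto
  define rs where "rs = rev (map (\<lambda>(v, \<theta>). (v, - \<theta>)) qs)"
  have uq: "\<forall>(v, \<theta>)\<in>set qs. norm v = 1" using qs(1) v0 orthonormal_norm[OF o] by auto
  then have ur: "\<forall>(v, \<theta>)\<in>set rs. norm v = 1" by (auto simp: rs_def)
  have "norm (phases (ps @ rs) \<psi> - \<xi>) = norm (phases rs (phases ps \<psi>) - phases rs (phases qs \<xi>))"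
    using phases_inverse[OF uq] by (simp add: phases_append rs_def)
  also have "\<dots> = norm (phases ps \<psi> - phases qs \<xi>)" by (rule norm_phases_diff[OF ur])
  also have "\<dots> < \<epsilon>"
    using ps(2) qs(2) norm_triangle_ineq4[of "phases ps \<psi> - csc (of_real (norm \<psi>)) v0" "phases qs \<xi> - csc (of_real (norm \<xi>)) v0"]
    unfolding eq by simp
  finally show ?thesis using ps(1) qs(1) by (intro exI[of _ "ps @ rs"]) (auto simp: rs_def)
qed

subsection \<open>Piecewise constant evolution\<close>

lemma grp_diff: "onb e \<Longrightarrow> grp e l t (u - v) = grp e l t u - grp e l t v"
  unfolding grp_def by (rule diag_diff) simp_all

lemma norm_grp_diff: "onb e \<Longrightarrow> norm (grp e l t u - grp e l t v) = norm (u - v)"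
  by (simp add: norm_grp flip: grp_diff)

lemma norm_triangle_sub_mid: "norm (a - c) \<le> norm (a - b) + norm (b - c)" for a b c :: ltwo
  using norm_triangle_ineq[of "a - b" "b - c"] by simp

definition run :: "('i \<Rightarrow> nat \<Rightarrow> ltwo) \<Rightarrow> ('i \<Rightarrow> nat \<Rightarrow> real) \<Rightarrow> ('i \<times> real) list \<Rightarrow> ltwo \<Rightarrow> ltwo" where
  "run e l cs = fold (\<lambda>(i, t). grp (e i) (l i) t) cs"

text \<open>Errors add up because every step is an isometry. \<open>phase_approx\<close> needs a
  state that is symmetric in the basis at hand; \<open>V\<close> says that this is the same
  condition for all bases, and rotations about even eigenvectors preserve it.\<close>

lemma run_approx_phases:
  assumes e: "\<And>i. onb (e i)" and ind: "\<And>i. indep_even (l i)"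
    and V: "\<And>i j u. (\<And>n. odd n \<Longrightarrow> cinn (e i n) u = 0) \<Longrightarrow> (\<And>n. odd n \<Longrightarrow> cinn (e j n) u = 0)"
    and ps: "set ps \<subseteq> {e i m |i m. even m} \<times> UNIV"
    and \<psi>: "\<And>i n. odd n \<Longrightarrow> cinn (e i n) \<psi> = 0" and "\<epsilon> > 0"
  shows "\<exists>cs. length cs = length ps \<and> (\<forall>(i, t)\<in>set cs. t > 0) \<and> norm (run e l cs \<psi> - phases ps \<psi>) < \<epsilon> \<and>
    (\<forall>i n. odd n \<longrightarrow> cinn (e i n) (phases ps \<psi>) = 0)"
  using ps \<open>\<epsilon> > 0\<close>
proof (induction ps arbitrary: \<epsilon> rule: rev_induct)
  case Nil
  then show ?case using \<psi> by (intro exI[of _ "[]"]) (simp add: run_def)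
next
  case (snoc p ps)
  obtain v \<theta> where p: "p = (v, \<theta>)" by (cases p)
  then obtain i m where v: "v = e i m" "even m" using snoc.prems by auto
  have "\<epsilon> / 2 > 0" using snoc.prems by simp
  then obtain cs where cs: "length cs = length ps" "\<forall>(i, t)\<in>set cs. t > 0" "norm (run e l cs \<psi> - phases ps \<psi>) < \<epsilon> / 2"
    and V0: "\<And>i n. odd n \<Longrightarrow> cinn (e i n) (phases ps \<psi>) = 0"
    using snoc.IH[of "\<epsilon> / 2"] snoc.prems by auto
  obtain t where t: "t > 0" "norm (grp (e i) (l i) t (phases ps \<psi>) - phase (e i m) \<theta> (phases ps \<psi>)) < \<epsilon> / 2"
    using phase_approx[where e="e i" and l="l i" and \<theta>=\<theta>, OF e ind V0 v(2) \<open>\<epsilon> / 2 > 0\<close>] by blast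
  have r: "run e l (cs @ [(i, t)]) \<psi> = grp (e i) (l i) t (run e l cs \<psi>)" by (simp add: run_def)
  have "norm (run e l (cs @ [(i, t)]) \<psi> - phases (ps @ [p]) \<psi>)
     \<le> norm (grp (e i) (l i) t (run e l cs \<psi>) - grp (e i) (l i) t (phases ps \<psi>))
      + norm (grp (e i) (l i) t (phases ps \<psi>) - phase (e i m) \<theta> (phases ps \<psi>))"
    unfolding r p phases_snoc v(1) by (rule norm_triangle_sub_mid)
  also have "\<dots> < \<epsilon>" using cs(3) t(2) by (simp add: norm_grp_diff[OF e])
  finally have 1: "norm (run e l (cs @ [(i, t)]) \<psi> - phases (ps @ [p]) \<psi>) < \<epsilon>" .
  have Vi: "cinn (e i n) (phases (ps @ [p]) \<psi>) = 0" if "odd n" for n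
    using that V0 v by (auto simp: p phases_snoc cinn_phase orthonormal_cinn[OF onb_orthonormal[OF e]])
  have "cinn (e j n) (phases (ps @ [p]) \<psi>) = 0" if "odd n" for j n
    by (rule V[where i=i, OF Vi that])
  then show ?case using cs t(1) 1 by (intro exI[of _ "cs @ [(i, t)]"]) auto
qed

section \<open>The propagator of a sequence of pieces\<close>

definition clampt :: "(nat \<Rightarrow> real) \<Rightarrow> nat \<Rightarrow> real \<Rightarrow> real" where
  "clampt ts j t = max 0 (min (t - ts j) (ts (Suc j) - ts j))"

text \<open>\<open>clampt ts j t\<close> is the time spent in piece \<open>j\<close> up to
  \<open>t\<close>, so \<open>fwd\<close> evolves from 0 to \<open>t\<close> without locating
  \<open>t\<close> among the pieces, and \<open>bwd\<close> inverts it. The propagator from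
  \<open>s\<close> to \<open>t\<close> is \<open>fwd\<close> at \<open>t\<close> after
  \<open>bwd\<close> at \<open>s\<close>, whichever time is later.\<close>

primrec fwd :: "(nat \<Rightarrow> real \<Rightarrow> ltwo \<Rightarrow> ltwo) \<Rightarrow> (nat \<Rightarrow> real) \<Rightarrow> nat \<Rightarrow> real \<Rightarrow> ltwo \<Rightarrow> ltwo" where
  "fwd G ts 0 t u = u"
| "fwd G ts (Suc n) t u = G n (clampt ts n t) (fwd G ts n t u)"

primrec bwd :: "(nat \<Rightarrow> real \<Rightarrow> ltwo \<Rightarrow> ltwo) \<Rightarrow> (nat \<Rightarrow> real) \<Rightarrow> nat \<Rightarrow> real \<Rightarrow> ltwo \<Rightarrow> ltwo" where
  "bwd G ts 0 t u = u"
| "bwd G ts (Suc n) t u = bwd G ts n t (G n (- clampt ts n t) u)"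

text \<open>Isometry makes the estimate in the second argument uniform in \<open>t\<close>, so
  separate continuity suffices.\<close>

lemma isometric_family_continuous:
  fixes H :: "real \<Rightarrow> ltwo \<Rightarrow> ltwo"
  assumes iso: "\<And>t x y. norm (H t x - H t y) = norm (x - y)" and c: "\<And>x. continuous_on UNIV (\<lambda>t. H t x)"
    and f: "continuous_on UNIV f"
  shows "continuous_on UNIV (\<lambda>t. H t (f t))"
proof -
  have "((\<lambda>t. H t (f t)) \<longlongrightarrow> H t0 (f t0)) (at t0)" for t0
  proof -
    have "((\<lambda>t. norm (f t - f t0) + norm (H t (f t0) - H t0 (f t0))) \<longlongrightarrow> 0 + 0) (at t0)"
      using f c[of "f t0"] by (intro tendsto_add tendsto_norm_zero LIM_zero) (auto simp: continuous_on_def)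
    then have z: "((\<lambda>t. norm (f t - f t0) + norm (H t (f t0) - H t0 (f t0))) \<longlongrightarrow> 0) (at t0)" by simp
    have "norm (H t (f t) - H t0 (f t0)) \<le> norm (f t - f t0) + norm (H t (f t0) - H t0 (f t0))" for t
      using norm_triangle_sub_mid[where a="H t (f t)" and b="H t (f t0)" and c="H t0 (f t0)"] by (simp add: iso)
    then have "((\<lambda>t. H t (f t) - H t0 (f t0)) \<longlongrightarrow> 0) (at t0)"
      by (intro Lim_null_comparison[OF _ z]) simp
    then show ?thesis by (rule LIM_zero_cancel)
  qed
  then show ?thesis by (simp add: continuous_on_def)
qed

locale unitary_pieces =
  fixes G :: "nat \<Rightarrow> real \<Rightarrow> ltwo \<Rightarrow> ltwo" and ts :: "nat \<Rightarrow> real"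
  assumes G_norm: "norm (G j t u) = norm u"
    and G_lin: "G j t (csc a u + csc b v) = csc a (G j t u) + csc b (G j t v)"
    and G_add: "G j t (G j s u) = G j (t + s) u"
    and G_0: "G j 0 u = u"
    and G_cont: "continuous_on UNIV (\<lambda>t. G j t u)"
    and ts_0: "ts 0 = 0" and ts_mono: "strict_mono ts"
begin

lemma G_iso: "norm (G j t u - G j t v) = norm (u - v)"
proof -
  have "G j t (u - v) = G j t u - G j t v" using G_lin[of j t 1 u "-1" v] by (simp add: csc_minus_left)
  then show ?thesis by (metis G_norm)
qed

lemma clampt_cont: "continuous_on UNIV (clampt ts j)"
  unfolding clampt_def[abs_def] by (intro continuous_intros)

lemma G_cont_compose: "continuous_on UNIV c \<Longrightarrow> continuous_on UNIV (\<lambda>t. G j (c t) u)"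
  by (rule continuous_on_compose2[OF G_cont]) auto

lemma fwd_norm: "norm (fwd G ts n t u) = norm u"
  by (induction n) (simp_all add: G_norm)

lemma bwd_norm: "norm (bwd G ts n t u) = norm u"
  by (induction n arbitrary: u) (simp_all add: G_norm)

lemma fwd_lin: "fwd G ts n t (csc a u + csc b v) = csc a (fwd G ts n t u) + csc b (fwd G ts n t v)"
  by (induction n) (simp_all add: G_lin)

lemma bwd_lin: "bwd G ts n t (csc a u + csc b v) = csc a (bwd G ts n t u) + csc b (bwd G ts n t v)"
  by (induction n arbitrary: u v) (simp_all add: G_lin)

lemma fwd_iso: "norm (fwd G ts n t u - fwd G ts n t v) = norm (u - v)"
proof -
  have "fwd G ts n t (u - v) = fwd G ts n t u - fwd G ts n t v" using fwd_lin[of n t 1 u "-1" v] by (simp add: csc_minus_left)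
  then show ?thesis by (metis fwd_norm)
qed

lemma bwd_iso: "norm (bwd G ts n t u - bwd G ts n t v) = norm (u - v)"
proof -
  have "bwd G ts n t (u - v) = bwd G ts n t u - bwd G ts n t v" using bwd_lin[of n t 1 u "-1" v] by (simp add: csc_minus_left)
  then show ?thesis by (metis bwd_norm)
qed

lemma fwd_cont: "continuous_on UNIV (\<lambda>t. fwd G ts n t u)"
proof (induction n)
  case (Suc n)
  show ?case unfolding fwd.simps
    by (rule isometric_family_continuous[OF G_iso G_cont_compose[OF clampt_cont] Suc])
qed simp

lemma bwd_cont: "continuous_on UNIV (\<lambda>t. bwd G ts n t u)"
proof (induction n arbitrary: u)
  case (Suc n)
  have "continuous_on UNIV (\<lambda>t. - clampt ts n t)" by (intro continuous_intros clampt_cont)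
  then show ?case unfolding bwd.simps
    by (intro isometric_family_continuous[OF bwd_iso Suc] G_cont_compose)
qed simp

lemma fwd_bwd: "fwd G ts n t (bwd G ts n t u) = u"
  by (induction n arbitrary: u) (simp_all add: G_add G_0)

lemma bwd_fwd: "bwd G ts n t (fwd G ts n t u) = u"
  by (induction n arbitrary: u) (simp_all add: G_add G_0)

lemma fwd_cong: "(\<And>i. i < n \<Longrightarrow> clampt ts i t = clampt ts i s) \<Longrightarrow> fwd G ts n t u = fwd G ts n s u"
  by (induction n) simp_all

lemma fwd_const: "m \<le> n \<Longrightarrow> (\<And>i. m \<le> i \<Longrightarrow> i < n \<Longrightarrow> clampt ts i t = 0) \<Longrightarrow> fwd G ts n t u = fwd G ts m t u"
  by (induction n) (auto simp: G_0 le_Suc_eq)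

lemma bwd_const: "m \<le> n \<Longrightarrow> (\<And>i. m \<le> i \<Longrightarrow> i < n \<Longrightarrow> clampt ts i t = 0) \<Longrightarrow> bwd G ts n t u = bwd G ts m t u"
  by (induction n arbitrary: u) (auto simp: G_0 le_Suc_eq)

lemma ts_le: "i \<le> j \<Longrightarrow> ts i \<le> ts j"
  using ts_mono by (simp add: strict_mono_less_eq)

lemma clampt_late: "Suc i \<le> j \<Longrightarrow> ts j \<le> t \<Longrightarrow> clampt ts i t = ts (Suc i) - ts i"
  using ts_le[of "Suc i" j] ts_le[of i "Suc i"] by (simp add: clampt_def)

lemma clampt_early: "j \<le> i \<Longrightarrow> t \<le> ts j \<Longrightarrow> clampt ts i t = 0"
  using ts_le[of j i] by (simp add: clampt_def)

text \<open>Pieces before \<open>j\<close> have run in full at both times and cancel; those after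
  \<open>j\<close> have not begun.\<close>

lemma propagator_piece:
  assumes "j < n" and t: "t \<in> {ts j..ts (Suc j)}" and s: "s \<in> {ts j..ts (Suc j)}"
  shows "fwd G ts n t (bwd G ts n s u) = G j (t - s) u"
proof -
  have z: "clampt ts i x = 0" if "Suc j \<le> i" "x \<in> {ts j..ts (Suc j)}" for i x
    using clampt_early[OF that(1)] that(2) by simp
  have c: "clampt ts j x = x - ts j" if "x \<in> {ts j..ts (Suc j)}" for x using that by (simp add: clampt_def)
  have "bwd G ts n s u = bwd G ts (Suc j) s u" using assms(1) z[OF _ s] by (intro bwd_const) auto
  moreover have "fwd G ts n t v = fwd G ts (Suc j) t v" for v using assms(1) z[OF _ t] by (intro fwd_const) auto
  moreover have "fwd G ts j t v = fwd G ts j s v" for v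
    using clampt_late t s by (intro fwd_cong) (metis Suc_leI atLeastAtMost_iff)
  ultimately show ?thesis by (simp add: fwd_bwd G_add c[OF t] c[OF s])
qed

lemma fwd_end: "fwd G ts n (ts n) u = fold (\<lambda>i. G i (ts (Suc i) - ts i)) [0..<n] u"
proof -
  have "fwd G ts m t u = fold (\<lambda>i. G i (ts (Suc i) - ts i)) [0..<m] u" if "ts m \<le> t" for m t
    using that
  proof (induction m)
    case (Suc m)
    then show ?case using ts_le[of m "Suc m"] clampt_late[of m "Suc m" t] by simp
  qed simp
  then show ?thesis by simp
qed

lemma bwd_start: "bwd G ts n 0 u = u"
  using bwd_const[of 0 n 0 u] clampt_early[of 0] ts_0 by simp

end

text \<open>A weak solution evaluates the state at \<open>1/2\<close>, so the continuous representative is chosen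
  whenever there is one.\<close>

definition hrep :: "ltwo \<Rightarrow> real \<Rightarrow> complex" where
  "hrep u = (if \<exists>f. H10 f \<and> cls f = u then SOME f. H10 f \<and> cls f = u else rep_ltwo u)"

lemma hrep_H10: "H10 f \<Longrightarrow> cls f = u \<Longrightarrow> H10 (hrep u) \<and> cls (hrep u) = u"
  unfolding hrep_def using someI[of "\<lambda>f. H10 f \<and> cls f = u" f] by auto

lemma hrep_cls: "L2 (hrep u)" "cls (hrep u) = u"
proof -
  have "L2 (hrep u) \<and> cls (hrep u) = u"
  proof (cases "\<exists>f. H10 f \<and> cls f = u")
    case True
    then show ?thesis using hrep_H10 H10_L2 by blast
  next
    case False
    then show ?thesis unfolding hrep_def if_not_P[OF False] by simp
  qed
  then show "L2 (hrep u)" "cls (hrep u) = u" by auto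
qed

lemma l2norm_diff_cls: "L2 f \<Longrightarrow> L2 g \<Longrightarrow> l2norm (\<lambda>x. f x - g x) = norm (cls f - cls g)"
  by (simp add: norm_cls[symmetric] cls_diff L2_diff)

context unitary_pieces
begin

definition evol :: "nat \<Rightarrow> real \<Rightarrow> real \<Rightarrow> (real \<Rightarrow> complex) \<Rightarrow> real \<Rightarrow> complex" where
  "evol n t s f = hrep (fwd G ts n t (bwd G ts n s (cls f)))"

lemma L2_evol: "L2 (evol n t s f)"
  by (simp add: evol_def hrep_cls)

lemma cls_evol: "cls (evol n t s f) = fwd G ts n t (bwd G ts n s (cls f))"
  by (simp add: evol_def hrep_cls)

lemma unitary_propagator_evol: "unitary_propagator T (evol n)"
  unfolding unitary_propagator_def
proof (intro conjI ballI allI impI)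
  fix t s r f g a b
  assume f: "L2 f"
  show "L2 (evol n t s f)" by (rule L2_evol)
  show "l2norm (evol n t s f) = l2norm f" using f by (simp add: norm_cls[symmetric] L2_evol cls_evol fwd_norm bwd_norm)
  show "l2norm (\<lambda>x. evol n t s (evol n s r f) x - evol n t r f x) = 0"
    by (simp add: l2norm_diff_cls L2_evol cls_evol bwd_fwd)
  show "l2norm (\<lambda>x. evol n t t f x - f x) = 0" using f by (simp add: l2norm_diff_cls L2_evol cls_evol fwd_bwd)
  assume g: "L2 g"
  have "L2 (\<lambda>y. a * f y + b * g y)" "cls (\<lambda>y. a * f y + b * g y) = csc a (cls f) + csc b (cls g)"
    using f g by (auto simp: cls_add cls_csc L2_cmult intro: L2_add)
  moreover have "L2 (\<lambda>x. a * evol n t s f x + b * evol n t s g x)"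
    "cls (\<lambda>x. a * evol n t s f x + b * evol n t s g x) = csc a (cls (evol n t s f)) + csc b (cls (evol n t s g))"
    using L2_evol by (auto simp: cls_add cls_csc L2_cmult intro: L2_add)
  ultimately show "l2norm (\<lambda>x. evol n t s (\<lambda>y. a * f y + b * g y) x - (a * evol n t s f x + b * evol n t s g x)) = 0"
    by (simp add: l2norm_diff_cls L2_evol cls_evol fwd_lin bwd_lin)
next
  fix t0 s0 e :: real and f :: "real \<Rightarrow> complex"
  assume "e > 0"
  let ?v = "bwd G ts n s0 (cls f)"
  have "e / 2 > 0" using \<open>e > 0\<close> by simp
  then obtain d1 where d1: "d1 > 0" "\<And>t. dist t t0 < d1 \<Longrightarrow> dist (fwd G ts n t ?v) (fwd G ts n t0 ?v) < e / 2"
    using fwd_cont[of n ?v] unfolding continuous_on_iff by (metis UNIV_I)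
  obtain d2 where d2: "d2 > 0" "\<And>s. dist s s0 < d2 \<Longrightarrow> dist (bwd G ts n s (cls f)) ?v < e / 2"
    using bwd_cont[of n "cls f"] \<open>e / 2 > 0\<close> unfolding continuous_on_iff by (metis UNIV_I)
  show "\<exists>d>0. \<forall>t\<in>{0..T}. \<forall>s\<in>{0..T}. \<bar>t - t0\<bar> < d \<longrightarrow> \<bar>s - s0\<bar> < d \<longrightarrow> l2norm (\<lambda>x. evol n t s f x - evol n t0 s0 f x) < e"
  proof (intro exI[of _ "min d1 d2"] conjI ballI impI)
    fix t s assume "\<bar>t - t0\<bar> < min d1 d2" "\<bar>s - s0\<bar> < min d1 d2"
    then have 1: "norm (fwd G ts n t ?v - fwd G ts n t0 ?v) < e / 2" and 2: "norm (bwd G ts n s (cls f) - ?v) < e / 2"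
      using d1(2)[of t] d2(2)[of s] by (auto simp: dist_norm)
    have "norm (fwd G ts n t (bwd G ts n s (cls f)) - fwd G ts n t0 ?v)
      \<le> norm (fwd G ts n t (bwd G ts n s (cls f)) - fwd G ts n t ?v) + norm (fwd G ts n t ?v - fwd G ts n t0 ?v)"
      by (rule norm_triangle_sub_mid)
    also have "\<dots> < e" using 1 2 by (simp add: fwd_iso)
    finally show "l2norm (\<lambda>x. evol n t s f x - evol n t0 s0 f x) < e"
      by (simp add: l2norm_diff_cls L2_evol cls_evol)
  qed (use d1 d2 in auto)
qed

end

subsection \<open>Approximate controllability\<close>

lemma cls_eigf:
  "quantized \<mu> \<delta> \<Longrightarrow> cls (eigf \<delta> n) = csc (of_real (1 / norm (cls (rpsi \<delta> n)))) (cls (rpsi \<delta> n))"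
  unfolding eigf_def[abs_def] by (rule H10_cmult[OF rpsi_H10])

text \<open>Antisymmetric eigenfunctions do not feel the coupling: up to scaling they are sines of
  the Dirichlet basis. Being symmetric therefore means the same at every coupling.\<close>

lemma cinn_eigf_odd_iff:
  assumes q: "quantized \<mu> \<delta>" and mu: "0 \<le> \<mu>" "\<mu> \<le> 1" and n: "odd n"
  shows "cinn (cls (eigf \<delta> n)) u = 0 \<longleftrightarrow> cinn (fourier.e n) u = 0"
proof -
  have "\<delta> n = 0" using q n by (auto simp: quantized_def)
  then have "rpsi \<delta> n = rpsi (\<lambda>_. 0) n" by (simp add: rpsi_def kap_def)
  moreover have "fourier.e n = csc (of_real (sqrt 2)) (cls (rpsi (\<lambda>_. 0) n))"
    unfolding fourier.e_def by (rule H10_cmult[OF rpsi_H10[OF quantized_0]])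
  ultimately show ?thesis using rpsi_nonzero[OF q mu, of n] by (simp add: cls_eigf[OF q] cinn_csc_left)
qed

lemma H_even_coeff:
  assumes f: "H_even f" and n: "odd n"
  shows "cinn (fourier.e n) (cls f) = 0"
proof -
  have L: "L2 f" using f by (simp add: H_even_def)
  have "cmod (cinn (fourier.e n) (cls f)) \<le> \<delta>" if \<delta>: "\<delta> > 0" for \<delta>
  proof -
    obtain N :: nat and c where Nc: "l2norm (\<lambda>x. f x - (\<Sum>j<N. c j * complex_of_real (sqrt 2 * sin (real (2*j+1) * pi * x)))) < \<delta>"
      using f \<delta> unfolding H_even_def by blast
    define S where "S x = (\<Sum>j<N. c j * (of_real (sqrt 2) * rpsi (\<lambda>_. 0) (2 * j) x))" for x
    have S: "H10 S" "cls S = (\<Sum>j<N. csc (c j) (fourier.e (2 * j)))"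
      unfolding S_def[abs_def] fourier.e_def
      using H10_sum[of "\<lambda>j x. of_real (sqrt 2) * rpsi (\<lambda>_. 0) (2 * j) x" "{..<N}" c, OF fourier.H10_phi] by simp_all
    have "l2norm (\<lambda>x. f x - S x) = l2norm (\<lambda>x. f x - (\<Sum>j<N. c j * complex_of_real (sqrt 2 * sin (real (2*j+1) * pi * x))))"
      unfolding l2norm_def
    proof (rule arg_cong[of _ _ sqrt], rule Bochner_Integration.integral_cong[OF refl])
      fix x assume "x \<in> space unitI"
      then have "x \<in> {0..1}" by simp
      then have "S x = (\<Sum>j<N. c j * complex_of_real (sqrt 2 * sin (real (2*j+1) * pi * x)))"
        unfolding S_def by (simp only: rpsi_0 of_real_mult)
      then show "(cmod (f x - S x))\<^sup>2 = (cmod (f x - (\<Sum>j<N. c j * complex_of_real (sqrt 2 * sin (real (2*j+1) * pi * x)))))\<^sup>2" by simp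
    qed
    then have d: "norm (cls f - cls S) < \<delta>" using Nc L H10_L2[OF S(1)] by (simp add: l2norm_diff_cls)
    have "cinn (fourier.e n) (fourier.e (2 * j)) = 0" for j
      using n orthonormal_cinn[OF fourier.orth, of n "2 * j"] by auto
    then have "cinn (fourier.e n) (cls S) = 0" by (simp add: S(2) cinn_sum_right cinn_csc_right)
    then have "cinn (fourier.e n) (cls f) = cinn (fourier.e n) (cls f - cls S)" by (simp add: cinn_diff_right)
    then have "cmod (cinn (fourier.e n) (cls f)) \<le> norm (cls f - cls S)"
      using cinn_Cauchy_Schwarz[of "fourier.e n" "cls f - cls S"] by (simp add: orthonormal_norm[OF fourier.orth])
    then show ?thesis using d by simp
  qed
  then have "cmod (cinn (fourier.e n) (cls f)) \<le> 0" by (rule field_le_epsilon[of _ 0, simplified])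
  then show ?thesis by simp
qed

lemma even_coeffs_dense:
  assumes e: "onb e" and odd: "\<And>n. odd n \<Longrightarrow> cinn (e n) \<psi> = 0" and "\<delta> > 0"
  shows "\<exists>N c. norm (\<psi> - (\<Sum>j<N. csc (c j) (e (2 * j)))) < \<delta>"
proof -
  define f where "f i = csc (cinn (e i) \<psi>) (e i)" for i
  have "(\<lambda>n. \<Sum>i<n. f i) \<longlonglongrightarrow> \<psi>" using onb_expansion[OF e, of \<psi>] by (simp add: sums_def f_def)
  then obtain N0 where N0: "\<And>n. n \<ge> N0 \<Longrightarrow> norm ((\<Sum>i<n. f i) - \<psi>) < \<delta>"
    using \<open>\<delta> > 0\<close> by (meson LIMSEQ_D)
  have "(\<Sum>i<2 * N. f i) = (\<Sum>j<N. f (2 * j))" for N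
    by (induction N) (simp_all add: odd f_def)
  then have "norm (\<psi> - (\<Sum>j<N0. csc (cinn (e (2 * j)) \<psi>) (e (2 * j)))) < \<delta>"
    using N0[of "2 * N0"] by (simp add: f_def norm_minus_commute)
  then show ?thesis by (intro exI[of _ N0] exI[of _ "\<lambda>j. cinn (e (2 * j)) \<psi>"])
qed

text \<open>If the inner product vanished, both forms would vanish on the pair, each by the
  eigenvalue equation of its own eigenfunction. The forms differ by \<open>\<mu>1 - \<mu>2\<close>
  times a product of values at \<open>1/2\<close>, which are nonzero for even indices.\<close>

lemma eigf_not_orthogonal:
  assumes q1: "quantized \<mu>1 \<delta>1" "0 \<le> \<mu>1" "\<mu>1 \<le> 1" and q2: "quantized \<mu>2 \<delta>2" "0 \<le> \<mu>2" "\<mu>2 \<le> 1"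
    and ne: "\<mu>1 \<noteq> \<mu>2" and ev: "even m" "even n"
  shows "cinn (cls (eigf \<delta>2 m)) (cls (eigf \<delta>1 n)) \<noteq> 0"
proof
  assume z: "cinn (cls (eigf \<delta>2 m)) (cls (eigf \<delta>1 n)) = 0"
  interpret A: eigensys \<mu>1 "eigf \<delta>1" "\<lambda>n. (kap \<delta>1 n)\<^sup>2" by (rule eigensys_eigf[OF q1])
  interpret B: eigensys \<mu>2 "eigf \<delta>2" "\<lambda>n. (kap \<delta>2 n)\<^sup>2" by (rule eigensys_eigf[OF q2])
  have 1: "aform \<mu>1 (eigf \<delta>2 m) (eigf \<delta>1 n) = 0" by (simp add: A.eig[OF B.H10_phi] z)
  have "cinn (cls (eigf \<delta>1 n)) (cls (eigf \<delta>2 m)) = 0" using z by (metis cinn_commute complex_cnj_zero)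
  then have "aform \<mu>2 (eigf \<delta>1 n) (eigf \<delta>2 m) = 0" by (simp add: B.eig[OF A.H10_phi])
  then have 2: "aform \<mu>2 (eigf \<delta>2 m) (eigf \<delta>1 n) = 0" by (metis aform_cnj complex_cnj_zero)
  have "aform \<mu>1 (eigf \<delta>2 m) (eigf \<delta>1 n) - aform \<mu>2 (eigf \<delta>2 m) (eigf \<delta>1 n)
     = of_real (\<mu>1 - \<mu>2) * (cnj (eigf \<delta>2 m (1/2)) * eigf \<delta>1 n (1/2))"
    by (simp add: aform_def algebra_simps)
  then have "eigf \<delta>2 m (1/2) = 0 \<or> eigf \<delta>1 n (1/2) = 0" using 1 2 ne by simp
  then show False
    using psi_half_nonzero[OF q1(1,3) ev(2)] psi_half_nonzero[OF q2(1,3) ev(1)]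
      rpsi_nonzero[OF q1, of n] rpsi_nonzero[OF q2, of m] by (auto simp: eigf_def)
qed

theorem theorem6p2:
  fixes \<epsilon> r :: real and \<Psi>0 \<Psi>1 :: "real \<Rightarrow> complex"
  assumes "\<epsilon> > 0" and "r > 0"
    and "H_even \<Psi>0" and "H_even \<Psi>1"
    and "l2norm \<Psi>0 = l2norm \<Psi>1"
  shows "\<exists>T (\<mu>::real \<Rightarrow> real) (n::nat) (ts::nat \<Rightarrow> real) U.
           T > 0 \<and> piecewise_constant_on T \<mu> n ts \<and>
           (\<forall>t\<in>{0..T}. 0 \<le> \<mu> t \<and> \<mu> t < r) \<and>
           piecewise_weak_solution T \<mu> n ts U \<and>
           l2norm (\<lambda>x. \<Psi>1 x - U T 0 \<Psi>0 x) < \<epsilon>"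
proof -
  obtain \<mu>1 \<mu>2 \<delta>1 \<delta>2 where m: "0 < \<mu>1" "\<mu>1 < r" "\<mu>1 \<le> 1" "0 < \<mu>2" "\<mu>2 < r" "\<mu>2 \<le> 1" "\<mu>1 \<noteq> \<mu>2"
    "quantized \<mu>1 \<delta>1" "quantized \<mu>2 \<delta>2" "indep_even (\<lambda>n. (kap \<delta>1 n)\<^sup>2)" "indep_even (\<lambda>n. (kap \<delta>2 n)\<^sup>2)"
    by (rule generic_controls[OF \<open>r > 0\<close>])
  define mu where "mu i = (if i then \<mu>1 else \<mu>2)" for i
  define dl where "dl i = (if i then \<delta>1 else \<delta>2)" for i
  define l where "l i n = (kap (dl i) n)\<^sup>2" for i n
  define e where "e i n = cls (eigf (dl i) n)" for i n
  have mu: "0 \<le> mu i" "mu i \<le> 1" "mu i < r" and q: "quantized (mu i) (dl i)" for i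
    using m by (auto simp: mu_def dl_def)
  have ind: "indep_even (l i)" for i using m by (simp add: l_def[abs_def] dl_def)
  have es: "eigensys (mu i) (eigf (dl i)) (l i)" for i
    using eigensys_eigf[OF q mu(1,2)] by (simp add: l_def[abs_def])
  have ees: "eigensys.e (eigf (dl i)) = e i" for i
    by (rule ext) (simp add: eigensys.e_def[OF es] e_def)
  have onb: "onb (e i)" for i using eigensys.onb_e[OF es] by (simp add: ees)
  have L: "L2 \<Psi>0" "L2 \<Psi>1" using assms by (auto simp: H_even_def)
  define \<psi> \<xi> where "\<psi> = cls \<Psi>0" and "\<xi> = cls \<Psi>1"
  have V: "cinn (e i n) \<psi> = 0" "cinn (e i n) \<xi> = 0" if "odd n" for i n
    using cinn_eigf_odd_iff[OF q mu(1,2) that] H_even_coeff[OF assms(3) that] H_even_coeff[OF assms(4) that]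
    by (simp_all add: e_def \<psi>_def \<xi>_def)
  have Vtr: "cinn (e j n) u = 0" if "\<And>n. odd n \<Longrightarrow> cinn (e i n) u = 0" "odd n" for i j u n
    using that(1)[OF that(2)] cinn_eigf_odd_iff[OF q mu(1,2) that(2)] unfolding e_def by blast
  \<comment> \<open>The hub is the ground state at coupling \<open>\<mu>2\<close>; the
    \<open>u j\<close> are the symmetric eigenvectors at \<open>\<mu>1\<close>.\<close>
  define v0 where "v0 = e False 0"
  define u where "u j = e True (2 * j)" for j
  have o: "orthonormal u"
    using orthonormal_cinn[OF onb_orthonormal[OF onb[of True]]] by (simp add: orthonormal_def u_def)
  have v0: "norm v0 = 1" unfolding v0_def by (rule orthonormal_norm[OF onb_orthonormal[OF onb]])
  have ne: "cinn v0 (u j) \<noteq> 0" for j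
    unfolding v0_def u_def e_def dl_def using m by (simp add: eigf_not_orthogonal[of \<mu>1 \<delta>1 \<mu>2 \<delta>2])
  have d1: "\<exists>N c. norm (\<psi> - (\<Sum>j<N. csc (c j) (u j))) < \<delta>" if "\<delta> > 0" for \<delta>
    unfolding u_def by (rule even_coeffs_dense[OF onb V(1) that])
  have d2: "\<exists>N c. norm (\<xi> - (\<Sum>j<N. csc (c j) (u j))) < \<delta>" if "\<delta> > 0" for \<delta>
    unfolding u_def by (rule even_coeffs_dense[OF onb V(2) that])
  have "norm \<psi> = norm \<xi>" using assms(5) L by (simp add: \<psi>_def \<xi>_def norm_cls)
  then obtain ps where ps: "set ps \<subseteq> insert v0 (range u) \<times> UNIV" "norm (phases ps \<psi> - \<xi>) < \<epsilon> / 2"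
    using phases_transitive[OF o v0 ne d1 d2, of "\<epsilon> / 2"] \<open>\<epsilon> > 0\<close> by auto
  \<comment> \<open>The rotation by angle 0 guarantees at least one piece, and so a positive final
    time.\<close>
  define ps' where "ps' = ps @ [(v0, 0)]"
  have ps': "phases ps' \<psi> = phases ps \<psi>" by (simp add: ps'_def phases_snoc phase_def)
  have ev: "insert v0 (range u) \<subseteq> {e i m |i m. even m}" unfolding v0_def u_def by fastforce
  have "set ps' \<subseteq> insert v0 (range u) \<times> UNIV" using ps(1) by (auto simp: ps'_def)
  also have "\<dots> \<subseteq> {e i m |i m. even m} \<times> UNIV" by (intro Sigma_mono ev order_refl)
  finally have sub: "set ps' \<subseteq> {e i m |i m. even m} \<times> UNIV" .
  obtain cs where cs: "length cs = length ps'" "\<forall>(i, t)\<in>set cs. t > 0" "norm (run e l cs \<psi> - phases ps' \<psi>) < \<epsilon> / 2"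
  proof -
    have "\<exists>cs. length cs = length ps' \<and> (\<forall>(i, t)\<in>set cs. t > 0) \<and> norm (run e l cs \<psi> - phases ps' \<psi>) < \<epsilon> / 2 \<and>
        (\<forall>i n. odd n \<longrightarrow> cinn (e i n) (phases ps' \<psi>) = 0)"
    proof (rule run_approx_phases)
      show "cinn (e j n) u = 0" if "\<And>n. odd n \<Longrightarrow> cinn (e i n) u = 0" "odd n" for i j u n
        using that by (rule Vtr)
    qed (use onb ind sub V(1) \<open>\<epsilon> > 0\<close> in simp_all)
    then show ?thesis using that by blast
  qed
  define n where "n = length cs"
  have n: "n > 0" by (simp add: n_def cs ps'_def)
  define idx where "idx j = (if j < n then fst (cs ! j) else True)" for j
  \<comment> \<open>Beyond the last piece the length 1 keeps \<open>ts\<close> strictly increasing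
    on all indices.\<close>
  define \<tau> where "\<tau> j = (if j < n then snd (cs ! j) else 1)" for j
  have \<tau>: "\<tau> j > 0" for j using cs(2) nth_mem[of j cs] by (auto simp: \<tau>_def n_def split_beta)
  define ts where "ts j = (\<Sum>i<j. \<tau> i)" for j
  define G where "G j = grp (e (idx j)) (l (idx j))" for j
  interpret unitary_pieces G ts
  proof
    show "strict_mono ts" using \<tau> by (simp add: strict_mono_Suc_iff ts_def)
  qed (simp_all add: G_def norm_grp[OF onb] grp_linear[OF onb] grp_grp[OF onb] grp_0[OF onb] continuous_grp[OF onb] ts_def)
  \<comment> \<open>At the final time the least index is \<open>n\<close>, whose default coupling
    also lies in the allowed range.\<close>
  define \<mu> where "\<mu> t = mu (idx (LEAST j. t < ts (Suc j)))" for t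
  have \<mu>: "\<mu> t = mu (idx j)" if "ts j \<le> t" "t < ts (Suc j)" for j t
  proof -
    have "(LEAST j. t < ts (Suc j)) = j"
    proof (rule Least_equality)
      fix y assume "t < ts (Suc y)"
      then show "j \<le> y" using that(1) ts_le[of "Suc y" j] by (metis not_less_eq_eq not_le order_trans)
    qed (rule that(2))
    then show ?thesis by (simp add: \<mu>_def)
  qed
  have "ts n > ts 0" using n ts_mono by (simp add: strict_mono_less)
  then have T: "ts n > 0" by (simp add: ts_0)
  have pc: "piecewise_constant_on (ts n) \<mu> n ts"
    unfolding piecewise_constant_on_def
  proof (intro conjI allI impI)
    show "ts j < ts (Suc j)" for j using ts_mono by (simp add: strict_mono_Suc_iff)
    show "\<exists>c. \<forall>t\<in>{ts j..<ts (Suc j)}. \<mu> t = c" for j using \<mu> by (intro exI[of _ "mu (idx j)"]) auto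
  qed (simp_all add: ts_0)
  have weak: "piecewise_weak_solution (ts n) \<mu> n ts (evol n)"
    unfolding piecewise_weak_solution_def
  proof (intro conjI allI impI ballI unitary_propagator_evol)
    fix j s t and \<Psi> :: "real \<Rightarrow> complex"
    assume j: "j < n" and s: "s \<in> {ts j..ts (Suc j)}" and \<Psi>: "H10 \<Psi>" and t: "t \<in> {ts j<..<ts (Suc j)}"
    interpret E: eigensys "mu (idx j)" "eigf (dl (idx j))" "l (idx j)" by (rule es)
    have ee: "E.e = e (idx j)" by (rule ees)
    have piece: "cls (evol n x s \<Psi>) = G j (x - s) (cls \<Psi>)" if "x \<in> {ts j<..<ts (Suc j)}" for x
      unfolding cls_evol by (rule propagator_piece[OF j _ s]) (use that in auto)
    obtain f where f: "H10 f" "cls f = G j (t - s) (cls \<Psi>)"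
      using E.grp_H10[OF \<Psi>, of "t - s"] unfolding ee G_def by blast
    have ct: "fwd G ts n t (bwd G ts n s (cls \<Psi>)) = G j (t - s) (cls \<Psi>)"
      using piece[OF t] by (simp add: cls_evol)
    show H: "H10 (evol n t s \<Psi>)" unfolding evol_def ct using hrep_H10[OF f] by blast
    fix \<Phi> assume \<Phi>: "H10 \<Phi>"
    obtain D where D: "((\<lambda>\<tau>. cinn (cls \<Phi>) (G j \<tau> (cls \<Psi>))) has_vector_derivative D) (at (t - s))"
      and iD: "\<i> * D = aform (mu (idx j)) \<Phi> (evol n t s \<Psi>)"
      using E.grp_weak_solution[OF \<Phi> \<Psi> H, of "t - s"] piece[OF t] unfolding ee G_def by blast
    have "((\<lambda>x. x - s) has_vector_derivative 1) (at t)"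
      by (auto intro!: derivative_eq_intros)
    from vector_diff_chain_at[OF this D]
    have D': "((\<lambda>x. cinn (cls \<Phi>) (G j (x - s) (cls \<Psi>))) has_vector_derivative D) (at t)"
      by (simp add: o_def)
    have "((\<lambda>x. l2inner \<Phi> (evol n x s \<Psi>)) has_vector_derivative D) (at t)"
    proof (rule has_vector_derivative_transform_within_open[OF D' open_greaterThanLessThan t])
      fix x assume "x \<in> {ts j<..<ts (Suc j)}"
      then show "cinn (cls \<Phi>) (G j (x - s) (cls \<Psi>)) = l2inner \<Phi> (evol n x s \<Psi>)"
        using piece cinn_cls[OF H10_L2[OF \<Phi>] L2_evol] by metis
    qed
    moreover have "\<i> * D = h0 \<Phi> (evol n t s \<Psi>) + complex_of_real (\<mu> t) * h1 \<Phi> (evol n t s \<Psi>)"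
      using iD \<mu>[of j t] t by (simp add: aform_eq[OF \<Phi> H])
    ultimately show "\<exists>D. ((\<lambda>\<tau>. l2inner \<Phi> (evol n \<tau> s \<Psi>)) has_vector_derivative D) (at t) \<and>
        \<i> * D = h0 \<Phi> (evol n t s \<Psi>) + complex_of_real (\<mu> t) * h1 \<Phi> (evol n t s \<Psi>)" by blast
  qed
  have fin: "cls (evol n (ts n) 0 \<Psi>0) = run e l cs \<psi>"
  proof -
    have "cs = map (\<lambda>j. (idx j, \<tau> j)) [0..<n]"
      by (rule nth_equalityI) (auto simp: n_def idx_def \<tau>_def)
    then have "run e l cs \<psi> = fold (\<lambda>(i, t). grp (e i) (l i) t) (map (\<lambda>j. (idx j, \<tau> j)) [0..<n]) \<psi>"
      by (simp add: run_def)
    also have "\<dots> = fold (\<lambda>j. G j (ts (Suc j) - ts j)) [0..<n] \<psi>"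
      by (simp add: fold_map o_def G_def ts_def)
    finally show ?thesis by (simp add: cls_evol bwd_start fwd_end \<psi>_def)
  qed
  have "l2norm (\<lambda>x. \<Psi>1 x - evol n (ts n) 0 \<Psi>0 x) = norm (\<xi> - run e l cs \<psi>)"
    using L by (simp add: l2norm_diff_cls L2_evol fin \<xi>_def)
  also have "\<dots> \<le> norm (\<xi> - phases ps \<psi>) + norm (phases ps \<psi> - run e l cs \<psi>)" by (rule norm_triangle_sub_mid)
  also have "\<dots> < \<epsilon>" using ps(2) cs(3) by (simp add: ps' norm_minus_commute)
  finally have close: "l2norm (\<lambda>x. \<Psi>1 x - evol n (ts n) 0 \<Psi>0 x) < \<epsilon>" .
  have "\<forall>t\<in>{0..ts n}. 0 \<le> \<mu> t \<and> \<mu> t < r" using mu by (simp add: \<mu>_def)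
  then show ?thesis using T pc weak close by blast
qed

end
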